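(* Let $0<C<\infty$, let $M\ge 1$ be an integer, let $N\ge 2M$ be a multiple of $M$, and let $\rho$ be a probability density on $[-C,C]$ with $\rho(-v)=\rho(v)$. Consider the Gaussian two-armed bandit with horizon $N$, controlled by strategies that apply each chosen action $M$ times in a row, with prior density $\nu_a(m,v)=\kappa_a(m)\rho(v)$, where $\kappa_a$ is the uniform density on $[-a,a]$ and $a\to\infty$. For $\ell=1,2$, real $U$, and integers $n_1,n_2\ge M$ that are multiples of $M$ with $n=n_1+n_2\le N$, put $$g^{(\ell)}(U,n_1,n_2)=\int_0^C 2v\exp\left((-1)^{\ell}2Uv-2v^2n_1n_2n^{-1}\right)\rho(v)\,dv,$$ and define recursively $$R_M(U,n_1,n_2)=\min_{\ell=1,2}R^{(\ell)}_M(U,n_1,n_2),$$ where $R^{(1)}_M(U,n_1,n_2)=R^{(2)}_M(U,n_1,n_2)=0$ if $n_1+n_2=N$, and, if $n_1+n_2<N$, $$R^{(1)}_M(U,n_1,n_2)=M g^{(1)}(U,n_1,n_2)+\int_{-\infty}^{\infty}R_M(U-x,n_1+M,n_2)\,f_{Mn_2^2n^{-1}(n+M)^{-1}}(x)\,dx,$$ $$R^{(2)}_M(U,n_1,n_2)=M g^{(2)}(U,n_1,n_2)+\int_{-\infty}^{\infty}R_M(U-x,n_1,n_2+M)\,f_{Mn_1^2n^{-1}(n+M)^{-1}}(x)\,dx.$$ Then the following strategy is Bayesian in the limit $a\to\infty$. At the initial stage $n\le 2M$ it applies the actions turn-by-turn (one packet of $M$ applications of each action). Afterwards, if the history is $(X_1,n_1,X_2,n_2)$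 with $n_1,n_2\ge M$, $n=n_1+n_2<N$, and $U=(X_1n_2-X_2n_1)n^{-1}$, the $\ell$-th action is currently optimal if and only if $R^{(\ell)}_M(U,n_1,n_2)$ is the smaller of $R^{(1)}_M(U,n_1,n_2)$ and $R^{(2)}_M(U,n_1,n_2)$ (if the two values are equal, both actions are optimal and the choice is arbitrary). The corresponding Bayesian risk satisfies $$\lim_{a\to\infty}R^B_N(\nu_a)=R^B_N(\rho):=4M\int_0^C v\rho(v)\,dv+\int_{-\infty}^{\infty}R_M(U,M,M)\,f_{0.5M}(U)\,dU.$$
   Context: Notation: $f_D(x|m)=(2\pi D)^{-1/2}\exp\{-(x-m)^2/(2D)\}$ for $D>0$, and $f_D(x)=f_D(x|0)$. Gaussian two-armed bandit: at each time $n=1,\dots,N$ an action $y_n\in\{1,2\}$ is chosen and an income $\xi_n$ is received. Given $y_n=\ell$, $\xi_n$ is normal with mean $m_\ell$ and variance $1$, independently of the past. The unknown parameter is $\theta=(m_1,m_2)$, parameterized as $m_1=m+v$, $m_2=m-v$ with $|v|\le C$. Strategies: a strategy $\sigma$ assigns to each history of past actions and incomes the (possibly random) choice of the next action. Only strategies applying each chosen action $M$ times are considered: the $N$ steps are divided into $N/M$ consecutive packets of length $M$, the same action is used throughout a packet, and it is chosen on the basis of the history before the packet. Loss: $L_N(\sigma,\theta)=N\max(m_1,m_2)-\mathbb{E}_{\sigma,\theta}\left(\sum_{n=1}^N\xi_n\right)$. Bayesian risk: for a prior density $\nu(m,v)$, $R^B_N(\nu)=\inf_\sigma\iint L_N(\sigma,(m+v,m-v))\,\nu(m,v)\,dm\,dv$,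 the infimum being over all (possibly randomized) strategies $\sigma$ that use the same action throughout each of the $N/M$ consecutive packets of length $M$, this action being chosen on the basis of the history before the packet. History: after $n$ steps it is summarized by $(X_1,n_1,X_2,n_2)$, where $n_\ell$ is the number of applications of action $\ell$ so far ($n_1+n_2=n$) and $X_\ell$ is the total income obtained from action $\ell$. Limiting Bayesian strategy: a strategy $\sigma$ is Bayesian in the limit $a\to\infty$ if $\iint L_N(\sigma,(m+v,m-v))\,\nu_a(m,v)\,dm\,dv-R^B_N(\nu_a)\to0$ as $a\to\infty$. For a history with $n_1,n_2\ge M$, the posterior is taken with respect to the prior that is formally constant in $m$, i.e. the posterior density of $(m,v)\in\mathbb{R}\times[-C,C]$ is proportional to $f_{n_1}(X_1|n_1(m+v))\,f_{n_2}(X_2|n_2(m-v))\,\rho(v)$. An action is currently optimal after that history if applying it in the next packet and continuing optimally minimizes, over all continuations, the posterior expected loss $\mathbb{E}\sum_{k=n+1}^{N}\left(\max(m_1,m_2)-m_{y_k}\right)$ over the remaining $N-n$ steps. *)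

theory Defs
  imports "HOL-Probability.Probability"
begin

definition gauss :: "real \<Rightarrow> real \<Rightarrow> real \<Rightarrow> real" where
  "gauss D m x = normal_density m (sqrt D) x"


section \<open>The bandit\<close>

datatype arm = Arm1 | Arm2

fun other_arm :: "arm \<Rightarrow> arm" where
  "other_arm Arm1 = Arm2"
| "other_arm Arm2 = Arm1"

text \<open>
  A parameter is a pair \<open>\<theta> = (m\<^sub>1, m\<^sub>2)\<close>.  Time is counted from 0: entry \<open>k\<close> of a history is the
  (action, income) pair of step \<open>k + 1\<close>, so the history after \<open>n\<close> steps is a point of
  \<open>hist_space n\<close> (a function on \<open>{0..<n}\<close>, equal to \<open>undefined\<close> elsewhere).
\<close>

fun arm_mean :: "real \<times> real \<Rightarrow> arm \<Rightarrow> real" where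
  "arm_mean (m1, m2) Arm1 = m1"
| "arm_mean (m1, m2) Arm2 = m2"

definition best_mean :: "real \<times> real \<Rightarrow> real" where
  "best_mean \<theta> = max (arm_mean \<theta> Arm1) (arm_mean \<theta> Arm2)"

type_synonym history = "nat \<Rightarrow> arm \<times> real"

definition obs :: "(arm \<times> real) measure" where
  "obs = count_space UNIV \<Otimes>\<^sub>M borel"

definition hist_space :: "nat \<Rightarrow> history measure" where
  "hist_space n = PiM {0..<n} (\<lambda>_. obs)"

type_synonym strategy = "nat \<Rightarrow> history \<Rightarrow> arm pmf"

text \<open>
  \<open>\<sigma> n h\<close> is the law of the action of step \<open>n + 1\<close> given the history \<open>h\<close> of the first \<open>n\<close> steps.
  Strategies are defined at all times; with horizon \<open>N\<close> only the times \<open>n < N\<close> are ever used.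
\<close>

definition packet_strategies :: "nat \<Rightarrow> strategy set" where
  "packet_strategies M = {\<sigma>.
     (\<forall>n. (\<lambda>h. measure_pmf (\<sigma> n h)) \<in> hist_space n \<rightarrow>\<^sub>M subprob_algebra (count_space UNIV)) \<and>
     (\<forall>n. \<forall>h \<in> space (hist_space n). \<not> M dvd n \<longrightarrow> \<sigma> n h = return_pmf (fst (h (n - 1))))}"

definition step_law :: "strategy \<Rightarrow> real \<times> real \<Rightarrow> nat \<Rightarrow> history \<Rightarrow> (arm \<times> real) measure" where
  "step_law \<sigma> \<theta> n h = measure_pmf (\<sigma> n h) \<bind>
     (\<lambda>l. distr (density lborel (\<lambda>x. ennreal (gauss 1 (arm_mean \<theta> l) x))) obs (Pair l))"

text \<open>The law of the first \<open>n + k\<close> steps, given that the first \<open>n\<close> steps produced the history \<open>h\<close>.\<close>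

definition path_law :: "strategy \<Rightarrow> real \<times> real \<Rightarrow> nat \<Rightarrow> nat \<Rightarrow> history \<Rightarrow> history measure" where
  "path_law \<sigma> \<theta> n k h = Ionescu_Tulcea.C (step_law \<sigma> \<theta>) (\<lambda>_. obs) n k h"

definition loss :: "nat \<Rightarrow> strategy \<Rightarrow> real \<times> real \<Rightarrow> real" where
  "loss N \<sigma> \<theta> = real N * best_mean \<theta>
     - (\<integral>\<omega>. (\<Sum>k<N. snd (\<omega> k)) \<partial>path_law \<sigma> \<theta> 0 N (\<lambda>_. undefined))"


section \<open>Bayesian risk\<close>

definition bayes_loss :: "nat \<Rightarrow> (real \<Rightarrow> real \<Rightarrow> real) \<Rightarrow> strategy \<Rightarrow> real" where
  "bayes_loss N \<nu> \<sigma> = (\<integral>(m, v). loss N \<sigma> (m + v, m - v) * \<nu> m v \<partial>(lborel \<Otimes>\<^sub>M lborel))"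

definition bayes_risk :: "nat \<Rightarrow> nat \<Rightarrow> (real \<Rightarrow> real \<Rightarrow> real) \<Rightarrow> real" where
  "bayes_risk M N \<nu> = (INF \<sigma>\<in>packet_strategies M. bayes_loss N \<nu> \<sigma>)"

definition uniform_prior :: "(real \<Rightarrow> real) \<Rightarrow> real \<Rightarrow> real \<Rightarrow> real \<Rightarrow> real" where
  "uniform_prior \<rho> a m v = indicator {-a..a} m / (2 * a) * \<rho> v"

definition bayesian_in_limit :: "nat \<Rightarrow> nat \<Rightarrow> (real \<Rightarrow> real) \<Rightarrow> strategy \<Rightarrow> bool" where
  "bayesian_in_limit M N \<rho> \<sigma> \<longleftrightarrow>
     ((\<lambda>a. bayes_loss N (uniform_prior \<rho> a) \<sigma> - bayes_risk M N (uniform_prior \<rho> a)) \<longlongrightarrow> 0) at_top"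


section \<open>Currently optimal actions\<close>

definition arm_count :: "nat \<Rightarrow> history \<Rightarrow> arm \<Rightarrow> nat" where
  "arm_count n h l = card {k. k < n \<and> fst (h k) = l}"

definition arm_income :: "nat \<Rightarrow> history \<Rightarrow> arm \<Rightarrow> real" where
  "arm_income n h l = (\<Sum>k | k < n \<and> fst (h k) = l. snd (h k))"

text \<open>Histories consisting of complete packets.\<close>

definition packet_histories :: "nat \<Rightarrow> nat \<Rightarrow> history set" where
  "packet_histories M n = {h \<in> space (hist_space n). M dvd n \<and>
     (\<forall>k<n. \<not> M dvd k \<longrightarrow> fst (h k) = fst (h (k - 1)))}"

definition posterior_weight :: "(real \<Rightarrow> real) \<Rightarrow> nat \<Rightarrow> history \<Rightarrow> real \<Rightarrow> real \<Rightarrow> real" where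
  "posterior_weight \<rho> n h m v =
     gauss (real (arm_count n h Arm1)) (real (arm_count n h Arm1) * (m + v)) (arm_income n h Arm1) *
     gauss (real (arm_count n h Arm2)) (real (arm_count n h Arm2) * (m - v)) (arm_income n h Arm2) * \<rho> v"

definition posterior_density :: "(real \<Rightarrow> real) \<Rightarrow> nat \<Rightarrow> history \<Rightarrow> real \<Rightarrow> real \<Rightarrow> real" where
  "posterior_density \<rho> n h m v = posterior_weight \<rho> n h m v /
     (\<integral>(m', v'). posterior_weight \<rho> n h m' v' \<partial>(lborel \<Otimes>\<^sub>M lborel))"

definition remaining_loss :: "nat \<Rightarrow> strategy \<Rightarrow> nat \<Rightarrow> history \<Rightarrow> real \<times> real \<Rightarrow> real" where
  "remaining_loss N \<tau> n h \<theta> =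
     (\<integral>\<omega>. (\<Sum>k=n..<N. best_mean \<theta> - arm_mean \<theta> (fst (\<omega> k))) \<partial>path_law \<tau> \<theta> n (N - n) h)"

definition posterior_loss :: "nat \<Rightarrow> (real \<Rightarrow> real) \<Rightarrow> strategy \<Rightarrow> nat \<Rightarrow> history \<Rightarrow> real" where
  "posterior_loss N \<rho> \<tau> n h =
     (\<integral>(m, v). remaining_loss N \<tau> n h (m + v, m - v) * posterior_density \<rho> n h m v
        \<partial>(lborel \<Otimes>\<^sub>M lborel))"

text \<open>
  The continuations after \<open>h\<close> are the packet strategies, of which \<open>posterior_loss\<close> only sees the
  choices from time \<open>n\<close> on.
\<close>

definition currently_optimal ::
    "nat \<Rightarrow> nat \<Rightarrow> (real \<Rightarrow> real) \<Rightarrow> nat \<Rightarrow> history \<Rightarrow> arm \<Rightarrow> bool" where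
  "currently_optimal M N \<rho> n h l \<longleftrightarrow>
     (\<exists>\<tau> \<in> packet_strategies M. \<tau> n h = return_pmf l \<and>
        (\<forall>\<tau>' \<in> packet_strategies M. posterior_loss N \<rho> \<tau> n h \<le> posterior_loss N \<rho> \<tau>' n h))"


section \<open>The recursion\<close>

fun arm_sign :: "arm \<Rightarrow> real" where
  "arm_sign Arm1 = -1"
| "arm_sign Arm2 = 1"

definition g_fun :: "real \<Rightarrow> (real \<Rightarrow> real) \<Rightarrow> arm \<Rightarrow> real \<Rightarrow> nat \<Rightarrow> nat \<Rightarrow> real" where
  "g_fun C \<rho> l U n1 n2 =
     (LINT v:{0..C}|lborel. 2 * v * exp (arm_sign l * 2 * U * v
        - 2 * v\<^sup>2 * real n1 * real n2 / real (n1 + n2)) * \<rho> v)"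

text \<open>
  The recursion is only meant for \<open>0 < M\<close> and \<open>n\<^sub>1 + n\<^sub>2 \<le> N\<close>; outside this range all values are 0.
\<close>

function R_arm :: "real \<Rightarrow> (real \<Rightarrow> real) \<Rightarrow> nat \<Rightarrow> nat \<Rightarrow> arm \<Rightarrow> real \<Rightarrow> nat \<Rightarrow> nat \<Rightarrow> real"
  and R_min :: "real \<Rightarrow> (real \<Rightarrow> real) \<Rightarrow> nat \<Rightarrow> nat \<Rightarrow> real \<Rightarrow> nat \<Rightarrow> nat \<Rightarrow> real"
where
  "R_arm C \<rho> M N Arm1 U n1 n2 =
     (if 0 < M \<and> n1 + n2 < N
      then real M * g_fun C \<rho> Arm1 U n1 n2 +
        (\<integral>x. R_min C \<rho> M N (U - x) (n1 + M) n2 *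
           gauss (real M * (real n2)\<^sup>2 / (real (n1 + n2) * real (n1 + n2 + M))) 0 x \<partial>lborel)
      else 0)"
| "R_arm C \<rho> M N Arm2 U n1 n2 =
     (if 0 < M \<and> n1 + n2 < N
      then real M * g_fun C \<rho> Arm2 U n1 n2 +
        (\<integral>x. R_min C \<rho> M N (U - x) n1 (n2 + M) *
           gauss (real M * (real n1)\<^sup>2 / (real (n1 + n2) * real (n1 + n2 + M))) 0 x \<partial>lborel)
      else 0)"
| "R_min C \<rho> M N U n1 n2 = min (R_arm C \<rho> M N Arm1 U n1 n2) (R_arm C \<rho> M N Arm2 U n1 n2)"
  by pat_completeness auto
termination
  by (relation "Wellfounded.measure (case_sum
       (\<lambda>(C, \<rho>, M, N, l, U, n1, n2). 2 * (N - (n1 + n2)))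
       (\<lambda>(C, \<rho>, M, N, U, n1, n2). Suc (2 * (N - (n1 + n2)))))") auto

declare R_arm.simps [simp del] R_min.simps [simp del]

definition U_stat :: "nat \<Rightarrow> history \<Rightarrow> real" where
  "U_stat n h = (arm_income n h Arm1 * real (arm_count n h Arm2)
     - arm_income n h Arm2 * real (arm_count n h Arm1)) / real n"

definition R_rule :: "real \<Rightarrow> (real \<Rightarrow> real) \<Rightarrow> nat \<Rightarrow> nat \<Rightarrow> nat \<Rightarrow> history \<Rightarrow> arm \<Rightarrow> bool" where
  "R_rule C \<rho> M N n h l \<longleftrightarrow>
     R_arm C \<rho> M N l (U_stat n h) (arm_count n h Arm1) (arm_count n h Arm2) \<le>
     R_arm C \<rho> M N (other_arm l) (U_stat n h) (arm_count n h Arm1) (arm_count n h Arm2)"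

text \<open>
  The initial stage applies each action for one packet, in either order; ties in the rule are
  resolved arbitrarily, possibly at random.
\<close>

definition limiting_strategies :: "real \<Rightarrow> (real \<Rightarrow> real) \<Rightarrow> nat \<Rightarrow> nat \<Rightarrow> strategy set" where
  "limiting_strategies C \<rho> M N = {\<sigma> \<in> packet_strategies M.
     (\<forall>h \<in> packet_histories M M. \<sigma> M h = return_pmf (other_arm (fst (h 0)))) \<and>
     (\<forall>n h. 2 * M \<le> n \<and> n < N \<and> h \<in> packet_histories M n \<and>
        M \<le> arm_count n h Arm1 \<and> M \<le> arm_count n h Arm2 \<longrightarrow>
        (\<forall>l \<in> set_pmf (\<sigma> n h). R_rule C \<rho> M N n h l))}"

definition limit_risk :: "real \<Rightarrow> (real \<Rightarrow> real) \<Rightarrow> nat \<Rightarrow> nat \<Rightarrow> real" where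
  "limit_risk C \<rho> M N =
     4 * real M * (LINT v:{0..C}|lborel. v * \<rho> v)
     + (\<integral>U. R_min C \<rho> M N U M M * gauss (real M / 2) 0 U \<partial>lborel)"

end

theory Submission
  imports Defs
begin

text \<open>
  Under the improper prior that is constant in \<open>m\<close>, integrating \<open>m\<close> out of the likelihood of a history
  leaves the weight \<open>e \<cdot> exp (2 U v - 2 v\<^sup>2 n\<^sub>1 n\<^sub>2 / n) \<rho> v\<close> of \<open>v\<close>, where the factor \<open>e\<close> depends on the
  history only and \<open>U\<close> performs a Gaussian random walk with respect to \<open>e\<close>.  Hence the unnormalized posterior
  expected regret of any strategy is at least \<open>e\<close> times the value of the recursion for \<open>R\<^sub>M\<close>, with equality if the
  strategy always takes minimizing actions.  This also holds for histories in which one action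
  is missing; there \<open>U = 0\<close>, and trying the missing action is always optimal.

  For the uniform prior on \<open>[-a, a]\<close>, restricting \<open>m\<close> to \<open>[-a, a]\<close> is exchanged for restricting the first
  income to an interval \<open>[-A, A]\<close>, for which the flat prior gives at least \<open>2 A\<close> times the limiting
  risk, with equality for the limiting strategies.  With \<open>A = a \<plusminus> (C + sqrt a)\<close>, Chebyshev's inequality bounds
  the error of this exchange independently of \<open>a\<close>, so it vanishes after division by \<open>2 a\<close>.
\<close>

section \<open>Gaussian smoothing\<close>

text \<open>The flat prior has infinite mass, so the unnormalized Bayesian quantities start only
  after the first income. At that time the evidence is 1 whatever the income was (translation
  invariance), \<open>U\<close> is 0, and the optimal value depends on neither the income nor the
  arm; this is why an interval of length 2 A for the first income yields exactly 2 A times the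
  limiting risk. The walk \<open>U\<close> runs on the clock n1 n2 / n: the variance of a step is
  the increase of that clock. Hence exp (2 U v - 2 v^2 n1 n2 / n) is an exponential martingale,
  packets can be cut into single steps, and a missing action means that the clock still stands at 0.
  In the exchange of truncations, each one-sided inclusion fails only where the first income is at
  least sqrt a away from its mean. There the weight (x - mean)^2 / a is at least 1, and its total
  contribution is at most twice the largest loss 2 C N. The shift C + sqrt a is o(a), so it
  disappears after division by a. Values in \<open>ennreal\<close> reduce the exchanges of prior and
  income to Tonelli; real integrals occur only at the interfaces.\<close>

text \<open>The heat semigroup, with \<open>s\<close> as variance. Scaling a standard normal
  variable, instead of using the density of variance \<open>s\<close>, makes \<open>s = 0\<close>
  the identity; this case occurs as long as one arm is unobserved.\<close>

definition smooth :: "real \<Rightarrow> (real \<Rightarrow> ennreal) \<Rightarrow> real \<Rightarrow> ennreal" where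
  "smooth s F U = (\<integral>\<^sup>+z. F (U + sqrt s * z) * ennreal (std_normal_density z) \<partial>lborel)"

lemma nn_integral_normal_density:
  "0 < \<sigma> \<Longrightarrow> (\<integral>\<^sup>+x. ennreal (normal_density \<mu> \<sigma> x) \<partial>lborel) = 1"
  by (subst nn_integral_eq_integral) auto

lemma borel_measurable_smooth [measurable (raw)]:
  assumes "case_prod F \<in> borel_measurable (N \<Otimes>\<^sub>M borel)" "s \<in> borel_measurable N" "U \<in> borel_measurable N"
  shows "(\<lambda>x. smooth (s x) (F x) (U x)) \<in> borel_measurable N"
proof -
  have [measurable]: "s \<in> borel_measurable N" "U \<in> borel_measurable N" using assms by auto
  have "(\<lambda>p. (fst p, U (fst p) + sqrt (s (fst p)) * snd p)) \<in> N \<Otimes>\<^sub>M lborel \<rightarrow>\<^sub>M N \<Otimes>\<^sub>M borel"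
    by measurable
  from measurable_compose[OF this assms(1)]
  have [measurable]: "(\<lambda>p. F (fst p) (U (fst p) + sqrt (s (fst p)) * snd p)) \<in> borel_measurable (N \<Otimes>\<^sub>M lborel)"
    by simp
  show ?thesis unfolding smooth_def
    by (rule lborel.borel_measurable_nn_integral) (simp add: split_beta', measurable)
qed

lemma smooth_mono: "(\<And>u. F u \<le> G u) \<Longrightarrow> smooth s F U \<le> smooth s G U"
  unfolding smooth_def by (intro nn_integral_mono mult_right_mono) auto

lemma smooth_zero [simp]: "smooth 0 F U = F U"
proof -
  have "smooth 0 F U = (\<integral>\<^sup>+z. F U * ennreal (std_normal_density z) \<partial>lborel)"
    unfolding smooth_def by simp
  also have "\<dots> = F U" by (simp add: nn_integral_cmult nn_integral_normal_density)
  finally show ?thesis .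
qed

lemma smooth_const [simp]: "smooth s (\<lambda>_. a) U = a"
  unfolding smooth_def by (simp add: nn_integral_cmult nn_integral_normal_density)

lemma smooth_add:
  assumes [measurable]: "F \<in> borel_measurable borel" "G \<in> borel_measurable borel"
  shows "smooth s (\<lambda>u. F u + G u) U = smooth s F U + smooth s G U"
  unfolding smooth_def by (subst nn_integral_add[symmetric]) (auto simp: distrib_right)

lemma smooth_cmult:
  assumes [measurable]: "F \<in> borel_measurable borel"
  shows "smooth s (\<lambda>u. a * F u) U = a * smooth s F U"
  unfolding smooth_def by (subst nn_integral_cmult[symmetric]) (auto simp: mult_ac)

lemma nn_integral_lborel_affine:
  fixes c t :: real
  assumes [measurable]: "f \<in> borel_measurable borel" and c: "c \<noteq> 0"
  shows "(\<integral>\<^sup>+x. ennreal \<bar>c\<bar> * f (t + c * x) \<partial>lborel) = (\<integral>\<^sup>+x. f x \<partial>lborel)"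
  by (subst nn_integral_real_affine[OF assms, of t]) (simp add: nn_integral_cmult)

lemma smooth_uminus:
  assumes [measurable]: "F \<in> borel_measurable borel"
  shows "(\<integral>\<^sup>+z. F (U - sqrt s * z) * ennreal (std_normal_density z) \<partial>lborel) = smooth s F U"
proof -
  have "smooth s F U = (\<integral>\<^sup>+z. ennreal \<bar>-1\<bar> * (F (U + sqrt s * (0 + (-1) * z)) * ennreal (std_normal_density (0 + (-1) * z))) \<partial>lborel)"
    unfolding smooth_def by (rule nn_integral_lborel_affine[symmetric]) auto
  also have "\<dots> = (\<integral>\<^sup>+z. F (U - sqrt s * z) * ennreal (std_normal_density z) \<partial>lborel)"
    by (simp add: std_normal_density_def)
  finally show ?thesis by simp
qed

lemma smooth_eq_normal_density:
  assumes [measurable]: "F \<in> borel_measurable borel" and s: "0 < s"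
  shows "smooth s F U = (\<integral>\<^sup>+x. F (U + x) * ennreal (normal_density 0 (sqrt s) x) \<partial>lborel)"
proof -
  have "(\<integral>\<^sup>+x. F (U + x) * ennreal (normal_density 0 (sqrt s) x) \<partial>lborel) =
    (\<integral>\<^sup>+z. ennreal \<bar>sqrt s\<bar> * (F (U + (0 + sqrt s * z)) * ennreal (normal_density 0 (sqrt s) (0 + sqrt s * z))) \<partial>lborel)"
    by (rule nn_integral_lborel_affine[symmetric]) (use s in auto)
  also have "\<dots> = smooth s F U"
    unfolding smooth_def
  proof (intro nn_integral_cong)
    fix z
    have "sqrt s * normal_density 0 (sqrt s) (sqrt s * z) = std_normal_density z"
      using s by (simp add: normal_density_def std_normal_density_def power_mult_distrib real_sqrt_mult)
    then have "ennreal \<bar>sqrt s\<bar> * ennreal (normal_density 0 (sqrt s) (sqrt s * z)) = ennreal (std_normal_density z)"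
      using s by (simp add: ennreal_mult'[symmetric])
    then show "ennreal \<bar>sqrt s\<bar> * (F (U + (0 + sqrt s * z)) * ennreal (normal_density 0 (sqrt s) (0 + sqrt s * z))) =
      F (U + sqrt s * z) * ennreal (std_normal_density z)"
      by (metis (no_types, lifting) add_0 mult.left_commute)
  qed
  finally show ?thesis by simp
qed

text \<open>Sum of independent centred normals, by convolution of their densities; zero variances
  have no density and are split off. This merges consecutive steps and packets.\<close>

lemma smooth_smooth:
  assumes [measurable]: "F \<in> borel_measurable borel" and s: "0 \<le> s" "0 \<le> t"
  shows "smooth s (smooth t F) U = smooth (s + t) F U"
proof (cases "s = 0 \<or> t = 0")
  case True
  moreover have "smooth 0 F = F" by (rule ext) simp
  ultimately show ?thesis by auto
next
  case False
  then have s: "0 < s" "0 < t" using s by auto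
  have [measurable]: "smooth t F \<in> borel_measurable borel" by measurable
  let ?f = "\<lambda>x. ennreal (normal_density 0 (sqrt s) x)" and ?g = "\<lambda>x. ennreal (normal_density 0 (sqrt t) x)"
  have "smooth s (smooth t F) U = (\<integral>\<^sup>+x. (\<integral>\<^sup>+y. F (U + x + y) * ?g y \<partial>lborel) * ?f x \<partial>lborel)"
    using s by (simp add: smooth_eq_normal_density)
  also have "\<dots> = (\<integral>\<^sup>+x. (\<integral>\<^sup>+w. F (U + w) * ?g (w - x) * ?f x \<partial>lborel) \<partial>lborel)"
  proof (intro nn_integral_cong)
    fix x
    have "(\<integral>\<^sup>+w. F (U + w) * ?g (w - x) \<partial>lborel) = (\<integral>\<^sup>+y. ennreal \<bar>1\<bar> * (F (U + (x + 1 * y)) * ?g ((x + 1 * y) - x)) \<partial>lborel)"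
      by (rule nn_integral_lborel_affine[symmetric]) auto
    then show "(\<integral>\<^sup>+y. F (U + x + y) * ?g y \<partial>lborel) * ?f x = (\<integral>\<^sup>+w. F (U + w) * ?g (w - x) * ?f x \<partial>lborel)"
      by (simp add: nn_integral_multc add.assoc)
  qed
  also have "\<dots> = (\<integral>\<^sup>+w. (\<integral>\<^sup>+x. F (U + w) * ?g (w - x) * ?f x \<partial>lborel) \<partial>lborel)"
    by (rule lborel_pair.Fubini') measurable
  also have "\<dots> = (\<integral>\<^sup>+w. F (U + w) * (\<integral>\<^sup>+x. ennreal (normal_density 0 (sqrt t) (w - x) * normal_density 0 (sqrt s) x) \<partial>lborel) \<partial>lborel)"
    by (simp add: nn_integral_cmult[symmetric] ennreal_mult' mult.assoc)
  also have "\<dots> = (\<integral>\<^sup>+w. F (U + w) * ennreal (normal_density 0 (sqrt (s + t)) w) \<partial>lborel)"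
    using fun_cong[OF conv_normal_density_zero_mean[of "sqrt t" "sqrt s"]] s by (simp add: add.commute)
  also have "\<dots> = smooth (s + t) F U"
    using s by (subst smooth_eq_normal_density) auto
  finally show ?thesis .
qed

text \<open>Moment generating function of the normal law, by completing the square.\<close>

lemma smooth_exp:
  assumes "0 \<le> s"
  shows "smooth s (\<lambda>u. ennreal (a * exp (k * u))) U = ennreal (a * exp (k * U + k\<^sup>2 * s / 2))"
proof -
  have "ennreal (a * exp (k * (U + sqrt s * z))) * ennreal (std_normal_density z) =
    ennreal (a * exp (k * U + k\<^sup>2 * s / 2)) * ennreal (normal_density (k * sqrt s) 1 z)" for z
  proof -
    have "exp (k * (U + sqrt s * z)) * exp (- z\<^sup>2 / 2) = exp (k * U + k\<^sup>2 * s / 2) * exp (- (z - k * sqrt s)\<^sup>2 / 2)"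
      unfolding exp_add[symmetric] using assms
      by (auto simp: field_simps power2_eq_square)
    then have "exp (k * (U + sqrt s * z)) * std_normal_density z = exp (k * U + k\<^sup>2 * s / 2) * normal_density (k * sqrt s) 1 z"
      by (simp add: std_normal_density_def normal_density_def)
    then show ?thesis by (simp add: ennreal_mult''[symmetric] mult.assoc)
  qed
  then show ?thesis
    unfolding smooth_def by (simp add: nn_integral_cmult nn_integral_normal_density)
qed

section \<open>The limiting recursion\<close>

abbreviation steps :: "(arm \<Rightarrow> nat) \<Rightarrow> nat" where
  "steps c \<equiv> c Arm1 + c Arm2"

text \<open>Inverse variance of the difference of the two sample means when both arms are observed;
  \<open>U_stat\<close> is that difference times this precision. For the empty count division by
  zero gives the desired value 0.\<close>

definition precision :: "(arm \<Rightarrow> nat) \<Rightarrow> real" where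
  "precision c = real (c Arm1) * real (c Arm2) / real (steps c)"

lemma precision_nonneg: "0 \<le> precision c"
  by (simp add: precision_def)

lemma precision_eq_0: "c l = 0 \<Longrightarrow> precision c = 0"
  by (cases l) (auto simp: precision_def)

lemma steps_upd: "steps (c(l := c l + j)) = steps c + j"
  by (cases l) auto

lemma steps_arm: "steps c = c l + c (other_arm l)"
  by (cases l) auto

lemma other_arm_neq [simp]: "other_arm l \<noteq> l" "l \<noteq> other_arm l"
  by (cases l; simp)+

lemma other_other_arm [simp]: "other_arm (other_arm l) = l"
  by (cases l; simp)

lemma neq_other_arm_iff: "l' \<noteq> l \<longleftrightarrow> l' = other_arm l"
  by (cases l; cases l'; simp)

lemma precision_alt: "precision c = real (c l) * real (c (other_arm l)) / real (steps c)"
  by (cases l) (auto simp: precision_def)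

text \<open>For \<open>j = M\<close> the right-hand side is the kernel variance in the recursion for
  \<open>R_arm\<close>. Those variances are thus increments of a single function of the counts and
  telescope.\<close>

lemma precision_diff:
  assumes "0 < steps c"
  shows "precision (c(l := c l + j)) - precision c =
    real j * (real (c (other_arm l)))\<^sup>2 / (real (steps c) * real (steps c + j))"
proof -
  define x y where "x = real (c l)" and "y = real (c (other_arm l))"
  have n: "real (steps c) = x + y" unfolding steps_arm[of c l] by (simp add: x_def y_def)
  have pos: "0 < x + y" using assms unfolding n[symmetric] by (simp only: of_nat_0_less_iff)
  have "(x + j) * y / (x + y + j) - x * y / (x + y) = j * y\<^sup>2 / ((x + y) * (x + y + j))"
    using pos by (simp add: field_simps power2_eq_square)
  then show ?thesis
    unfolding precision_alt[of _ l] steps_upd of_nat_add[of "steps c" j] n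
    by (simp add: x_def y_def)
qed

lemma precision_mono: "precision c \<le> precision (c(l := c l + j))"
proof (cases "steps c = 0")
  case True then show ?thesis by (simp add: precision_def)
next
  case False
  then have "0 \<le> precision (c(l := c l + j)) - precision c" by (subst precision_diff) auto
  then show ?thesis by simp
qed

text \<open>The function g of the recursion with a free \<open>D\<close>: the regret
  \<open>\<bar>v\<bar> + arm_sign l * v\<close> of one application of \<open>l\<close>, integrated
  over the unnormalized posterior of \<open>v\<close> on the whole line.\<close>

definition weighted_gap :: "(real \<Rightarrow> real) \<Rightarrow> arm \<Rightarrow> real \<Rightarrow> real \<Rightarrow> ennreal" where
  "weighted_gap \<rho> l U D =
     (\<integral>\<^sup>+v. ennreal ((\<bar>v\<bar> + arm_sign l * v) * \<rho> v * exp (2 * U * v - 2 * v\<^sup>2 * D)) \<partial>lborel)"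

text \<open>Lengths \<open>j\<close> below a full packet are needed because the induction over
  single steps passes through unfinished packets.\<close>

definition packet_value ::
    "(real \<Rightarrow> real) \<Rightarrow> (real \<Rightarrow> (arm \<Rightarrow> nat) \<Rightarrow> ennreal) \<Rightarrow> arm \<Rightarrow> nat \<Rightarrow> real \<Rightarrow> (arm \<Rightarrow> nat) \<Rightarrow> ennreal" where
  "packet_value \<rho> F l j U c = of_nat j * weighted_gap \<rho> l U (precision c) +
     smooth (precision (c(l := c l + j)) - precision c) (\<lambda>u. F u (c(l := c l + j))) U"

text \<open>\<open>k\<close> counts the packets still to come. In \<open>R_arm\<close> the kernel
  becomes \<open>gauss 0\<close>, which vanishes, when the other arm is unobserved;
  \<open>smooth\<close> keeps the recursion meaningful there.\<close>

primrec opt_value :: "(real \<Rightarrow> real) \<Rightarrow> nat \<Rightarrow> nat \<Rightarrow> real \<Rightarrow> (arm \<Rightarrow> nat) \<Rightarrow> ennreal" where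
  "opt_value \<rho> M 0 U c = 0"
| "opt_value \<rho> M (Suc k) U c =
     min (packet_value \<rho> (opt_value \<rho> M k) Arm1 M U c) (packet_value \<rho> (opt_value \<rho> M k) Arm2 M U c)"

lemma packet_value_0 [simp]: "packet_value \<rho> F l 0 U c = F U c"
  by (simp add: packet_value_def)

lemma opt_value_le: "opt_value \<rho> M (Suc k) U c \<le> packet_value \<rho> (opt_value \<rho> M k) l M U c"
  by (cases l) auto

lemma opt_value_eq:
  "packet_value \<rho> (opt_value \<rho> M k) l M U c \<le> packet_value \<rho> (opt_value \<rho> M k) (other_arm l) M U c
    \<Longrightarrow> opt_value \<rho> M (Suc k) U c = packet_value \<rho> (opt_value \<rho> M k) l M U c"
  by (cases l) (auto simp: min_def)

section \<open>Martingale and semigroup identities under a symmetric prior\<close>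

locale symmetric_prior =
  fixes C :: real and \<rho> :: "real \<Rightarrow> real"
  assumes C_pos: "0 < C"
    and rho_measurable [measurable]: "\<rho> \<in> borel_measurable borel"
    and rho_nonneg [simp]: "\<And>v. 0 \<le> \<rho> v"
    and rho_support: "\<And>v. v \<notin> {-C..C} \<Longrightarrow> \<rho> v = 0"
    and rho_total: "(\<integral>\<^sup>+v. ennreal (\<rho> v) \<partial>lborel) = 1"
    and rho_sym: "\<And>v. \<rho> (- v) = \<rho> v"
begin

lemma gap_nonneg [simp]: "0 \<le> \<bar>v\<bar> + arm_sign l * v"
  by (cases l) auto

lemma measurable_weighted_gap [measurable (raw)]:
  assumes [measurable]: "f \<in> borel_measurable N" "g \<in> borel_measurable N"
  shows "(\<lambda>x. weighted_gap \<rho> l (f x) (g x)) \<in> borel_measurable N"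
  unfolding weighted_gap_def by measurable

text \<open>The gap of \<open>Arm2\<close> vanishes for negative \<open>v\<close> and that of
  \<open>Arm1\<close> for positive \<open>v\<close>. For \<open>Arm1\<close> the reflection of
  \<open>v\<close> and the symmetry of \<open>\<rho>\<close> move the integral to the positive
  side.\<close>

lemma weighted_gap_half:
  "weighted_gap \<rho> l U D =
     (\<integral>\<^sup>+v. ennreal (indicator {0..C} v * (2 * v * exp (arm_sign l * 2 * U * v - 2 * v\<^sup>2 * D) * \<rho> v)) \<partial>lborel)"
proof (cases l)
  case Arm2
  have "(\<bar>v\<bar> + v) * \<rho> v = indicator {0..C} v * (2 * v * \<rho> v)" for v
    using rho_support[of v] by (auto split: split_indicator)
  then have *: "(\<bar>v\<bar> + v) * \<rho> v * exp (2 * U * v - 2 * v\<^sup>2 * D) =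
     indicator {0..C} v * (2 * v * exp (2 * U * v - 2 * v\<^sup>2 * D) * \<rho> v)" for v
    by (simp add: mult_ac)
  show ?thesis unfolding weighted_gap_def by (simp only: Arm2 arm_sign.simps mult_1 *)
next
  case Arm1
  have "(\<bar>- v\<bar> - (- v)) * \<rho> (- v) = indicator {0..C} v * (2 * v * \<rho> v)" for v
    using rho_support[of v] by (auto split: split_indicator simp: rho_sym)
  then have *: "(\<bar>0 + (-1) * v\<bar> + arm_sign Arm1 * (0 + (-1) * v)) * \<rho> (0 + (-1) * v) *
         exp (2 * U * (0 + (-1) * v) - 2 * (0 + (-1) * v)\<^sup>2 * D) =
     indicator {0..C} v * (2 * v * exp (arm_sign Arm1 * 2 * U * v - 2 * v\<^sup>2 * D) * \<rho> v)" for v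
    by (simp add: mult_ac)
  have "weighted_gap \<rho> l U D = (\<integral>\<^sup>+v. ennreal \<bar>-1\<bar> *
      ennreal ((\<bar>0 + (-1) * v\<bar> + arm_sign l * (0 + (-1) * v)) * \<rho> (0 + (-1) * v) *
         exp (2 * U * (0 + (-1) * v) - 2 * (0 + (-1) * v)\<^sup>2 * D)) \<partial>lborel)"
    unfolding weighted_gap_def by (rule nn_integral_lborel_affine[symmetric]) auto
  moreover have "ennreal \<bar>-1\<bar> = 1" by simp
  ultimately show ?thesis by (simp only: * Arm1 mult_1)
qed

text \<open>Without information the exponent is 0, and by symmetry neither arm is preferred.\<close>

lemma weighted_gap_0: "weighted_gap \<rho> l 0 0 = weighted_gap \<rho> l' 0 0"
  by (simp add: weighted_gap_half)

lemma weighted_gap_finite: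
  assumes "0 \<le> D"
  shows "weighted_gap \<rho> l U D < \<infinity>"
proof -
  have "weighted_gap \<rho> l U D \<le> (\<integral>\<^sup>+v. ennreal (2 * C * exp (2 * \<bar>U\<bar> * C)) * ennreal (\<rho> v) \<partial>lborel)"
    unfolding weighted_gap_half
  proof (intro nn_integral_mono)
    fix v
    show "ennreal (indicator {0..C} v * (2 * v * exp (arm_sign l * 2 * U * v - 2 * v\<^sup>2 * D) * \<rho> v))
      \<le> ennreal (2 * C * exp (2 * \<bar>U\<bar> * C)) * ennreal (\<rho> v)"
    proof (cases "v \<in> {0..C}")
      case True
      have "arm_sign l * U \<le> \<bar>U\<bar>" by (cases l) auto
      then have "arm_sign l * U * v \<le> \<bar>U\<bar> * v" using True by (intro mult_right_mono) auto
      then have "arm_sign l * 2 * U * v \<le> 2 * (\<bar>U\<bar> * v)" by simp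
      also have "\<dots> \<le> 2 * (\<bar>U\<bar> * C)" using True by (intro mult_left_mono) auto
      finally have 1: "arm_sign l * 2 * U * v \<le> 2 * (\<bar>U\<bar> * C)" .
      have "0 \<le> v\<^sup>2 * D" using assms by simp
      with 1 have "arm_sign l * 2 * U * v - 2 * v\<^sup>2 * D \<le> 2 * \<bar>U\<bar> * C" by simp
      then have "2 * v * exp (arm_sign l * 2 * U * v - 2 * v\<^sup>2 * D) * \<rho> v \<le> 2 * C * exp (2 * \<bar>U\<bar> * C) * \<rho> v"
        using True by (intro mult_mono) auto
      then show ?thesis using True C_pos
        by (simp add: ennreal_mult''[symmetric] ennreal_leI)
    qed simp
  qed
  also have "\<dots> = ennreal (2 * C * exp (2 * \<bar>U\<bar> * C))"
    by (simp add: nn_integral_cmult rho_total)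
  also have "\<dots> < \<infinity>" by simp
  finally show ?thesis .
qed

text \<open>Martingale property for each single \<open>v\<close>: the Gaussian average produces the
  factor exp ((2 v)^2 s / 2), which cancels the additional exp (- 2 v^2 s). Tonelli carries this
  through the integral over \<open>v\<close>.\<close>

lemma smooth_weighted_gap:
  assumes "0 \<le> s"
  shows "smooth s (\<lambda>u. weighted_gap \<rho> l u (D + s)) U = weighted_gap \<rho> l U D"
proof -
  let ?a = "\<lambda>v. (\<bar>v\<bar> + arm_sign l * v) * \<rho> v * exp (- 2 * v\<^sup>2 * (D + s))"
  have "smooth s (\<lambda>u. weighted_gap \<rho> l u (D + s)) U =
    smooth s (\<lambda>u. \<integral>\<^sup>+v. ennreal (?a v * exp ((2 * v) * u)) \<partial>lborel) U"
    unfolding weighted_gap_def mult.assoc exp_add[symmetric] by (simp add: algebra_simps)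
  also have "\<dots> = (\<integral>\<^sup>+z. \<integral>\<^sup>+v. ennreal (?a v * exp ((2 * v) * (U + sqrt s * z))) *
      ennreal (std_normal_density z) \<partial>lborel \<partial>lborel)"
    unfolding smooth_def by (simp add: nn_integral_multc)
  also have "\<dots> = (\<integral>\<^sup>+v. smooth s (\<lambda>u. ennreal (?a v * exp ((2 * v) * u))) U \<partial>lborel)"
    unfolding smooth_def by (rule lborel_pair.Fubini') measurable
  also have "\<dots> = (\<integral>\<^sup>+v. ennreal (?a v * exp ((2 * v) * U + (2 * v)\<^sup>2 * s / 2)) \<partial>lborel)"
    using assms by (simp only: smooth_exp)
  also have "\<dots> = weighted_gap \<rho> l U D"
    unfolding weighted_gap_def mult.assoc exp_add[symmetric] by (simp add: algebra_simps power2_eq_square)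
  finally show ?thesis .
qed

lemma smooth_weighted_gap_precision:
  "smooth (precision (c(l' := c l' + j)) - precision c) (\<lambda>u. weighted_gap \<rho> l u (precision (c(l' := c l' + j)))) U =
    weighted_gap \<rho> l U (precision c)"
  using smooth_weighted_gap[of "precision (c(l' := c l' + j)) - precision c" l "precision c" U] precision_mono[of c l' j] by simp

lemma measurable_packet_value:
  assumes "\<And>c. (\<lambda>U. F U c) \<in> borel_measurable borel"
  shows "(\<lambda>U. packet_value \<rho> F l j U c) \<in> borel_measurable borel"
  unfolding packet_value_def using assms
  by (intro borel_measurable_add borel_measurable_times borel_measurable_smooth measurable_weighted_gap) auto

lemma measurable_opt_value [measurable]: "(\<lambda>U. opt_value \<rho> M k U c) \<in> borel_measurable borel"
  by (induction k arbitrary: c) (auto intro!: measurable_packet_value borel_measurable_min)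

lemma measurable_packet_opt [measurable]:
  "(\<lambda>U. packet_value \<rho> (opt_value \<rho> M k) l j U c) \<in> borel_measurable borel"
  by (intro measurable_packet_value) simp

text \<open>By the martingale property the gaps of the later \<open>j\<close> steps cost the same
  when seen from now, and the two smoothings compose. Hence a packet may be cut anywhere.\<close>

lemma packet_value_split:
  assumes F: "\<And>c. (\<lambda>U. F U c) \<in> borel_measurable borel"
  shows "of_nat i * weighted_gap \<rho> l U (precision c) +
      smooth (precision (c(l := c l + i)) - precision c) (\<lambda>u. packet_value \<rho> F l j u (c(l := c l + i))) U =
    packet_value \<rho> F l (i + j) U c"
proof -
  define c' where "c' = c(l := c l + i)"
  define c'' where "c'' = c(l := c l + (i + j))"
  have c: "c'(l := c' l + j) = c''" by (simp add: add.assoc c'_def c''_def)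
  note [measurable] = F
  have d: "0 \<le> precision c' - precision c" "0 \<le> precision c'' - precision c'"
    using precision_mono[of c l i] precision_mono[of c' l j] unfolding c by (auto simp: c'_def)
  have "smooth (precision c' - precision c) (smooth (precision c'' - precision c') (\<lambda>u. F u c'')) U =
      smooth (precision c'' - precision c) (\<lambda>u. F u c'') U"
    using smooth_smooth[OF F[of c''] d] by simp
  then have "smooth (precision c' - precision c) (\<lambda>u. packet_value \<rho> F l j u c') U =
    of_nat j * weighted_gap \<rho> l U (precision c) + smooth (precision c'' - precision c) (\<lambda>u. F u c'') U"
    using smooth_weighted_gap_precision[of c l i l U]
    unfolding packet_value_def c c'_def[symmetric]
    by (subst smooth_add) (simp_all add: smooth_cmult F)
  then show ?thesis
    unfolding packet_value_def c'_def[symmetric] c''_def[symmetric]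
    by (simp add: distrib_right add.assoc)
qed

text \<open>Sampling the unobserved arm first is no worse: postponing it by a packet costs the same
  uninformative loss and can be imitated after the exchange of the two packets.\<close>
lemma packet_value_unobserved:
  assumes "c (other_arm l) = 0"
  shows "packet_value \<rho> (opt_value \<rho> M k) (other_arm l) M 0 c \<le> packet_value \<rho> (opt_value \<rho> M k) l M 0 c"
  using assms
proof (induction k arbitrary: c)
  case 0
  then show ?case
    by (simp add: packet_value_def precision_eq_0[of c "other_arm l"] weighted_gap_0[of Arm1 Arm2])
       (cases l; simp add: weighted_gap_0[of Arm1 Arm2])
next
  case (Suc k)
  let ?o = "other_arm l"
  let ?v = "\<lambda>l. packet_value \<rho> (opt_value \<rho> M k) l M"
  define c' where "c' = c(l := c l + M)"
  define c1 where "c1 = c(?o := c ?o + M)"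
  have z: "precision c = 0" "precision c' = 0"
    using Suc.prems by (auto intro!: precision_eq_0[of _ ?o] simp: c'_def)
  have w: "weighted_gap \<rho> ?o 0 0 = weighted_gap \<rho> l 0 0" by (rule weighted_gap_0)
  have cc: "c1(l := c1 l + M) = c'(?o := c' ?o + M)"
    by (auto simp: c1_def c'_def)
  have nn: "0 \<le> precision c1" "0 \<le> precision (c1(l := c1 l + M)) - precision c1"
    using precision_nonneg precision_mono[of c1 l M] by auto
  have m1: "smooth (precision c1) (\<lambda>u. weighted_gap \<rho> l u (precision c1)) 0 = weighted_gap \<rho> l 0 0"
    using smooth_weighted_gap[of "precision c1" l 0 0] nn by simp
  \<comment> \<open>\<open>c'\<close> still lacks the other arm, so by induction that arm may come
    next. Both precisions are 0, which is why \<open>U\<close> is still 0 there.\<close>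
  have "opt_value \<rho> M (Suc k) 0 c' = ?v ?o 0 c'"
    using Suc.IH[of c'] Suc.prems by (intro opt_value_eq) (simp add: c'_def fun_upd_other[OF other_arm_neq(1)] del: fun_upd_apply)
  then have R: "packet_value \<rho> (opt_value \<rho> M (Suc k)) l M 0 c =
      of_nat M * weighted_gap \<rho> l 0 0 + (of_nat M * weighted_gap \<rho> l 0 0 +
        smooth (precision (c'(?o := c' ?o + M))) (\<lambda>u. opt_value \<rho> M k u (c'(?o := c' ?o + M))) 0)"
    by (simp add: packet_value_def z w flip: c'_def del: opt_value.simps fun_upd_apply)
  have "packet_value \<rho> (opt_value \<rho> M (Suc k)) ?o M 0 c =
      of_nat M * weighted_gap \<rho> l 0 0 + smooth (precision c1) (\<lambda>u. opt_value \<rho> M (Suc k) u c1) 0"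
    by (simp add: packet_value_def z w flip: c1_def del: opt_value.simps fun_upd_apply)
  \<comment> \<open>After the missing arm, playing \<open>l\<close> imitates the opposite order; by
    \<open>cc\<close> both orders end at the same counts.\<close>
  also have "\<dots> \<le> of_nat M * weighted_gap \<rho> l 0 0 + smooth (precision c1) (\<lambda>u. ?v l u c1) 0"
    by (intro add_mono smooth_mono opt_value_le order_refl)
  also have "smooth (precision c1) (\<lambda>u. ?v l u c1) 0 = of_nat M * weighted_gap \<rho> l 0 0 +
        smooth (precision (c1(l := c1 l + M))) (\<lambda>u. opt_value \<rho> M k u (c1(l := c1 l + M))) 0"
    using smooth_smooth[OF measurable_opt_value nn(1,2), of M k "c1(l := c1 l + M)" 0]
    unfolding packet_value_def
    by (subst smooth_add) (simp_all add: smooth_cmult m1 del: fun_upd_apply)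
  finally show ?case unfolding R cc .
qed

text \<open>Playing \<open>l\<close> in all remaining packets is one admissible continuation, and by
  the martingale property each packet costs as much as it would now. The bound serves for
  finiteness.\<close>

lemma opt_value_bound: "opt_value \<rho> M k U c \<le> of_nat (k * M) * weighted_gap \<rho> l U (precision c)"
proof (induction k arbitrary: U c)
  case (Suc k)
  let ?c = "c(l := c l + M)"
  have "opt_value \<rho> M (Suc k) U c \<le> packet_value \<rho> (opt_value \<rho> M k) l M U c" by (rule opt_value_le)
  also have "\<dots> \<le> of_nat M * weighted_gap \<rho> l U (precision c) +
      smooth (precision ?c - precision c) (\<lambda>u. of_nat (k * M) * weighted_gap \<rho> l u (precision ?c)) U"
    unfolding packet_value_def by (intro add_mono smooth_mono Suc.IH order_refl)
  also have "\<dots> = of_nat (Suc k * M) * weighted_gap \<rho> l U (precision c)"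
    by (subst smooth_cmult) (auto simp del: fun_upd_apply simp: smooth_weighted_gap_precision distrib_right)
  finally show ?case .
qed simp

lemma opt_value_finite: "opt_value \<rho> M k U c < \<infinity>"
  using opt_value_bound[of M k U c Arm1] weighted_gap_finite[OF precision_nonneg, of Arm1 U c]
  by (auto intro: le_less_trans simp: ennreal_mult_less_top of_nat_less_top)

lemma packet_value_finite: "packet_value \<rho> (opt_value \<rho> M k) l j U c < \<infinity>"
proof -
  let ?c = "c(l := c l + j)"
  have "packet_value \<rho> (opt_value \<rho> M k) l j U c \<le> of_nat j * weighted_gap \<rho> l U (precision c) +
      smooth (precision ?c - precision c) (\<lambda>u. of_nat (k * M) * weighted_gap \<rho> l u (precision ?c)) U"
    unfolding packet_value_def by (intro add_mono smooth_mono opt_value_bound order_refl)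
  also have "\<dots> = of_nat j * weighted_gap \<rho> l U (precision c) + of_nat (k * M) * weighted_gap \<rho> l U (precision c)"
    by (subst smooth_cmult) (auto simp del: fun_upd_apply simp: smooth_weighted_gap_precision)
  also have "\<dots> < \<infinity>"
    using weighted_gap_finite[OF precision_nonneg, of l U c] by (auto simp: ennreal_mult_less_top of_nat_less_top)
  finally show ?thesis .
qed

section \<open>Identification with the real-valued recursion\<close>

lemma g_fun_eq: "ennreal (g_fun C \<rho> l U (c Arm1) (c Arm2)) = weighted_gap \<rho> l U (precision c)"
proof -
  let ?f = "\<lambda>v. indicator {0..C} v * (2 * v * exp (arm_sign l * 2 * U * v - 2 * v\<^sup>2 * precision c) * \<rho> v)"
  have nn: "0 \<le> ?f v" for v by (auto split: split_indicator)
  have "g_fun C \<rho> l U (c Arm1) (c Arm2) = (\<integral>v. ?f v \<partial>lborel)"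
    unfolding g_fun_def set_lebesgue_integral_def precision_def by (simp add: mult.assoc)
  also have "\<dots> = enn2real (weighted_gap \<rho> l U (precision c))"
    unfolding weighted_gap_half by (rule integral_eq_nn_integral) (use nn in auto)
  finally show ?thesis
    using weighted_gap_finite[OF precision_nonneg, of l U c] by simp
qed

lemma g_fun_nonneg: "0 \<le> g_fun C \<rho> l U n1 n2"
  unfolding g_fun_def set_lebesgue_integral_def
  by (rule integral_nonneg_AE) (auto split: split_indicator)

text \<open>Finiteness matters because a non-integrable function has Bochner integral 0. The
  reflection of \<open>x\<close> reconciles \<open>U - x\<close> in the recursion with
  \<open>U + x\<close> in \<open>smooth\<close>.\<close>

lemma smooth_gauss:
  assumes [measurable]: "F \<in> borel_measurable borel" and F: "\<And>u. 0 \<le> F u" and s: "0 < s"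
    and fin: "smooth s (\<lambda>u. ennreal (F u)) U < \<infinity>"
  shows "ennreal (\<integral>x. F (U - x) * gauss s 0 x \<partial>lborel) = smooth s (\<lambda>u. ennreal (F u)) U"
    and "0 \<le> (\<integral>x. F (U - x) * gauss s 0 x \<partial>lborel)"
proof -
  have "(\<integral>\<^sup>+x. ennreal (F (U - x) * gauss s 0 x) \<partial>lborel) =
    (\<integral>\<^sup>+x. ennreal \<bar>-1\<bar> * ennreal (F (U - (0 + (-1) * x)) * gauss s 0 (0 + (-1) * x)) \<partial>lborel)"
    unfolding gauss_def by (rule nn_integral_lborel_affine[symmetric]) auto
  also have "\<dots> = smooth s (\<lambda>u. ennreal (F u)) U"
  proof (subst smooth_eq_normal_density[OF _ s])
    have "gauss s 0 (- x) = normal_density 0 (sqrt s) x" for x by (simp add: gauss_def normal_density_def)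
    then show "(\<integral>\<^sup>+x. ennreal \<bar>-1\<bar> * ennreal (F (U - (0 + (-1) * x)) * gauss s 0 (0 + (-1) * x)) \<partial>lborel) =
        (\<integral>\<^sup>+x. ennreal (F (U + x)) * ennreal (normal_density 0 (sqrt s) x) \<partial>lborel)"
      by (simp add: ennreal_mult F)
  qed simp
  finally have 1: "(\<integral>\<^sup>+x. ennreal (F (U - x) * gauss s 0 x) \<partial>lborel) = smooth s (\<lambda>u. ennreal (F u)) U" .
  have "(\<integral>x. F (U - x) * gauss s 0 x \<partial>lborel) = enn2real (smooth s (\<lambda>u. ennreal (F u)) U)"
    unfolding 1[symmetric] using F by (intro integral_eq_nn_integral) (auto simp: gauss_def)
  with fin show "ennreal (\<integral>x. F (U - x) * gauss s 0 x \<partial>lborel) = smooth s (\<lambda>u. ennreal (F u)) U"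
    and "0 \<le> (\<integral>x. F (U - x) * gauss s 0 x \<partial>lborel)" by simp_all
qed

text \<open>The first assumption is the recursion with the next value already replaced by
  \<open>opt_value\<close>. The variance has to be positive because \<open>gauss 0\<close> is the
  zero function, not a point mass.\<close>

lemma R_arm_eq:
  assumes "R_arm C \<rho> M N l U (c Arm1) (c Arm2) =
      real M * g_fun C \<rho> l U (c Arm1) (c Arm2) +
      (\<integral>x. enn2real (opt_value \<rho> M k (U - x) (c(l := c l + M))) *
        gauss (precision (c(l := c l + M)) - precision c) 0 x \<partial>lborel)"
    and "0 < precision (c(l := c l + M)) - precision c"
  shows "R_arm C \<rho> M N l U (c Arm1) (c Arm2) = enn2real (packet_value \<rho> (opt_value \<rho> M k) l M U c)"
proof -
  let ?c = "c(l := c l + M)"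
  have e: "ennreal (enn2real (opt_value \<rho> M k u c)) = opt_value \<rho> M k u c" for u c
    using opt_value_finite[of M k u c] by simp
  have fin: "smooth (precision ?c - precision c) (\<lambda>u. opt_value \<rho> M k u ?c) U < \<infinity>"
    using packet_value_finite[of M k l M U c] unfolding packet_value_def
    by (auto intro: le_less_trans[rotated] simp del: fun_upd_apply)
  have I: "ennreal (\<integral>x. enn2real (opt_value \<rho> M k (U - x) ?c) *
        gauss (precision ?c - precision c) 0 x \<partial>lborel) = smooth (precision ?c - precision c) (\<lambda>u. opt_value \<rho> M k u ?c) U"
     "0 \<le> (\<integral>x. enn2real (opt_value \<rho> M k (U - x) ?c) * gauss (precision ?c - precision c) 0 x \<partial>lborel)"
    using smooth_gauss[of "\<lambda>u. enn2real (opt_value \<rho> M k u ?c)" "precision ?c - precision c" U] assms(2) fin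
    unfolding e by auto
  have "ennreal (R_arm C \<rho> M N l U (c Arm1) (c Arm2)) = packet_value \<rho> (opt_value \<rho> M k) l M U c"
    unfolding assms(1) packet_value_def using I g_fun_nonneg
    by (simp add: ennreal_plus ennreal_mult' g_fun_eq ennreal_of_nat_eq_real_of_nat del: fun_upd_apply)
  moreover have "0 \<le> R_arm C \<rho> M N l U (c Arm1) (c Arm2)"
    unfolding assms(1) using I(2) g_fun_nonneg by (intro add_nonneg_nonneg mult_nonneg_nonneg) auto
  ultimately show ?thesis by (metis enn2real_ennreal)
qed

text \<open>Induction on the number \<open>k\<close> of packets left. Positive counts persist and
  keep every kernel variance positive, so the degenerate kernel of \<open>R_arm\<close> is never
  met.\<close>

lemma R_eq_opt_value:
  assumes M: "1 \<le> M" and c: "0 < c Arm1" "0 < c Arm2" and N: "N = steps c + k * M"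
  shows "R_min C \<rho> M N U (c Arm1) (c Arm2) = enn2real (opt_value \<rho> M k U c)"
    and "k = Suc k' \<Longrightarrow> R_arm C \<rho> M N l U (c Arm1) (c Arm2) = enn2real (packet_value \<rho> (opt_value \<rho> M k') l M U c)"
  using c N
proof (induction k arbitrary: c U k' l)
  case 0
  { case 1 then show ?case by (simp add: R_min.simps R_arm.simps) }
  { case 2 then show ?case by simp }
next
  case (Suc k)
  have arm: "R_arm C \<rho> M N l U (c Arm1) (c Arm2) = enn2real (packet_value \<rho> (opt_value \<rho> M k) l M U c)"
    if c: "0 < c Arm1" "0 < c Arm2" and N: "N = steps c + Suc k * M" for l U c
  proof (rule R_arm_eq)
    let ?c = "c(l := c l + M)"
    have d: "precision ?c - precision c = real M * (real (c (other_arm l)))\<^sup>2 / (real (steps c) * real (steps c + M))"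
      using c by (intro precision_diff) simp
    have "0 < c (other_arm l)" using c by (cases l) auto
    then show "0 < precision ?c - precision c" unfolding d using c M by simp
    have IH: "enn2real (opt_value \<rho> M k u ?c) = R_min C \<rho> M N u (?c Arm1) (?c Arm2)" for u
      using c N by (intro Suc.IH(1)[symmetric]) (cases l; simp add: algebra_simps)+
    show "R_arm C \<rho> M N l U (c Arm1) (c Arm2) =
      real M * g_fun C \<rho> l U (c Arm1) (c Arm2) +
      (\<integral>x. enn2real (opt_value \<rho> M k (U - x) ?c) * gauss (precision ?c - precision c) 0 x \<partial>lborel)"
      unfolding IH d using N M by (cases l) (simp_all add: R_arm.simps)
  qed
  { case 1
    have "enn2real (min a b) = min (enn2real a) (enn2real b)" if "a < \<infinity>" "b < \<infinity>" for a b :: ennreal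
      using that by (cases a; cases b) (auto simp: min_def)
    then show ?case
      using packet_value_finite by (simp only: R_min.simps arm[OF 1] opt_value.simps) }
  { case 2 then show ?case using arm by simp }
qed

end

section \<open>Expected regret of a strategy\<close>

instance arm :: finite
proof
  have "(UNIV :: arm set) = {Arm1, Arm2}" using arm.exhaust by auto
  then show "finite (UNIV :: arm set)" by (metis finite.intros)
qed

lemma sum_arm: "(\<Sum>l\<in>UNIV. f l) = f Arm1 + f Arm2"
proof -
  have *: "(UNIV :: arm set) = {Arm1, Arm2}" using arm.exhaust by auto
  show ?thesis unfolding * by simp
qed

abbreviation gap :: "real \<times> real \<Rightarrow> arm \<Rightarrow> real" where
  "gap \<theta> l \<equiv> best_mean \<theta> - arm_mean \<theta> l"

lemma gap_ge_0: "0 \<le> gap \<theta> l"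
  by (cases l) (auto simp: best_mean_def)

lemma gap_le: "gap \<theta> l \<le> \<bar>fst \<theta> - snd \<theta>\<bar>"
  by (cases l; cases \<theta>) (auto simp: best_mean_def)

lemma arm_mean_shift: "arm_mean (m + v, m - v) l = m - arm_sign l * v"
  by (cases l) auto

lemma gap_shift: "gap (m + v, m - v) l = \<bar>v\<bar> + arm_sign l * v"
  by (cases l) (auto simp: best_mean_def)

lemma gauss_nonneg [simp]: "0 \<le> gauss D m x"
  by (simp add: gauss_def)

lemma measurable_gauss [measurable (raw)]:
  assumes [measurable]: "f \<in> borel_measurable N" "g \<in> borel_measurable N"
  shows "(\<lambda>x. gauss D (f x) (g x)) \<in> borel_measurable N"
  unfolding gauss_def normal_density_def by measurable

lemma nn_integral_gauss: "0 < D \<Longrightarrow> (\<integral>\<^sup>+x. ennreal (gauss D m x) \<partial>lborel) = 1"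
  by (simp add: gauss_def nn_integral_normal_density)

lemma measurable_arm_mean [measurable (raw)]:
  assumes [measurable]: "f \<in> N \<rightarrow>\<^sub>M borel \<Otimes>\<^sub>M borel"
  shows "(\<lambda>x. arm_mean (f x) l) \<in> borel_measurable N"
proof -
  have "arm_mean \<theta> Arm1 = fst \<theta>" "arm_mean \<theta> Arm2 = snd \<theta>" for \<theta> by (cases \<theta>; simp)+
  then show ?thesis by (cases l) simp_all
qed

lemma measurable_best_mean [measurable (raw)]:
  assumes [measurable]: "f \<in> N \<rightarrow>\<^sub>M borel \<Otimes>\<^sub>M borel"
  shows "(\<lambda>x. best_mean (f x)) \<in> borel_measurable N"
  unfolding best_mean_def by measurable

section \<open>Measurability on histories and regret by backward recursion\<close>

lemma measurable_fst_obs [measurable]: "fst \<in> obs \<rightarrow>\<^sub>M count_space UNIV"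
  by (simp add: obs_def)

lemma measurable_snd_obs [measurable]: "snd \<in> borel_measurable obs"
  by (simp add: obs_def)

lemma measurable_Pair_obs [measurable (raw)]:
  assumes [measurable]: "f \<in> borel_measurable N"
  shows "(\<lambda>x. (l, f x)) \<in> N \<rightarrow>\<^sub>M obs"
  unfolding obs_def by measurable

lemma measurable_hist_component:
  "k < n \<Longrightarrow> (\<lambda>h. h k) \<in> hist_space n \<rightarrow>\<^sub>M obs"
  unfolding hist_space_def by measurable

lemma measurable_hist_upd [measurable (raw)]:
  assumes [measurable]: "f \<in> N \<rightarrow>\<^sub>M hist_space n" "g \<in> N \<rightarrow>\<^sub>M obs"
  shows "(\<lambda>x. (f x)(n := g x)) \<in> N \<rightarrow>\<^sub>M hist_space (Suc n)"
  using assms unfolding hist_space_def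
  by (intro measurable_fun_upd[where J="{0..<n}"]) auto

lemma space_hist_upd [simp]:
  assumes "h \<in> space (hist_space n)"
  shows "h(n := (l, x)) \<in> space (hist_space (Suc n))"
proof -
  have "(\<lambda>y::real. h(n := (l, y))) \<in> borel \<rightarrow>\<^sub>M hist_space (Suc n)"
    using assms by measurable
  from measurable_space[OF this, of x] show ?thesis by simp
qed

text \<open>The expected sum of gaps under \<open>path_law\<close>, written as iterated integrals:
  induction can peel off the next step, and Tonelli can exchange its income with the prior.\<close>

primrec regret :: "strategy \<Rightarrow> real \<times> real \<Rightarrow> nat \<Rightarrow> nat \<Rightarrow> history \<Rightarrow> ennreal" where
  "regret \<sigma> \<theta> 0 n h = 0"
| "regret \<sigma> \<theta> (Suc k) n h = (\<Sum>l\<in>UNIV. ennreal (pmf (\<sigma> n h) l) *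
     (\<integral>\<^sup>+x. ennreal (gauss 1 (arm_mean \<theta> l) x) * (ennreal (gap \<theta> l) + regret \<sigma> \<theta> k (Suc n) (h(n := (l, x)))) \<partial>lborel))"

definition measurable_strategy :: "strategy \<Rightarrow> bool" where
  "measurable_strategy \<sigma> \<longleftrightarrow>
     (\<forall>n. (\<lambda>h. measure_pmf (\<sigma> n h)) \<in> hist_space n \<rightarrow>\<^sub>M subprob_algebra (count_space UNIV))"

lemma packet_strategy_measurable: "\<sigma> \<in> packet_strategies M \<Longrightarrow> measurable_strategy \<sigma>"
  by (simp add: packet_strategies_def measurable_strategy_def)

lemma packet_strategy_repeat:
  "\<sigma> \<in> packet_strategies M \<Longrightarrow> h \<in> space (hist_space n) \<Longrightarrow> \<not> M dvd n \<Longrightarrow> \<sigma> n h = return_pmf (fst (h (n - 1)))"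
  by (simp add: packet_strategies_def)

lemma sum_pmf_arm: "(\<Sum>l\<in>UNIV. ennreal (pmf p (l :: arm))) = 1"
proof -
  have "(\<Sum>l\<in>UNIV. pmf p (l :: arm)) = 1" by (rule sum_pmf_eq_1) auto
  then show ?thesis by (simp add: sum_ennreal)
qed

lemma regret_le: "regret \<sigma> \<theta> k n h \<le> of_nat k * ennreal \<bar>fst \<theta> - snd \<theta>\<bar>"
proof (induction k arbitrary: n h)
  case (Suc k)
  let ?B = "ennreal \<bar>fst \<theta> - snd \<theta>\<bar>"
  have "regret \<sigma> \<theta> (Suc k) n h \<le> (\<Sum>l\<in>UNIV. ennreal (pmf (\<sigma> n h) l) *
     (\<integral>\<^sup>+x. ennreal (gauss 1 (arm_mean \<theta> l) x) * (?B + of_nat k * ?B) \<partial>lborel))"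
    unfolding regret.simps
    by (intro sum_mono mult_left_mono nn_integral_mono add_mono Suc.IH ennreal_leI gap_le) auto
  also have "\<dots> = (\<Sum>l\<in>UNIV. ennreal (pmf (\<sigma> n h) l)) * (?B + of_nat k * ?B)"
    by (simp add: nn_integral_multc nn_integral_gauss sum_distrib_right del: sum_ennreal)
  also have "\<dots> = of_nat (Suc k) * ?B"
    by (simp add: sum_pmf_arm distrib_right)
  finally show ?case .
qed simp

lemma regret_finite: "regret \<sigma> \<theta> k n h < \<infinity>"
  using regret_le[of \<sigma> \<theta> k n h]
  by (auto intro: le_less_trans simp: ennreal_mult_less_top of_nat_less_top)

lemma measurable_pmf_strategy:
  assumes "measurable_strategy \<sigma>"
  shows "(\<lambda>h. pmf (\<sigma> n h) l) \<in> borel_measurable (hist_space n)"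
proof -
  have "(\<lambda>h. measure (measure_pmf (\<sigma> n h)) {l}) \<in> borel_measurable (hist_space n)"
    using assms unfolding measurable_strategy_def
    by (intro measurable_compose[OF _ measurable_measure_subprob_algebra]) auto
  then show ?thesis by (simp add: measure_pmf_single)
qed

text \<open>Joint measurability in parameter and history is what the later exchange of prior and
  income requires.\<close>

lemma measurable_regret:
  assumes \<sigma>: "measurable_strategy \<sigma>"
  shows "(\<lambda>(\<theta>, h). regret \<sigma> \<theta> k n h) \<in> borel_measurable ((borel \<Otimes>\<^sub>M borel) \<Otimes>\<^sub>M hist_space n)"
proof (induction k arbitrary: n)
  case (Suc k)
  note [measurable] = measurable_pmf_strategy[OF \<sigma>]
  have [measurable]: "(\<lambda>p. regret \<sigma> (fst (fst p)) k (Suc n) ((snd (fst p))(n := (l, snd p))))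
      \<in> borel_measurable (((borel \<Otimes>\<^sub>M borel) \<Otimes>\<^sub>M hist_space n) \<Otimes>\<^sub>M lborel)" for l
  proof -
    have "(\<lambda>p. (fst (fst p), (snd (fst p))(n := (l, snd p))))
      \<in> ((borel \<Otimes>\<^sub>M borel) \<Otimes>\<^sub>M hist_space n) \<Otimes>\<^sub>M lborel \<rightarrow>\<^sub>M (borel \<Otimes>\<^sub>M borel) \<Otimes>\<^sub>M hist_space (Suc n)"
      by measurable
    from measurable_compose[OF this Suc.IH] show ?thesis by simp
  qed
  show ?case
    unfolding regret.simps split_beta'
    by (intro borel_measurable_sum borel_measurable_times lborel.borel_measurable_nn_integral)
      (simp_all add: split_beta', measurable)
qed (simp add: split_beta')

lemma measurable_regret' [measurable (raw)]:
  assumes \<sigma>: "measurable_strategy \<sigma>"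
    and "f \<in> N \<rightarrow>\<^sub>M borel \<Otimes>\<^sub>M borel" "g \<in> N \<rightarrow>\<^sub>M hist_space n"
  shows "(\<lambda>x. regret \<sigma> (f x) k n (g x)) \<in> borel_measurable N"
  using measurable_compose[OF measurable_Pair[OF assms(2,3)] measurable_regret[OF \<sigma>]] by simp

section \<open>From path laws to iterated integrals\<close>

definition arm_law :: "real \<times> real \<Rightarrow> arm \<Rightarrow> (arm \<times> real) measure" where
  "arm_law \<theta> l = distr (density lborel (\<lambda>x. ennreal (gauss 1 (arm_mean \<theta> l) x))) obs (Pair l)"

lemma sets_arm_law [simp]: "sets (arm_law \<theta> l) = sets obs"
  by (simp add: arm_law_def)

lemma prob_space_arm_law: "prob_space (arm_law \<theta> l)"
  unfolding arm_law_def gauss_def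
  by (intro prob_space.prob_space_distr prob_space_normal_density) auto

lemma measurable_arm_law: "arm_law \<theta> \<in> count_space UNIV \<rightarrow>\<^sub>M subprob_algebra obs"
  by (auto simp: space_subprob_algebra intro: prob_space_imp_subprob_space prob_space_arm_law)

lemma nn_integral_arm_law:
  assumes [measurable]: "f \<in> borel_measurable obs"
  shows "(\<integral>\<^sup>+z. f z \<partial>arm_law \<theta> l) = (\<integral>\<^sup>+x. ennreal (gauss 1 (arm_mean \<theta> l) x) * f (l, x) \<partial>lborel)"
  unfolding arm_law_def by (simp add: nn_integral_distr nn_integral_density)

lemma step_law_eq: "step_law \<sigma> \<theta> n h = measure_pmf (\<sigma> n h) \<bind> arm_law \<theta>"
  by (simp add: step_law_def arm_law_def[abs_def])

lemma nn_integral_step_law: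
  assumes [measurable]: "f \<in> borel_measurable obs"
  shows "(\<integral>\<^sup>+z. f z \<partial>step_law \<sigma> \<theta> n h) = (\<Sum>l\<in>UNIV. ennreal (pmf (\<sigma> n h) l) *
     (\<integral>\<^sup>+x. ennreal (gauss 1 (arm_mean \<theta> l) x) * f (l, x) \<partial>lborel))"
proof -
  have "arm_law \<theta> \<in> measure_pmf (\<sigma> n h) \<rightarrow>\<^sub>M subprob_algebra obs"
    using measurable_arm_law by simp
  then have "(\<integral>\<^sup>+z. f z \<partial>step_law \<sigma> \<theta> n h) = (\<integral>\<^sup>+l. (\<integral>\<^sup>+z. f z \<partial>arm_law \<theta> l) \<partial>measure_pmf (\<sigma> n h))"
    unfolding step_law_eq by (rule nn_integral_bind[OF assms])
  then show ?thesis
    by (simp add: nn_integral_measure_pmf nn_integral_count_space_finite nn_integral_arm_law)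
qed

lemma Ionescu_Tulcea_step_law:
  assumes "measurable_strategy \<sigma>"
  shows "Ionescu_Tulcea (step_law \<sigma> \<theta>) (\<lambda>_. obs)"
  unfolding Ionescu_Tulcea_def
proof (intro conjI allI impI)
  fix i :: nat
  show "step_law \<sigma> \<theta> i \<in> Pi\<^sub>M {0..<i} (\<lambda>_. obs) \<rightarrow>\<^sub>M subprob_algebra obs"
    using assms unfolding step_law_eq[abs_def] measurable_strategy_def hist_space_def
    by (intro measurable_bind2[OF _ measurable_arm_law]) auto
next
  fix i :: nat and x :: history
  assume "x \<in> space (Pi\<^sub>M {0..<i} (\<lambda>_. obs))"
  show "prob_space (step_law \<sigma> \<theta> i x)"
    unfolding step_law_eq
    by (intro prob_space.prob_space_bind[where S=obs])
      (use measurable_arm_law in \<open>auto simp: prob_space_arm_law prob_space_measure_pmf\<close>)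
qed

lemma measurable_gap_obs [measurable (raw)]:
  assumes [measurable]: "f \<in> N \<rightarrow>\<^sub>M obs"
  shows "(\<lambda>x. gap \<theta> (fst (f x))) \<in> borel_measurable N"
proof -
  have "(\<lambda>x. fst (f x)) \<in> N \<rightarrow>\<^sub>M count_space UNIV" by (rule measurable_compose[OF assms measurable_fst_obs])
  from measurable_compose[OF this, of "gap \<theta>" borel] show ?thesis by simp
qed

lemma nn_integral_gauss_abs: "(\<integral>\<^sup>+x. ennreal (gauss 1 m x) * ennreal \<bar>x - m\<bar> \<partial>lborel) < \<infinity>"
proof -
  have "integrable lborel (\<lambda>x. gauss 1 m x * \<bar>x - m\<bar>)"
    using integrable_normal_moment_abs[of 1 m 1] by (simp add: gauss_def)
  then show ?thesis by (simp add: integrable_iff_bounded abs_mult ennreal_mult)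
qed

text \<open>Positive and negative parts of the centred income agree by symmetry, so its mean is 0
  once integrability is known.\<close>

lemma nn_integral_gauss_reflect:
  "(\<integral>\<^sup>+x. ennreal (gauss 1 m x) * ennreal (x - m) \<partial>lborel) = (\<integral>\<^sup>+x. ennreal (gauss 1 m x) * ennreal (m - x) \<partial>lborel)"
proof -
  have "(\<integral>\<^sup>+x. ennreal (gauss 1 m x) * ennreal (x - m) \<partial>lborel) =
    (\<integral>\<^sup>+x. ennreal \<bar>-1\<bar> * (ennreal (gauss 1 m (2 * m + (-1) * x)) * ennreal ((2 * m + (-1) * x) - m)) \<partial>lborel)"
    by (rule nn_integral_lborel_affine[symmetric]) auto
  moreover have "gauss 1 m (2 * m - x) = gauss 1 m x" for x
    by (simp add: gauss_def normal_density_def power2_commute)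
  ultimately show ?thesis by simp
qed

context
  fixes \<sigma> :: strategy and \<theta> :: "real \<times> real"
  assumes \<sigma>: "measurable_strategy \<sigma>"
begin

interpretation IT: Ionescu_Tulcea "step_law \<sigma> \<theta>" "\<lambda>_. obs"
  by (rule Ionescu_Tulcea_step_law[OF \<sigma>])

lemma sets_path_law [simp]: "h \<in> space (hist_space n) \<Longrightarrow> sets (path_law \<sigma> \<theta> n k h) = sets (hist_space (n + k))"
  unfolding path_law_def hist_space_def by (rule IT.sets_C)

lemma prob_space_path_law: "h \<in> space (hist_space n) \<Longrightarrow> prob_space (path_law \<sigma> \<theta> n k h)"
  unfolding path_law_def hist_space_def by (rule IT.prob_space_C)

lemma measurable_path_component:
  "h \<in> space (hist_space n) \<Longrightarrow> i < n + k \<Longrightarrow> (\<lambda>\<omega>. \<omega> i) \<in> path_law \<sigma> \<theta> n k h \<rightarrow>\<^sub>M obs"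
  using measurable_hist_component[of i "n + k"] measurable_cong_sets[OF sets_path_law refl] by blast

text \<open>Induction on \<open>k\<close>, splitting the path kernel after one step: entry
  \<open>n\<close> is then fixed, and the induction hypothesis covers the later entries.\<close>

lemma nn_integral_path_law_gap:
  "h \<in> space (hist_space n) \<Longrightarrow>
    (\<integral>\<^sup>+\<omega>. (\<Sum>i\<in>{n..<n + k}. ennreal (gap \<theta> (fst (\<omega> i)))) \<partial>path_law \<sigma> \<theta> n k h) = regret \<sigma> \<theta> k n h"
proof (induction k arbitrary: n h)
  case 0
  then show ?case by simp
next
  case (Suc k)
  let ?G = "\<lambda>i \<omega>. ennreal (gap \<theta> (fst (\<omega> i)))"
  note [measurable] = measurable_regret'[OF \<sigma>]
  have h: "h \<in> space (Pi\<^sub>M {0..<n} (\<lambda>_. obs))" using Suc.prems by (simp add: hist_space_def)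
  have m: "(\<lambda>\<omega>. ?G i \<omega>) \<in> borel_measurable (Pi\<^sub>M {0..<j} (\<lambda>_. obs))" if "i < j" for i j :: nat
    using measurable_gap_obs[OF measurable_hist_component[OF that]] unfolding hist_space_def by measurable
  have "path_law \<sigma> \<theta> n (Suc k) h = IT.C n 1 h \<bind> IT.C (n + 1) k"
    unfolding path_law_def using IT.split_C[OF h, of 1 k] by simp
  also have "IT.C n 1 h = IT.eP n h"
    using bind_return[OF IT.measurable_eP h] by simp
  finally have "(\<integral>\<^sup>+\<omega>. (\<Sum>i\<in>{n..<n + Suc k}. ?G i \<omega>) \<partial>path_law \<sigma> \<theta> n (Suc k) h) =
    (\<integral>\<^sup>+\<omega>. (\<Sum>i\<in>{n..<n + Suc k}. ?G i \<omega>) \<partial>(IT.eP n h \<bind> IT.C (Suc n) k))" by simp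
  also have "\<dots> = (\<integral>\<^sup>+\<omega>'. (\<integral>\<^sup>+\<omega>. (\<Sum>i\<in>{n..<n + Suc k}. ?G i \<omega>) \<partial>IT.C (Suc n) k \<omega>') \<partial>IT.eP n h)"
  proof (rule nn_integral_bind)
    show "(\<lambda>\<omega>. \<Sum>i\<in>{n..<n + Suc k}. ?G i \<omega>) \<in> borel_measurable (Pi\<^sub>M {0..<Suc n + k} (\<lambda>_. obs))"
      by (intro borel_measurable_sum m) auto
    show "IT.C (Suc n) k \<in> IT.eP n h \<rightarrow>\<^sub>M subprob_algebra (Pi\<^sub>M {0..<Suc n + k} (\<lambda>_. obs))"
      using IT.measurable_C[of "Suc n" k] measurable_cong_sets[OF IT.sets_eP[OF h] refl] by blast
  qed
  also have "\<dots> = (\<integral>\<^sup>+\<omega>'. (?G n \<omega>' + regret \<sigma> \<theta> k (Suc n) \<omega>') \<partial>IT.eP n h)"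
  proof (rule nn_integral_cong)
    fix \<omega>' assume "\<omega>' \<in> space (IT.eP n h)"
    then have \<omega>': "\<omega>' \<in> space (Pi\<^sub>M {0..<Suc n} (\<lambda>_. obs))" by (simp add: IT.space_eP[OF h])
    have mC: "f \<in> borel_measurable (IT.C (Suc n) k \<omega>')" if "f \<in> borel_measurable (Pi\<^sub>M {0..<Suc n + k} (\<lambda>_. obs))" for f :: "_ \<Rightarrow> ennreal"
      using that measurable_cong_sets[OF IT.sets_C[OF \<omega>'] refl] by blast
    have "(\<integral>\<^sup>+\<omega>. (\<Sum>i\<in>{n..<n + Suc k}. ?G i \<omega>) \<partial>IT.C (Suc n) k \<omega>') =
      (\<integral>\<^sup>+\<omega>. (?G n \<omega> + (\<Sum>i\<in>{Suc n..<Suc n + k}. ?G i \<omega>)) \<partial>IT.C (Suc n) k \<omega>')"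
    proof (rule nn_integral_cong)
      fix \<omega>
      have "{n..<n + Suc k} = insert n {Suc n..<Suc n + k}" by auto
      then show "(\<Sum>i\<in>{n..<n + Suc k}. ?G i \<omega>) = ?G n \<omega> + (\<Sum>i\<in>{Suc n..<Suc n + k}. ?G i \<omega>)"
        by (simp only:) (subst sum.insert, auto)
    qed
    also have "\<dots> = (\<integral>\<^sup>+\<omega>. ?G n \<omega> \<partial>IT.C (Suc n) k \<omega>') + (\<integral>\<^sup>+\<omega>. (\<Sum>i\<in>{Suc n..<Suc n + k}. ?G i \<omega>) \<partial>IT.C (Suc n) k \<omega>')"
      by (intro nn_integral_add mC borel_measurable_sum m) auto
    also have "(\<integral>\<^sup>+\<omega>. (\<Sum>i\<in>{Suc n..<Suc n + k}. ?G i \<omega>) \<partial>IT.C (Suc n) k \<omega>') = regret \<sigma> \<theta> k (Suc n) \<omega>'"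
      using Suc.IH[of \<omega>' "Suc n"] \<omega>' by (simp add: hist_space_def path_law_def)
    \<comment> \<open>Later steps do not alter entry \<open>n\<close>: projected to the first
      \<open>Suc n\<close> entries, the law of the extension is that of zero further steps, a point
      mass.\<close>
    also have "(\<integral>\<^sup>+\<omega>. ?G n \<omega> \<partial>IT.C (Suc n) k \<omega>') = ?G n \<omega>'"
    proof -
      have "(\<integral>\<^sup>+\<omega>. ?G n \<omega> \<partial>IT.C (Suc n) 0 \<omega>') = (\<integral>\<^sup>+\<omega>. ?G n (restrict \<omega> {0..<Suc n + 0}) \<partial>IT.C (Suc n) k \<omega>')"
        by (rule IT.nn_integral_C) (use \<omega>' m in auto)
      moreover have "(\<integral>\<^sup>+\<omega>. ?G n \<omega> \<partial>IT.C (Suc n) 0 \<omega>') = ?G n \<omega>'"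
        using \<omega>' m[of n "Suc n"] by (simp add: nn_integral_return)
      ultimately show ?thesis by simp
    qed
    finally show "(\<integral>\<^sup>+\<omega>. (\<Sum>i\<in>{n..<n + Suc k}. ?G i \<omega>) \<partial>IT.C (Suc n) k \<omega>') = ?G n \<omega>' + regret \<sigma> \<theta> k (Suc n) \<omega>'" .
  qed
  also have "\<dots> = (\<integral>\<^sup>+z. (ennreal (gap \<theta> (fst z)) + regret \<sigma> \<theta> k (Suc n) (h(n := z))) \<partial>step_law \<sigma> \<theta> n h)"
  proof -
    have "regret \<sigma> \<theta> k (Suc n) \<in> borel_measurable (hist_space (Suc n))"
      by (rule measurable_regret'[OF \<sigma>]) (auto simp: space_pair_measure)
    then have "(\<lambda>\<omega>. ?G n \<omega> + regret \<sigma> \<theta> k (Suc n) \<omega>) \<in> borel_measurable (Pi\<^sub>M {0..<Suc n} (\<lambda>_. obs))"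
      by (intro borel_measurable_add m) (simp_all add: hist_space_def)
    from IT.nn_integral_eP[OF h this] show ?thesis by simp
  qed
  also have "\<dots> = regret \<sigma> \<theta> (Suc k) n h"
  proof -
    have "(\<lambda>z. h(n := z)) \<in> obs \<rightarrow>\<^sub>M hist_space (Suc n)" using Suc.prems by measurable
    then have [measurable]: "(\<lambda>z. regret \<sigma> \<theta> k (Suc n) (h(n := z))) \<in> borel_measurable obs"
      by (intro measurable_regret'[OF \<sigma>]) (auto simp: space_pair_measure)
    show ?thesis by (subst nn_integral_step_law) (auto intro!: borel_measurable_add simp: measurable_gap_obs)
  qed
  finally show ?case .
qed

lemma remaining_loss_eq:
  assumes h: "h \<in> space (hist_space n)" and n: "n \<le> N"
  shows "remaining_loss N \<sigma> n h \<theta> = enn2real (regret \<sigma> \<theta> (N - n) n h)"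
proof -
  have [measurable]: "(\<lambda>\<omega>. gap \<theta> (fst (\<omega> i))) \<in> borel_measurable (path_law \<sigma> \<theta> n (N - n) h)" if "i < N" for i
    using measurable_path_component[OF h, of i "N - n"] that by (intro measurable_gap_obs) auto
  have "remaining_loss N \<sigma> n h \<theta> = enn2real (\<integral>\<^sup>+\<omega>. ennreal (\<Sum>k=n..<N. gap \<theta> (fst (\<omega> k))) \<partial>path_law \<sigma> \<theta> n (N - n) h)"
    unfolding remaining_loss_def
    by (intro integral_eq_nn_integral borel_measurable_sum AE_I2 sum_nonneg gap_ge_0) auto
  also have "(\<integral>\<^sup>+\<omega>. ennreal (\<Sum>k=n..<N. gap \<theta> (fst (\<omega> k))) \<partial>path_law \<sigma> \<theta> n (N - n) h) =
    (\<integral>\<^sup>+\<omega>. (\<Sum>i\<in>{n..<n + (N - n)}. ennreal (gap \<theta> (fst (\<omega> i)))) \<partial>path_law \<sigma> \<theta> n (N - n) h)"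
    by (subst sum_ennreal, rule gap_ge_0, simp add: n)
  also have "\<dots> = regret \<sigma> \<theta> (N - n) n h" by (rule nn_integral_path_law_gap[OF h])
  finally show ?thesis .
qed

text \<open>Projection discards everything after step \<open>k + 1\<close>; the kernel is then split
  just before that step.\<close>

lemma nn_integral_path_component:
  assumes [measurable]: "f \<in> borel_measurable obs" and u: "h \<in> space (hist_space 0)" and k: "k < N"
  shows "(\<integral>\<^sup>+\<omega>. f (\<omega> k) \<partial>path_law \<sigma> \<theta> 0 N h) =
    (\<integral>\<^sup>+h. (\<integral>\<^sup>+z. f z \<partial>step_law \<sigma> \<theta> k h) \<partial>path_law \<sigma> \<theta> 0 k h)"
proof -
  have h: "h \<in> space (Pi\<^sub>M {0..<0} (\<lambda>_. obs))" using u by (simp add: hist_space_def)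
  have m: "(\<lambda>\<omega>. f (\<omega> k)) \<in> borel_measurable (Pi\<^sub>M {0..<Suc k} (\<lambda>_. obs))"
    using measurable_hist_component[of k "Suc k"] unfolding hist_space_def by measurable
  have "(\<integral>\<^sup>+\<omega>. f (\<omega> k) \<partial>IT.C 0 (Suc k) h) = (\<integral>\<^sup>+\<omega>. f ((restrict \<omega> {0..<0 + Suc k}) k) \<partial>IT.C 0 N h)"
    by (rule IT.nn_integral_C) (use k h m in auto)
  then have "(\<integral>\<^sup>+\<omega>. f (\<omega> k) \<partial>path_law \<sigma> \<theta> 0 N h) = (\<integral>\<^sup>+\<omega>. f (\<omega> k) \<partial>(IT.C 0 k h \<bind> IT.eP k))"
    by (simp add: path_law_def)
  also have "\<dots> = (\<integral>\<^sup>+h. (\<integral>\<^sup>+\<omega>. f (\<omega> k) \<partial>IT.eP k h) \<partial>IT.C 0 k h)"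
    using IT.measurable_eP[of k] measurable_cong_sets[OF IT.sets_C[OF h, of k] refl] unfolding add_0
    by (intro nn_integral_bind[OF m]) blast
  also have "\<dots> = (\<integral>\<^sup>+h. (\<integral>\<^sup>+z. f z \<partial>step_law \<sigma> \<theta> k h) \<partial>IT.C 0 k h)"
    using m by (intro nn_integral_cong) (simp add: IT.space_C[OF h] IT.nn_integral_eP)
  finally show ?thesis by (simp add: path_law_def)
qed

text \<open>Given the past and the action, the income minus its \<open>arm_mean\<close> is centred.
  Integrability is established along the way, since \<open>loss\<close> uses a Bochner integral of
  signed incomes.\<close>

lemma integral_income:
  assumes u: "h \<in> space (hist_space 0)" and k: "k < N"
  shows "integrable (path_law \<sigma> \<theta> 0 N h) (\<lambda>\<omega>. snd (\<omega> k))"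
    and "integrable (path_law \<sigma> \<theta> 0 N h) (\<lambda>\<omega>. arm_mean \<theta> (fst (\<omega> k)))"
    and "(\<integral>\<omega>. snd (\<omega> k) \<partial>path_law \<sigma> \<theta> 0 N h) = (\<integral>\<omega>. arm_mean \<theta> (fst (\<omega> k)) \<partial>path_law \<sigma> \<theta> 0 N h)"
proof -
  let ?P = "path_law \<sigma> \<theta> 0 N h" and ?d = "\<lambda>z. snd z - arm_mean \<theta> (fst z)"
  interpret P: prob_space ?P by (rule prob_space_path_law[OF u])
  have [measurable]: "(\<lambda>\<omega>. \<omega> k) \<in> ?P \<rightarrow>\<^sub>M obs"
    using measurable_path_component[OF u, of k N] k by simp
  have [measurable]: "(\<lambda>z. arm_mean \<theta> (fst z)) \<in> borel_measurable obs"
    using measurable_compose[OF measurable_fst_obs, of "arm_mean \<theta>" borel] by simp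
  have E: "(\<integral>\<^sup>+\<omega>. f (\<omega> k) \<partial>?P) = (\<integral>\<^sup>+h. (\<Sum>l\<in>UNIV. ennreal (pmf (\<sigma> k h) l) *
     (\<integral>\<^sup>+x. ennreal (gauss 1 (arm_mean \<theta> l) x) * f (l, x) \<partial>lborel)) \<partial>path_law \<sigma> \<theta> 0 k h)"
    if "f \<in> borel_measurable obs" for f
    using nn_integral_path_component[OF that u k] by (simp add: nn_integral_step_law[OF that])
  have eq: "(\<integral>\<^sup>+\<omega>. ennreal (?d (\<omega> k)) \<partial>?P) = (\<integral>\<^sup>+\<omega>. ennreal (- ?d (\<omega> k)) \<partial>?P)"
    by (subst (1 2) E) (simp_all add: nn_integral_gauss_reflect)
  \<comment> \<open>Bounding both choice probabilities by 1 yields a constant independent of the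
    history.\<close>
  let ?B = "\<Sum>l\<in>UNIV. \<integral>\<^sup>+x. ennreal (gauss 1 (arm_mean \<theta> l) x) * ennreal \<bar>x - arm_mean \<theta> l\<bar> \<partial>lborel"
  have "(\<integral>\<^sup>+\<omega>. ennreal \<bar>?d (\<omega> k)\<bar> \<partial>?P) \<le> (\<integral>\<^sup>+h. ?B \<partial>path_law \<sigma> \<theta> 0 k h)"
  proof (subst E)
    have "ennreal (pmf p l) * b \<le> b" for p :: "arm pmf" and l b
      using mult_right_mono[of "ennreal (pmf p l)" 1 b] by (simp add: pmf_le_1)
    then show "(\<integral>\<^sup>+h. (\<Sum>l\<in>UNIV. ennreal (pmf (\<sigma> k h) l) * (\<integral>\<^sup>+x. ennreal (gauss 1 (arm_mean \<theta> l) x) *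
         ennreal \<bar>snd (l, x) - arm_mean \<theta> (fst (l, x))\<bar> \<partial>lborel)) \<partial>path_law \<sigma> \<theta> 0 k h) \<le> (\<integral>\<^sup>+h. ?B \<partial>path_law \<sigma> \<theta> 0 k h)"
      by (intro nn_integral_mono sum_mono) simp
  qed simp
  also have "\<dots> = ?B"
    using prob_space.emeasure_space_1[OF prob_space_path_law[OF u]] by simp
  also have "?B < \<infinity>"
    using nn_integral_gauss_abs by (simp add: sum_arm)
  finally have I: "integrable ?P (\<lambda>\<omega>. ?d (\<omega> k))"
    by (intro integrableI_bounded) auto
  have "(\<integral>\<omega>. ?d (\<omega> k) \<partial>?P) = 0"
    using real_lebesgue_integral_def[OF I] eq by simp
  show A: "integrable ?P (\<lambda>\<omega>. arm_mean \<theta> (fst (\<omega> k)))"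
  proof (rule P.integrable_const_bound)
    have "\<bar>arm_mean \<theta> l\<bar> \<le> max \<bar>fst \<theta>\<bar> \<bar>snd \<theta>\<bar>" for l by (cases l; cases \<theta>) auto
    then show "AE \<omega> in ?P. norm (arm_mean \<theta> (fst (\<omega> k))) \<le> max \<bar>fst \<theta>\<bar> \<bar>snd \<theta>\<bar>" by simp
  qed measurable
  have "integrable ?P (\<lambda>\<omega>. ?d (\<omega> k) + arm_mean \<theta> (fst (\<omega> k)))"
    by (intro Bochner_Integration.integrable_add I A)
  then show S: "integrable ?P (\<lambda>\<omega>. snd (\<omega> k))" by simp
  show "(\<integral>\<omega>. snd (\<omega> k) \<partial>?P) = (\<integral>\<omega>. arm_mean \<theta> (fst (\<omega> k)) \<partial>?P)"
    using \<open>(\<integral>\<omega>. ?d (\<omega> k) \<partial>?P) = 0\<close> A S by simp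
qed

text \<open>Replacing each income by the mean of the chosen arm turns the loss into an expected sum
  of gaps.\<close>

lemma loss_eq: "loss N \<sigma> \<theta> = enn2real (regret \<sigma> \<theta> N 0 (\<lambda>_. undefined))"
proof -
  let ?u = "\<lambda>_. undefined :: arm \<times> real" let ?P = "path_law \<sigma> \<theta> 0 N ?u"
  have u: "?u \<in> space (hist_space 0)" by (simp add: hist_space_def space_PiM)
  interpret P: prob_space ?P by (rule prob_space_path_law[OF u])
  have "(\<integral>\<omega>. (\<Sum>k<N. snd (\<omega> k)) \<partial>?P) = (\<integral>\<omega>. (\<Sum>k<N. arm_mean \<theta> (fst (\<omega> k))) \<partial>?P)"
    using integral_income[OF u] by (subst (1 2) Bochner_Integration.integral_sum) auto
  then have "loss N \<sigma> \<theta> = real N * best_mean \<theta> - (\<integral>\<omega>. (\<Sum>k<N. arm_mean \<theta> (fst (\<omega> k))) \<partial>?P)"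
    by (simp add: loss_def)
  also have "\<dots> = (\<integral>\<omega>. real N * best_mean \<theta> - (\<Sum>k<N. arm_mean \<theta> (fst (\<omega> k))) \<partial>?P)"
    using integral_income(2)[OF u]
    by (subst Bochner_Integration.integral_diff) (auto simp: P.prob_space intro!: Bochner_Integration.integrable_sum)
  also have "\<dots> = remaining_loss N \<sigma> 0 ?u \<theta>"
    by (simp add: remaining_loss_def sum_subtractf atLeast0LessThan)
  finally show ?thesis using remaining_loss_eq[OF u, of N] by simp
qed

end

section \<open>Likelihoods and the flat prior\<close>

lemma arm_count_Suc: "arm_count (Suc n) h = (arm_count n h)(fst (h n) := arm_count n h (fst (h n)) + 1)"
proof
  fix l
  have "{k. k < Suc n \<and> fst (h k) = l} = {k. k < n \<and> fst (h k) = l} \<union> (if fst (h n) = l then {n} else {})"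
    by (auto simp: less_Suc_eq)
  then show "arm_count (Suc n) h l = ((arm_count n h)(fst (h n) := arm_count n h (fst (h n)) + 1)) l"
    by (auto simp: arm_count_def card_insert_if)
qed

lemma arm_income_Suc: "arm_income (Suc n) h = (arm_income n h)(fst (h n) := arm_income n h (fst (h n)) + snd (h n))"
proof
  fix l
  have "{k. k < Suc n \<and> fst (h k) = l} = (if fst (h n) = l then insert n {k. k < n \<and> fst (h k) = l} else {k. k < n \<and> fst (h k) = l})"
    by (auto simp: less_Suc_eq)
  then show "arm_income (Suc n) h l = ((arm_income n h)(fst (h n) := arm_income n h (fst (h n)) + snd (h n))) l"
    by (auto simp: arm_income_def)
qed

lemma arm_count_upd_ge [simp]: "n \<le> k \<Longrightarrow> arm_count n (h(k := z)) = arm_count n h"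
  unfolding arm_count_def by (intro ext arg_cong[where f=card]) auto

lemma arm_income_upd_ge [simp]: "n \<le> k \<Longrightarrow> arm_income n (h(k := z)) = arm_income n h"
  unfolding arm_income_def by (intro ext sum.cong) auto

lemma arm_count_upd: "arm_count (Suc n) (h(n := (l, x))) = (arm_count n h)(l := arm_count n h l + 1)"
  by (simp add: arm_count_Suc)

lemma arm_income_upd: "arm_income (Suc n) (h(n := (l, x))) = (arm_income n h)(l := arm_income n h l + x)"
  by (simp add: arm_income_Suc)

lemma steps_arm_count: "steps (arm_count n h) = n"
proof (induction n)
  case 0 then show ?case by (simp add: arm_count_def)
next
  case (Suc n) then show ?case unfolding arm_count_Suc steps_upd by simp
qed

text \<open>Choice probabilities are left out: they depend on the history but not on the
  parameter.\<close>

definition likelihood :: "real \<times> real \<Rightarrow> nat \<Rightarrow> history \<Rightarrow> real" where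
  "likelihood \<theta> n h = (\<Prod>k<n. gauss 1 (arm_mean \<theta> (fst (h k))) (snd (h k)))"

definition noise_factor :: "nat \<Rightarrow> history \<Rightarrow> real" where
  "noise_factor n h = (\<Prod>k<n. exp (- (snd (h k))\<^sup>2 / 2) / sqrt (2 * pi))"

definition total_income :: "nat \<Rightarrow> history \<Rightarrow> real" where
  "total_income n h = arm_income n h Arm1 + arm_income n h Arm2"

text \<open>The factor e of the overview: the marginal density of the incomes at v = 0 when
  \<open>m\<close> has Lebesgue measure as prior. It is meaningful for positive \<open>n\<close>
  only; at \<open>n = 0\<close> the expression is 0 although the true mass is infinite.\<close>

definition evidence :: "nat \<Rightarrow> history \<Rightarrow> real" where
  "evidence n h = noise_factor n h * sqrt (2 * pi / real n) * exp ((total_income n h)\<^sup>2 / (2 * real n))"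

lemma likelihood_nonneg [simp]: "0 \<le> likelihood \<theta> n h"
  unfolding likelihood_def by (intro prod_nonneg) auto

lemma measurable_likelihood [measurable (raw)]:
  assumes [measurable]: "f \<in> N \<rightarrow>\<^sub>M borel \<Otimes>\<^sub>M borel"
  shows "(\<lambda>x. likelihood (f x) n h) \<in> borel_measurable N"
  unfolding likelihood_def by measurable

lemma likelihood_upd: "likelihood \<theta> (Suc n) (h(n := (l, x))) = likelihood \<theta> n h * gauss 1 (arm_mean \<theta> l) x"
  by (simp add: likelihood_def)

lemma noise_factor_pos: "0 < noise_factor n h"
  unfolding noise_factor_def by (intro prod_pos) auto

lemma evidence_pos: "0 < n \<Longrightarrow> 0 < evidence n h"
  by (simp add: evidence_def noise_factor_pos)

lemma total_income_upd: "total_income (Suc n) (h(n := (l, x))) = total_income n h + x"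
  by (cases l) (simp_all add: total_income_def arm_income_upd)

text \<open>Exponential family form: apart from \<open>noise_factor\<close>, which is free of the
  parameter, only counts and total incomes enter.\<close>

lemma likelihood_exp: "likelihood (m1, m2) n h = noise_factor n h *
  exp (m1 * arm_income n h Arm1 - real (arm_count n h Arm1) * m1\<^sup>2 / 2
     + m2 * arm_income n h Arm2 - real (arm_count n h Arm2) * m2\<^sup>2 / 2)"
proof (induction n)
  case 0 then show ?case by (simp add: likelihood_def noise_factor_def arm_count_def arm_income_def)
next
  case (Suc n)
  have g: "gauss 1 \<mu> x = exp (- x\<^sup>2 / 2) / sqrt (2 * pi) * exp (\<mu> * x - \<mu>\<^sup>2 / 2)" for \<mu> x
    by (simp add: gauss_def normal_density_def exp_add[symmetric] power2_eq_square field_simps)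
  have "likelihood (m1, m2) (Suc n) h = likelihood (m1, m2) n h * gauss 1 (arm_mean (m1, m2) (fst (h n))) (snd (h n))"
    by (simp add: likelihood_def)
  also have "\<dots> = noise_factor (Suc n) h *
    (exp (m1 * arm_income n h Arm1 - real (arm_count n h Arm1) * m1\<^sup>2 / 2
     + m2 * arm_income n h Arm2 - real (arm_count n h Arm2) * m2\<^sup>2 / 2) *
     exp (arm_mean (m1, m2) (fst (h n)) * snd (h n) - (arm_mean (m1, m2) (fst (h n)))\<^sup>2 / 2))"
    unfolding Suc.IH g by (simp add: noise_factor_def mult_ac)
  finally show ?case
    unfolding exp_add[symmetric] arm_count_Suc arm_income_Suc
    by (cases "fst (h n)") (simp_all add: field_simps)
qed

text \<open>Completing the square in \<open>m\<close>. Given \<open>v\<close>, the posterior of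
  \<open>m\<close> is normal with mean \<open>\<mu>\<close> and variance 1 / n, so integrating over
  \<open>m\<close> just removes the last factor.\<close>

lemma likelihood_eq_evidence:
  fixes h :: history and v :: real
  assumes n: "0 < n"
  defines "D \<equiv> precision (arm_count n h)"
  defines "\<mu> \<equiv> total_income n h / n - (real (arm_count n h Arm1) - real (arm_count n h Arm2)) * v / n"
  shows "likelihood (m + v, m - v) n h = evidence n h * exp (2 * U_stat n h * v - 2 * v\<^sup>2 * D) * gauss (1 / n) \<mu> m"
proof -
  define a b x y N where "a = real (arm_count n h Arm1)" and "b = real (arm_count n h Arm2)"
    and "x = arm_income n h Arm1" and "y = arm_income n h Arm2" and "N = real n"
  note defs = a_def[symmetric] b_def[symmetric] x_def[symmetric] y_def[symmetric] N_def[symmetric]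
  have N: "N = a + b" "0 < N" using steps_arm_count[of n h] n
    by (simp_all add: a_def b_def N_def flip: of_nat_add)
  have gauss: "gauss (1 / N) \<mu> m = exp (- (N * (m - \<mu>)\<^sup>2 / 2)) / sqrt (2 * pi / N)"
    using N by (simp add: gauss_def normal_density_def)
  have D: "D = a * b / N" using N unfolding D_def precision_def by (simp add: a_def b_def)
  have U: "U_stat n h = (x * b - y * a) / N" unfolding U_stat_def defs ..
  have \<mu>: "N * \<mu> = x + y - (a - b) * v"
    using N(2) unfolding \<mu>_def total_income_def defs by (simp add: right_diff_distrib)
  define L where "L = (m + v) * x - a * (m + v)\<^sup>2 / 2 + (m - v) * y - b * (m - v)\<^sup>2 / 2"
  \<comment> \<open>Multiplied by 2 N, the identity between the exponents becomes
    polynomial.\<close>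
  have "N * (2 * L) = (a + b) * (2 * ((m + v) * x) - a * (m + v)\<^sup>2 + 2 * ((m - v) * y) - b * (m - v)\<^sup>2)"
    unfolding L_def N(1) by simp
  also have "\<dots> = (x + y)\<^sup>2 + 4 * v * (x * b - y * a) - 4 * v\<^sup>2 * (a * b) - ((a + b) * m - (x + y - (a - b) * v))\<^sup>2"
    by algebra
  also have "\<dots> = (x + y)\<^sup>2 + 4 * v * (x * b - y * a) - 4 * v\<^sup>2 * (a * b) - (N * m - N * \<mu>)\<^sup>2"
    unfolding \<mu> by (simp only: N(1))
  finally have "L = ((x + y)\<^sup>2 + 4 * v * (x * b - y * a) - 4 * v\<^sup>2 * (a * b) - (N * m - N * \<mu>)\<^sup>2) / (2 * N)"
    using N(2) by (simp add: divide_simps mult_ac)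
  moreover have "N * (m - \<mu>)\<^sup>2 / 2 = (N * m - N * \<mu>)\<^sup>2 / (2 * N)"
    using N(2) by (simp add: right_diff_distrib[symmetric] power_mult_distrib power2_eq_square)
  moreover have "4 * v * (x * b - y * a) / (2 * N) = 2 * ((x * b - y * a) / N) * v"
    "4 * v\<^sup>2 * (a * b) / (2 * N) = 2 * v\<^sup>2 * (a * b / N)" by simp_all
  ultimately have e: "(m + v) * x - a * (m + v)\<^sup>2 / 2 + (m - v) * y - b * (m - v)\<^sup>2 / 2 =
     (x + y)\<^sup>2 / (2 * N) + (2 * ((x * b - y * a) / N) * v - 2 * v\<^sup>2 * (a * b / N)) + - (N * (m - \<mu>)\<^sup>2 / 2)"
    unfolding L_def add_divide_distrib diff_divide_distrib by linarith
  show ?thesis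
    unfolding likelihood_exp evidence_def total_income_def defs gauss D U e exp_add
    using N by simp
qed

lemma nn_integral_likelihood:
  assumes n: "0 < n"
  shows "(\<integral>\<^sup>+m. ennreal (likelihood (m + v, m - v) n h) \<partial>lborel) =
    ennreal (evidence n h * exp (2 * U_stat n h * v - 2 * v\<^sup>2 * precision (arm_count n h)))"
  unfolding likelihood_eq_evidence[OF n] using n evidence_pos[OF n, of h]
  by (simp add: ennreal_mult' nn_integral_cmult nn_integral_gauss)

text \<open>The Gaussian factor is the predictive density of the next income at v = 0: centred at
  the overall average, with variance 1 + 1 / n. It is the same for both arms, as both then have mean
  \<open>m\<close>.\<close>

lemma evidence_upd:
  assumes n: "0 < n"
  shows "evidence (Suc n) (h(n := (l, x))) = evidence n h * gauss (real (Suc n) / n) (total_income n h / n) x"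
proof -
  define S N where "S = total_income n h" and "N = real n"
  have N: "0 < N" using n by (simp add: N_def)
  have "(N + 1) * N * (2 * (- x\<^sup>2 / 2 + (S + x)\<^sup>2 / (2 * (N + 1)))) =
    (N + 1) * N * (2 * (S\<^sup>2 / (2 * N) + - ((x - S / N)\<^sup>2 / (2 * ((N + 1) / N)))))"
    using N by (simp add: divide_simps) (simp add: power2_eq_square algebra_simps)
  then have e: "- x\<^sup>2 / 2 + (S + x)\<^sup>2 / (2 * (N + 1)) = S\<^sup>2 / (2 * N) + - ((x - S / N)\<^sup>2 / (2 * ((N + 1) / N)))"
    using N by simp
  have noise: "noise_factor (Suc n) (h(n := (l, x))) = noise_factor n h * (exp (- x\<^sup>2 / 2) / sqrt (2 * pi))"
    by (simp add: noise_factor_def)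
  have sq: "sqrt (2 * pi / (N + 1)) / sqrt (2 * pi) = sqrt (2 * pi / N) / sqrt (2 * pi * ((N + 1) / N))"
    using N by (simp add: real_sqrt_divide real_sqrt_mult)
  have "evidence (Suc n) (h(n := (l, x))) = noise_factor n h * (sqrt (2 * pi / (N + 1)) / sqrt (2 * pi)) *
      exp (- x\<^sup>2 / 2 + (S + x)\<^sup>2 / (2 * (N + 1)))"
    unfolding evidence_def noise total_income_upd S_def[symmetric] exp_add
    by (simp add: N_def add.commute)
  also have "\<dots> = evidence n h * gauss ((N + 1) / N) (S / N) x"
    unfolding e sq exp_add evidence_def S_def[symmetric] N_def[symmetric] gauss_def normal_density_def
    using N by simp
  finally show ?thesis by (simp add: S_def N_def add.commute)
qed

text \<open>Only the innovation, the income minus the overall average, moves \<open>U_stat\<close>;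
  this is what makes it a random walk under the predictive law.\<close>

lemma U_stat_upd:
  assumes n: "0 < n"
  shows "U_stat (Suc n) (h(n := (l, x))) = U_stat n h -
    arm_sign l * (real (arm_count n h (other_arm l)) / real (Suc n)) * (x - total_income n h / n)"
proof -
  define a b X Y where "a = real (arm_count n h Arm1)" and "b = real (arm_count n h Arm2)"
    and "X = arm_income n h Arm1" and "Y = arm_income n h Arm2"
  note defs = a_def[symmetric] b_def[symmetric] X_def[symmetric] Y_def[symmetric]
  have N: "real n = a + b" "0 < a + b" using steps_arm_count[of n h] n
    by (simp_all add: a_def b_def flip: of_nat_add)
  show ?thesis
    unfolding U_stat_def total_income_def arm_count_upd arm_income_upd
    by (cases l) (simp_all add: defs N(1), use N(2) in \<open>simp_all add: divide_simps add_pos_pos\<close>, simp_all add: algebra_simps)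
qed

text \<open>The innovation has variance (n + 1) / n, and the factor b / (n + 1) from
  \<open>U_stat_upd\<close> turns this into b^2 / (n (n + 1)), the increase of
  \<open>precision\<close>. The sign belonging to the arm disappears by symmetry of the normal
  law.\<close>

lemma nn_integral_evidence_upd:
  fixes h :: history
  assumes n: "0 < n" and [measurable]: "F \<in> borel_measurable borel"
  defines "c \<equiv> arm_count n h"
  shows "(\<integral>\<^sup>+x. ennreal (evidence (Suc n) (h(n := (l, x)))) * F (U_stat (Suc n) (h(n := (l, x)))) \<partial>lborel) =
    ennreal (evidence n h) * smooth (precision (c(l := c l + 1)) - precision c) F (U_stat n h)"
proof -
  define N q \<mu> b s where "N = real n" and "q = (N + 1) / N" and "\<mu> = total_income n h / N"
    and "b = real (c (other_arm l))" and "s = precision (c(l := c l + 1)) - precision c"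
  have N: "0 < N" "0 < q" using n by (simp_all add: N_def q_def)
  have b: "0 \<le> b" by (simp add: b_def)
  have "s = b\<^sup>2 / (N * (N + 1))"
    unfolding s_def b_def using n by (subst precision_diff) (simp_all add: c_def steps_arm_count N_def add.commute)
  also have "\<dots> = (b / (N + 1))\<^sup>2 * q" using N unfolding q_def by (simp add: divide_simps power2_eq_square)
  finally have s: "sqrt s = b / (N + 1) * sqrt q" using N b by (simp add: real_sqrt_mult)
  have g: "gauss q \<mu> (\<mu> + sqrt q * z) * sqrt q = std_normal_density z" for z
    using N by (simp add: gauss_def normal_density_def std_normal_density_def real_sqrt_mult power_mult_distrib)
  have ev: "evidence (Suc n) (h(n := (l, x))) = evidence n h * gauss q \<mu> x" for x
    using evidence_upd[OF n, of h l x] by (simp add: q_def N_def \<mu>_def add.commute)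
  have U: "U_stat (Suc n) (h(n := (l, x))) = U_stat n h - arm_sign l * (b / (N + 1)) * (x - \<mu>)" for x
    unfolding U_stat_upd[OF n] by (simp add: b_def c_def N_def \<mu>_def add.commute)
  let ?U = "U_stat n h"
  have "(\<integral>\<^sup>+x. ennreal (evidence (Suc n) (h(n := (l, x)))) * F (U_stat (Suc n) (h(n := (l, x)))) \<partial>lborel) =
    (\<integral>\<^sup>+z. ennreal \<bar>sqrt q\<bar> * (ennreal (evidence n h * gauss q \<mu> (\<mu> + sqrt q * z)) *
        F (?U - arm_sign l * (b / (N + 1)) * ((\<mu> + sqrt q * z) - \<mu>))) \<partial>lborel)"
    unfolding ev U by (rule nn_integral_lborel_affine[symmetric]) (use N in auto)
  also have "\<dots> = (\<integral>\<^sup>+z. ennreal (evidence n h) * (F (?U - arm_sign l * (sqrt s * z)) * ennreal (std_normal_density z)) \<partial>lborel)"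
  proof (intro nn_integral_cong)
    fix z
    have 1: "ennreal \<bar>sqrt q\<bar> * ennreal (evidence n h * gauss q \<mu> (\<mu> + sqrt q * z)) =
        ennreal (evidence n h) * ennreal (std_normal_density z)"
      using N evidence_pos[OF n, of h] unfolding g[symmetric]
      by (simp add: ennreal_mult'[symmetric] mult_ac)
    have 2: "arm_sign l * (b / (N + 1)) * ((\<mu> + sqrt q * z) - \<mu>) = arm_sign l * (sqrt s * z)"
      unfolding s by simp
    show "ennreal \<bar>sqrt q\<bar> * (ennreal (evidence n h * gauss q \<mu> (\<mu> + sqrt q * z)) *
        F (?U - arm_sign l * (b / (N + 1)) * ((\<mu> + sqrt q * z) - \<mu>))) =
      ennreal (evidence n h) * (F (?U - arm_sign l * (sqrt s * z)) * ennreal (std_normal_density z))"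
      unfolding 2 mult.assoc[symmetric, of "ennreal \<bar>sqrt q\<bar>"] 1 by (simp only: mult_ac)
  qed
  also have "\<dots> = ennreal (evidence n h) * (\<integral>\<^sup>+z. F (?U - arm_sign l * (sqrt s * z)) * ennreal (std_normal_density z) \<partial>lborel)"
    by (intro nn_integral_cmult) measurable
  also have "(\<integral>\<^sup>+z. F (?U - arm_sign l * (sqrt s * z)) * ennreal (std_normal_density z) \<partial>lborel) = smooth s F ?U"
    by (cases l) (simp_all add: smooth_uminus, simp add: smooth_def)
  finally show ?thesis unfolding s_def .
qed

text \<open>The normal densities of the two totals depend on the parameter exactly as the product
  over single incomes does, so \<open>K\<close> cancels in the posterior. Zero counts are excluded
  because \<open>gauss 0\<close> vanishes.\<close>

lemma likelihood_eq_posterior_weight: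
  assumes "0 < arm_count n h Arm1" "0 < arm_count n h Arm2"
  obtains K where "0 < K" "\<And>m v. likelihood (m + v, m - v) n h * \<rho> v = K * posterior_weight \<rho> n h m v"
proof -
  have g: "gauss c (c * \<mu>) X = exp (- X\<^sup>2 / (2 * c)) / sqrt (2 * pi * c) * exp (\<mu> * X - c * \<mu>\<^sup>2 / 2)" if "0 < c" for c \<mu> X
    using that by (simp add: gauss_def normal_density_def exp_add[symmetric])
      (simp add: power2_eq_square field_simps)
  define Q where "Q l = exp (- (arm_income n h l)\<^sup>2 / (2 * real (arm_count n h l))) / sqrt (2 * pi * real (arm_count n h l))" for l
  have Q: "0 < Q Arm1" "0 < Q Arm2" using assms by (simp_all add: Q_def)
  have "likelihood (m + v, m - v) n h * \<rho> v = noise_factor n h / (Q Arm1 * Q Arm2) * posterior_weight \<rho> n h m v" for m v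
  proof -
    define E1 where "E1 = exp ((m + v) * arm_income n h Arm1 - real (arm_count n h Arm1) * (m + v)\<^sup>2 / 2)"
    define E2 where "E2 = exp ((m - v) * arm_income n h Arm2 - real (arm_count n h Arm2) * (m - v)\<^sup>2 / 2)"
    have P: "posterior_weight \<rho> n h m v = (Q Arm1 * E1) * (Q Arm2 * E2) * \<rho> v"
      unfolding posterior_weight_def Q_def E1_def E2_def using assms by (simp only: g of_nat_0_less_iff)
    have L: "likelihood (m + v, m - v) n h = noise_factor n h * (E1 * E2)"
      unfolding likelihood_exp E1_def E2_def exp_add[symmetric] by (simp add: algebra_simps)
    show ?thesis unfolding P L using Q by simp
  qed
  with that[of "noise_factor n h / (Q Arm1 * Q Arm2)"] Q noise_factor_pos show ?thesis by simp
qed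

section \<open>The recursion as a lower bound\<close>

abbreviation param :: "real \<times> real \<Rightarrow> real \<times> real" where
  "param p \<equiv> (fst p + snd p, fst p - snd p)"

context symmetric_prior
begin

text \<open>Unnormalized posterior expectation in the coordinates \<open>p = (m, v)\<close>, with
  Lebesgue measure for \<open>m\<close>.\<close>

definition bayes_regret :: "strategy \<Rightarrow> nat \<Rightarrow> nat \<Rightarrow> history \<Rightarrow> ennreal" where
  "bayes_regret \<sigma> t n h =
     (\<integral>\<^sup>+p. regret \<sigma> (param p) t n h * ennreal (likelihood (param p) n h * \<rho> (snd p)) \<partial>(lborel \<Otimes>\<^sub>M lborel))"

text \<open>Of the \<open>t\<close> remaining steps, \<open>t mod M\<close> finish the current
  packet with the arm last used, and \<open>t div M\<close> free packets follow. At a packet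
  boundary the first number is 0 and the last arm drops out.\<close>

definition hist_value :: "nat \<Rightarrow> nat \<Rightarrow> nat \<Rightarrow> history \<Rightarrow> ennreal" where
  "hist_value M t n h =
     packet_value \<rho> (opt_value \<rho> M (t div M)) (fst (h (n - 1))) (t mod M) (U_stat n h) (arm_count n h)"

lemma nn_integral_likelihood_rho:
  assumes n: "0 < n" and [measurable]: "f \<in> borel_measurable borel"
  shows "(\<integral>\<^sup>+p. f (snd p) * ennreal (likelihood (param p) n h * \<rho> (snd p)) \<partial>(lborel \<Otimes>\<^sub>M lborel)) =
    ennreal (evidence n h) *
      (\<integral>\<^sup>+v. f v * ennreal (\<rho> v * exp (2 * U_stat n h * v - 2 * v\<^sup>2 * precision (arm_count n h))) \<partial>lborel)"
proof -
  have "(\<integral>\<^sup>+p. f (snd p) * ennreal (likelihood (param p) n h * \<rho> (snd p)) \<partial>(lborel \<Otimes>\<^sub>M lborel)) =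
    (\<integral>\<^sup>+v. (\<integral>\<^sup>+m. f v * ennreal (likelihood (m + v, m - v) n h * \<rho> v) \<partial>lborel) \<partial>lborel)"
    by (subst lborel_pair.nn_integral_snd[symmetric]) simp_all
  also have "\<dots> = (\<integral>\<^sup>+v. f v * ennreal (\<rho> v) * (\<integral>\<^sup>+m. ennreal (likelihood (m + v, m - v) n h) \<partial>lborel) \<partial>lborel)"
    by (simp add: nn_integral_cmult[symmetric] ennreal_mult mult_ac)
  also have "\<dots> = (\<integral>\<^sup>+v. ennreal (evidence n h) * (f v * ennreal (\<rho> v * exp (2 * U_stat n h * v - 2 * v\<^sup>2 * precision (arm_count n h)))) \<partial>lborel)"
    unfolding nn_integral_likelihood[OF n] using evidence_pos[OF n, of h]
    by (intro nn_integral_cong) (simp add: ennreal_mult mult_ac)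
  also have "\<dots> = ennreal (evidence n h) *
      (\<integral>\<^sup>+v. f v * ennreal (\<rho> v * exp (2 * U_stat n h * v - 2 * v\<^sup>2 * precision (arm_count n h))) \<partial>lborel)"
    by (intro nn_integral_cmult) measurable
  finally show ?thesis .
qed

lemma nn_integral_gap_likelihood:
  assumes n: "0 < n"
  shows "(\<integral>\<^sup>+p. ennreal (gap (param p) l) * ennreal (likelihood (param p) n h * \<rho> (snd p)) \<partial>(lborel \<Otimes>\<^sub>M lborel)) =
    ennreal (evidence n h) * weighted_gap \<rho> l (U_stat n h) (precision (arm_count n h))"
  unfolding gap_shift weighted_gap_def
  by (subst nn_integral_likelihood_rho[OF n, of "\<lambda>v. ennreal (\<bar>v\<bar> + arm_sign l * v)"])
     (simp_all add: ennreal_mult'[symmetric] mult.assoc)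

text \<open>Tonelli exchanges the parameter with the next income, and the density of that income is
  absorbed into the likelihood of the longer history.\<close>

lemma bayes_regret_Suc:
  assumes \<sigma>: "measurable_strategy \<sigma>" and h: "h \<in> space (hist_space n)"
  shows "bayes_regret \<sigma> (Suc t) n h = (\<Sum>l\<in>UNIV. ennreal (pmf (\<sigma> n h) l) *
    ((\<integral>\<^sup>+p. ennreal (gap (param p) l) * ennreal (likelihood (param p) n h * \<rho> (snd p)) \<partial>(lborel \<Otimes>\<^sub>M lborel)) +
     (\<integral>\<^sup>+x. bayes_regret \<sigma> t (Suc n) (h(n := (l, x))) \<partial>lborel)))"
proof -
  let ?P = "lborel \<Otimes>\<^sub>M lborel :: (real \<times> real) measure"
  interpret PS: pair_sigma_finite ?P "lborel :: real measure"
    unfolding lborel_prod by (rule lborel_pair.pair_sigma_finite_axioms)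
  note [measurable] = measurable_regret'[OF \<sigma>]
  define w where "w p = ennreal (likelihood (param p) n h * \<rho> (snd p))" for p
  define g where "g l p x = ennreal (gauss 1 (arm_mean (param p) l) x)" for l p x
  define r where "r l p x = regret \<sigma> (param p) t (Suc n) (h(n := (l, x)))" for l p x
  have [measurable]: "w \<in> borel_measurable ?P" unfolding w_def by measurable
  have [measurable]: "case_prod (g l) \<in> borel_measurable (?P \<Otimes>\<^sub>M lborel)" for l unfolding g_def by measurable
  have [measurable]: "case_prod (r l) \<in> borel_measurable (?P \<Otimes>\<^sub>M lborel)" for l
  proof -
    have "(\<lambda>q. h(n := (l, snd q))) \<in> ?P \<Otimes>\<^sub>M lborel \<rightarrow>\<^sub>M hist_space (Suc n)" using h by measurable
    then show ?thesis unfolding r_def split_beta' by measurable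
  qed
  have [measurable]: "g l p \<in> borel_measurable lborel" for l p unfolding g_def by measurable
  have [measurable]: "r l p \<in> borel_measurable lborel" for l p
  proof -
    have "(\<lambda>x. h(n := (l, x))) \<in> lborel \<rightarrow>\<^sub>M hist_space (Suc n)" using h by measurable
    then show ?thesis unfolding r_def by (intro measurable_regret'[OF \<sigma>]) (auto simp: space_pair_measure)
  qed
  have [measurable]: "(\<lambda>p. ennreal (gap (param p) l)) \<in> borel_measurable ?P" for l by measurable
  have w': "ennreal (likelihood (param p) (Suc n) (h(n := (l, x))) * \<rho> (snd p)) = w p * g l p x" for l p x
    unfolding w_def g_def likelihood_upd by (simp add: ennreal_mult mult_ac)
  have i: "(\<integral>\<^sup>+x. g l p x * (ennreal (gap (param p) l) + r l p x) \<partial>lborel) * w p =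
     ennreal (gap (param p) l) * w p + (\<integral>\<^sup>+x. r l p x * (w p * g l p x) \<partial>lborel)" for l p
  proof -
    have "(\<integral>\<^sup>+x. g l p x * (ennreal (gap (param p) l) + r l p x) \<partial>lborel) =
      (\<integral>\<^sup>+x. g l p x * ennreal (gap (param p) l) \<partial>lborel) + (\<integral>\<^sup>+x. g l p x * r l p x \<partial>lborel)"
      unfolding distrib_left by (intro nn_integral_add borel_measurable_times) simp_all
    also have "(\<integral>\<^sup>+x. g l p x * ennreal (gap (param p) l) \<partial>lborel) = ennreal (gap (param p) l)"
      unfolding g_def by (subst nn_integral_multc) (simp_all add: nn_integral_gauss)
    finally have "(\<integral>\<^sup>+x. g l p x * (ennreal (gap (param p) l) + r l p x) \<partial>lborel) =
      ennreal (gap (param p) l) + (\<integral>\<^sup>+x. g l p x * r l p x \<partial>lborel)" .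
    moreover have "(\<integral>\<^sup>+x. r l p x * (w p * g l p x) \<partial>lborel) = (\<integral>\<^sup>+x. g l p x * r l p x \<partial>lborel) * w p"
      by (subst nn_integral_multc[symmetric]) (simp_all add: mult_ac)
    ultimately show ?thesis by (simp add: distrib_right)
  qed
  have "bayes_regret \<sigma> (Suc t) n h = (\<integral>\<^sup>+p. (\<Sum>l\<in>UNIV. ennreal (pmf (\<sigma> n h) l) *
     (ennreal (gap (param p) l) * w p + (\<integral>\<^sup>+x. r l p x * (w p * g l p x) \<partial>lborel))) \<partial>?P)"
    unfolding bayes_regret_def regret.simps w_def[symmetric] g_def[symmetric] r_def[symmetric] sum_distrib_right i[symmetric]
    by (simp only: mult.assoc)
  also have "\<dots> = (\<Sum>l\<in>UNIV. ennreal (pmf (\<sigma> n h) l) *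
    ((\<integral>\<^sup>+p. ennreal (gap (param p) l) * w p \<partial>?P) + (\<integral>\<^sup>+p. (\<integral>\<^sup>+x. r l p x * (w p * g l p x) \<partial>lborel) \<partial>?P)))"
    by (subst nn_integral_sum, measurable) (subst nn_integral_cmult, measurable, subst nn_integral_add, measurable)
  also have "\<dots> = (\<Sum>l\<in>UNIV. ennreal (pmf (\<sigma> n h) l) *
    ((\<integral>\<^sup>+p. ennreal (gap (param p) l) * w p \<partial>?P) + (\<integral>\<^sup>+x. (\<integral>\<^sup>+p. r l p x * (w p * g l p x) \<partial>?P) \<partial>lborel)))"
    by (subst PS.Fubini') simp_all
  finally show ?thesis
    unfolding bayes_regret_def w' w_def[symmetric] r_def[symmetric] .
qed

text \<open>The counterpart of \<open>bayes_regret_Suc\<close> for the candidate value: the random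
  walk of \<open>U_stat\<close>, then \<open>packet_value_split\<close> with a first piece of length
  one.\<close>

lemma value_step:
  assumes n: "0 < n"
  shows "ennreal (evidence n h) * weighted_gap \<rho> l (U_stat n h) (precision (arm_count n h)) +
      (\<integral>\<^sup>+x. ennreal (evidence (Suc n) (h(n := (l, x)))) * hist_value M t (Suc n) (h(n := (l, x))) \<partial>lborel) =
    ennreal (evidence n h) *
      packet_value \<rho> (opt_value \<rho> M (t div M)) l (Suc (t mod M)) (U_stat n h) (arm_count n h)"
proof -
  let ?c = "arm_count n h" let ?F = "\<lambda>u. packet_value \<rho> (opt_value \<rho> M (t div M)) l (t mod M) u (?c(l := ?c l + 1))"
  have "(\<integral>\<^sup>+x. ennreal (evidence (Suc n) (h(n := (l, x)))) * hist_value M t (Suc n) (h(n := (l, x))) \<partial>lborel) =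
     (\<integral>\<^sup>+x. ennreal (evidence (Suc n) (h(n := (l, x)))) * ?F (U_stat (Suc n) (h(n := (l, x)))) \<partial>lborel)"
    unfolding hist_value_def arm_count_upd by simp
  also have "\<dots> = ennreal (evidence n h) * smooth (precision (?c(l := ?c l + 1)) - precision ?c) ?F (U_stat n h)"
    by (rule nn_integral_evidence_upd[OF n]) measurable
  finally show ?thesis
    using packet_value_split[where F = "opt_value \<rho> M (t div M)" and i = 1 and j = "t mod M" and l = l
        and U = "U_stat n h" and c = ?c, OF measurable_opt_value]
    by (simp add: distrib_left[symmetric] del: fun_upd_apply)
qed

text \<open>A new packet begins, so its arm is still free and the minimum appears; after its first
  step \<open>t mod M = M - 1\<close> steps of it remain.\<close>

lemma hist_value_Suc_dvd:
  assumes M: "1 \<le> M" and d: "M dvd Suc t"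
  shows "hist_value M (Suc t) n h = opt_value \<rho> M (Suc (t div M)) (U_stat n h) (arm_count n h)"
    and "Suc (t mod M) = M"
proof -
  have "Suc t mod M = 0" using d by simp
  then show "Suc (t mod M) = M" using M by (simp add: mod_Suc split: if_splits)
  then show "hist_value M (Suc t) n h = opt_value \<rho> M (Suc (t div M)) (U_stat n h) (arm_count n h)"
    unfolding hist_value_def using \<open>Suc t mod M = 0\<close> by (simp add: div_Suc)
qed

lemma hist_value_Suc_not_dvd:
  assumes "\<not> M dvd Suc t"
  shows "hist_value M (Suc t) n h =
    packet_value \<rho> (opt_value \<rho> M (t div M)) (fst (h (n - 1))) (Suc (t mod M)) (U_stat n h) (arm_count n h)"
proof -
  have "Suc t mod M \<noteq> 0" using assms by (simp add: mod_eq_0_iff_dvd)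
  then show ?thesis unfolding hist_value_def by (simp add: div_Suc mod_Suc split: if_splits)
qed

lemma sum_return_pmf_arm: "(\<Sum>l\<in>UNIV. ennreal (pmf (return_pmf l0) l) * f l) = f (l0 :: arm)"
  by (cases l0) (simp_all add: sum_arm)

lemma bayes_regret_step_ge:
  assumes \<sigma>: "\<sigma> \<in> packet_strategies M" and n: "0 < n" and h: "h \<in> space (hist_space n)"
    and ge: "\<And>l x. ennreal (evidence (Suc n) (h(n := (l, x)))) * hist_value M t (Suc n) (h(n := (l, x)))
      \<le> bayes_regret \<sigma> t (Suc n) (h(n := (l, x)))"
  shows "(\<Sum>l\<in>UNIV. ennreal (pmf (\<sigma> n h) l) * (ennreal (evidence n h) *
      packet_value \<rho> (opt_value \<rho> M (t div M)) l (Suc (t mod M)) (U_stat n h) (arm_count n h)))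
    \<le> bayes_regret \<sigma> (Suc t) n h"
  unfolding bayes_regret_Suc[OF packet_strategy_measurable[OF \<sigma>] h] nn_integral_gap_likelihood[OF n] value_step[OF n, symmetric]
  by (intro sum_mono mult_left_mono add_mono order_refl nn_integral_mono ge) auto

text \<open>Backward induction on the remaining steps. At the start of a packet the minimum is at
  most any random mixture of the two arms; inside a packet the arm is forced.\<close>

lemma bayes_regret_ge:
  assumes \<sigma>: "\<sigma> \<in> packet_strategies M" and M: "1 \<le> M"
  shows "0 < n \<Longrightarrow> M dvd n + t \<Longrightarrow> h \<in> space (hist_space n) \<Longrightarrow>
    ennreal (evidence n h) * hist_value M t n h \<le> bayes_regret \<sigma> t n h"
proof (induction t arbitrary: n h)
  case 0
  then show ?case by (simp add: hist_value_def)
next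
  case (Suc t)
  let ?A = "\<lambda>l. packet_value \<rho> (opt_value \<rho> M (t div M)) l (Suc (t mod M)) (U_stat n h) (arm_count n h)"
  have "hist_value M (Suc t) n h \<le> (\<Sum>l\<in>UNIV. ennreal (pmf (\<sigma> n h) l) * ?A l)"
  proof (cases "M dvd n")
    case True
    then have d: "M dvd Suc t" using Suc.prems(2) by (metis dvd_add_right_iff)
    have "hist_value M (Suc t) n h \<le> ?A l" for l
      using opt_value_le[of \<rho> M "t div M" "U_stat n h" "arm_count n h" l]
      unfolding hist_value_Suc_dvd[OF M d] by simp
    then have "(\<Sum>l\<in>UNIV. ennreal (pmf (\<sigma> n h) l) * hist_value M (Suc t) n h) \<le> (\<Sum>l\<in>UNIV. ennreal (pmf (\<sigma> n h) l) * ?A l)"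
      by (intro sum_mono mult_left_mono) auto
    then show ?thesis by (simp add: sum_distrib_right[symmetric] sum_pmf_arm del: sum_ennreal)
  next
    case False
    then have d: "\<not> M dvd Suc t" using Suc.prems(2) by (metis dvd_add_left_iff)
    show ?thesis
      unfolding hist_value_Suc_not_dvd[OF d] packet_strategy_repeat[OF \<sigma> Suc.prems(3) False] sum_return_pmf_arm by simp
  qed
  then have "ennreal (evidence n h) * hist_value M (Suc t) n h \<le>
      (\<Sum>l\<in>UNIV. ennreal (pmf (\<sigma> n h) l) * (ennreal (evidence n h) * ?A l))"
    by (subst mult.left_commute) (simp add: sum_distrib_left[symmetric] mult_left_mono)
  also have "\<dots> \<le> bayes_regret \<sigma> (Suc t) n h"
    using Suc.prems by (intro bayes_regret_step_ge[OF \<sigma>] Suc.IH) (simp_all del: fun_upd_apply)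
  finally show ?case .
qed

text \<open>The bound is attained from every history of a set \<open>E\<close> that \<open>\<sigma>\<close> does not leave and on which
  it only takes minimizing actions.\<close>
lemma bayes_regret_eq:
  assumes \<sigma>: "\<sigma> \<in> packet_strategies M" and M: "1 \<le> M" and N: "M dvd N"
    and closed: "\<And>n h l x. E n h \<Longrightarrow> h \<in> space (hist_space n) \<Longrightarrow> 0 < n \<Longrightarrow> n < N \<Longrightarrow> l \<in> set_pmf (\<sigma> n h) \<Longrightarrow>
      E (Suc n) (h(n := (l, x)))"
    and opt: "\<And>n h l. E n h \<Longrightarrow> h \<in> space (hist_space n) \<Longrightarrow> 0 < n \<Longrightarrow> n < N \<Longrightarrow> M dvd n \<Longrightarrow> l \<in> set_pmf (\<sigma> n h) \<Longrightarrow>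
      packet_value \<rho> (opt_value \<rho> M ((N - Suc n) div M)) l M (U_stat n h) (arm_count n h) \<le>
      packet_value \<rho> (opt_value \<rho> M ((N - Suc n) div M)) (other_arm l) M (U_stat n h) (arm_count n h)"
  shows "E n h \<Longrightarrow> 0 < n \<Longrightarrow> n + t = N \<Longrightarrow> h \<in> space (hist_space n) \<Longrightarrow>
    bayes_regret \<sigma> t n h = ennreal (evidence n h) * hist_value M t n h"
proof (induction t arbitrary: n h)
  case 0
  then show ?case by (simp add: hist_value_def bayes_regret_def)
next
  case (Suc t)
  have t: "t = N - Suc n" "n < N" using Suc.prems by auto
  let ?A = "\<lambda>l. packet_value \<rho> (opt_value \<rho> M (t div M)) l (Suc (t mod M)) (U_stat n h) (arm_count n h)"
  have A: "?A l = hist_value M (Suc t) n h" if l: "l \<in> set_pmf (\<sigma> n h)" for l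
  proof (cases "M dvd n")
    case True
    then have d: "M dvd Suc t" using Suc.prems(3) N by (metis dvd_add_right_iff)
    show ?thesis
      using opt[OF Suc.prems(1,4,2) t(2) True l] opt_value_eq
      unfolding hist_value_Suc_dvd[OF M d] t(1)[symmetric] by metis
  next
    case False
    then have d: "\<not> M dvd Suc t" using Suc.prems(3) N by (metis dvd_add_left_iff)
    show ?thesis
      using l packet_strategy_repeat[OF \<sigma> Suc.prems(4) False] unfolding hist_value_Suc_not_dvd[OF d] by simp
  qed
  have "bayes_regret \<sigma> (Suc t) n h = (\<Sum>l\<in>UNIV. ennreal (pmf (\<sigma> n h) l) * (ennreal (evidence n h) * hist_value M (Suc t) n h))"
    unfolding bayes_regret_Suc[OF packet_strategy_measurable[OF \<sigma>] Suc.prems(4)] nn_integral_gap_likelihood[OF Suc.prems(2)]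
  proof (intro sum.cong refl)
    fix l
    show "ennreal (pmf (\<sigma> n h) l) * (ennreal (evidence n h) * weighted_gap \<rho> l (U_stat n h) (precision (arm_count n h)) +
        (\<integral>\<^sup>+x. bayes_regret \<sigma> t (Suc n) (h(n := (l, x))) \<partial>lborel)) =
      ennreal (pmf (\<sigma> n h) l) * (ennreal (evidence n h) * hist_value M (Suc t) n h)"
    proof (cases "l \<in> set_pmf (\<sigma> n h)")
      case True
      have "bayes_regret \<sigma> t (Suc n) (h(n := (l, x))) =
          ennreal (evidence (Suc n) (h(n := (l, x)))) * hist_value M t (Suc n) (h(n := (l, x)))" for x
        by (rule Suc.IH) (use closed[OF Suc.prems(1,4,2) t(2) True] Suc.prems in \<open>simp_all del: fun_upd_apply\<close>)
      then show ?thesis using value_step[OF Suc.prems(2), of h l M t] A[OF True] by simp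
    next
      case False
      then show ?thesis by (simp add: set_pmf_iff)
    qed
  qed
  then show ?case by (simp add: sum_distrib_right[symmetric] sum_pmf_arm del: sum_ennreal)
qed

end

section \<open>Currently optimal actions\<close>

lemma enn2real_le_iff_finite: "a < \<infinity> \<Longrightarrow> b < \<infinity> \<Longrightarrow> enn2real a \<le> enn2real b \<longleftrightarrow> a \<le> b"
  by (cases a; cases b) auto

section \<open>Measurability of the sufficient statistics\<close>

lemma arm_count_sum: "real (arm_count n h l) = (\<Sum>k<n. if fst (h k) = l then 1 else 0)"
proof -
  have "{k. k < n \<and> fst (h k) = l} = {..<n} \<inter> {k. fst (h k) = l}" by auto
  then show ?thesis unfolding arm_count_def by (simp add: sum.If_cases)
qed

lemma arm_income_sum: "arm_income n h l = (\<Sum>k<n. if fst (h k) = l then snd (h k) else 0)"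
proof -
  have "{k. k < n \<and> fst (h k) = l} = {..<n} \<inter> {k. fst (h k) = l}" by auto
  then show ?thesis unfolding arm_income_def by (simp add: sum.If_cases)
qed

lemma measurable_hist_arm: "k < n \<Longrightarrow> (\<lambda>h. fst (h k)) \<in> hist_space n \<rightarrow>\<^sub>M count_space UNIV"
  by (rule measurable_compose[OF measurable_hist_component measurable_fst_obs])

lemma measurable_hist_income: "k < n \<Longrightarrow> (\<lambda>h. snd (h k)) \<in> borel_measurable (hist_space n)"
  by (rule measurable_compose[OF measurable_hist_component measurable_snd_obs])

lemma measurable_real_arm_count [measurable]: "(\<lambda>h. real (arm_count n h l)) \<in> borel_measurable (hist_space n)"
  unfolding arm_count_sum
proof (intro borel_measurable_sum)
  fix k assume "k \<in> {..<n}"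
  then have [measurable]: "(\<lambda>h. fst (h k)) \<in> hist_space n \<rightarrow>\<^sub>M count_space UNIV"
    by (intro measurable_hist_arm) simp
  show "(\<lambda>h. if fst (h k) = l then 1 else 0 :: real) \<in> borel_measurable (hist_space n)" by measurable
qed

lemma measurable_arm_income [measurable]: "(\<lambda>h. arm_income n h l) \<in> borel_measurable (hist_space n)"
  unfolding arm_income_sum
proof (intro borel_measurable_sum)
  fix k assume "k \<in> {..<n}"
  then have [measurable]: "(\<lambda>h. fst (h k)) \<in> hist_space n \<rightarrow>\<^sub>M count_space UNIV"
    "(\<lambda>h. snd (h k)) \<in> borel_measurable (hist_space n)"
    by (simp_all add: measurable_hist_arm measurable_hist_income)
  show "(\<lambda>h. if fst (h k) = l then snd (h k) else 0) \<in> borel_measurable (hist_space n)" by measurable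
qed

lemma measurable_arm_count: "arm_count n \<in> hist_space n \<rightarrow>\<^sub>M count_space UNIV"
proof (subst measurable_count_space_eq2_countable)
  show "arm_count n \<in> space (hist_space n) \<rightarrow> UNIV \<and> (\<forall>c\<in>UNIV. arm_count n -` {c} \<inter> space (hist_space n) \<in> sets (hist_space n))"
  proof (intro conjI ballI)
    fix c :: "arm \<Rightarrow> nat"
    let ?S = "\<lambda>l. (\<lambda>h. real (arm_count n h l)) -` {real (c l)} \<inter> space (hist_space n)"
    have "f = c \<longleftrightarrow> f Arm1 = c Arm1 \<and> f Arm2 = c Arm2" for f
      by (metis arm.exhaust ext)
    then have "arm_count n -` {c} \<inter> space (hist_space n) = ?S Arm1 \<inter> ?S Arm2" by auto
    also have "\<dots> \<in> sets (hist_space n)"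
      by (intro sets.Int measurable_sets[OF measurable_real_arm_count]) auto
    finally show "arm_count n -` {c} \<inter> space (hist_space n) \<in> sets (hist_space n)" .
  qed simp
qed

lemma measurable_U_stat [measurable]: "U_stat n \<in> borel_measurable (hist_space n)"
  unfolding U_stat_def[abs_def] by measurable

lemma U_stat_unobserved:
  assumes "\<forall>k<n. fst (h k) = l"
  shows "arm_count n h (other_arm l) = 0" and "U_stat n h = 0"
proof -
  have e: "{k. k < n \<and> fst (h k) = other_arm l} = {}" using assms by auto
  then show c: "arm_count n h (other_arm l) = 0" by (simp only: arm_count_def card.empty)
  have "arm_income n h (other_arm l) = 0" unfolding arm_income_def e by simp
  with c show "U_stat n h = 0" unfolding U_stat_def by (cases l) simp_all
qed

text \<open>Unlike \<open>packet_histories\<close>, this does not ask for a complete last packet, so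
  it can serve as an invariant at every time.\<close>

definition packeted :: "nat \<Rightarrow> nat \<Rightarrow> history \<Rightarrow> bool" where
  "packeted M n h \<longleftrightarrow> (\<forall>k<n. \<not> M dvd k \<longrightarrow> fst (h k) = fst (h (k - 1)))"

lemma packet_histories_iff: "h \<in> packet_histories M n \<longleftrightarrow> h \<in> space (hist_space n) \<and> M dvd n \<and> packeted M n h"
  by (auto simp: packet_histories_def packeted_def)

lemma packeted_block:
  assumes "packeted M n h" "k * M \<le> j" "j < Suc k * M" "j < n"
  shows "fst (h j) = fst (h (k * M))"
  using assms(2-4)
proof (induction j rule: dec_induct)
  case (step i)
  have "\<not> M dvd Suc i"
  proof
    assume "M dvd Suc i"
    then obtain q where q: "Suc i = M * q" by auto
    have "M * k < M * q" "M * q < M * Suc k"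
      unfolding q[symmetric] using step.hyps step.prems by (simp_all add: mult.commute)
    then have "k < q" "q < Suc k" unfolding mult_less_cancel1 by blast+
    then show False by simp
  qed
  then have "fst (h (Suc i)) = fst (h i)" using assms(1) step.prems unfolding packeted_def by force
  then show ?case using step by simp
qed simp

lemma packeted_upd:
  assumes "packeted M n h" "0 < n" "\<not> M dvd n \<longrightarrow> l = fst (h (n - 1))"
  shows "packeted M (Suc n) (h(n := (l, x)))"
  unfolding packeted_def
proof (intro allI impI)
  fix k assume "k < Suc n" "\<not> M dvd k"
  then consider "k < n" | "k = n" by linarith
  then show "fst ((h(n := (l, x))) k) = fst ((h(n := (l, x))) (k - 1))"
  proof cases
    case 1
    then have "fst (h k) = fst (h (k - 1))" using assms(1) \<open>\<not> M dvd k\<close> unfolding packeted_def by blast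
    moreover have "k \<noteq> n" "k - 1 \<noteq> n" using 1 by auto
    ultimately show ?thesis by simp
  next
    case 2
    then show ?thesis using assms \<open>\<not> M dvd k\<close> by simp
  qed
qed

lemma packet_strategy_packeted:
  assumes "\<sigma> \<in> packet_strategies M" "h \<in> space (hist_space n)" "packeted M n h" "0 < n" "l \<in> set_pmf (\<sigma> n h)"
  shows "packeted M (Suc n) (h(n := (l, x)))"
  using assms packet_strategy_repeat[OF assms(1,2)] by (intro packeted_upd) auto

section \<open>The minimizing rule as a strategy\<close>

locale bandit = symmetric_prior +
  fixes M N :: nat
  assumes M: "1 \<le> M" and N: "2 * M \<le> N" and dvd: "M dvd N"
begin

text \<open>At a time \<open>n < N\<close> divisible by \<open>M\<close>,
  \<open>(N - Suc n) div M\<close> is the number of packets left after the coming one.\<close>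

definition packet_loss :: "nat \<Rightarrow> history \<Rightarrow> arm \<Rightarrow> ennreal" where
  "packet_loss n h l = packet_value \<rho> (opt_value \<rho> M ((N - Suc n) div M)) l M (U_stat n h) (arm_count n h)"

text \<open>The counts take countably many values, so measurability can be checked for each fixed
  count. This makes the rule below an admissible strategy.\<close>

lemma measurable_packet_loss [measurable]: "(\<lambda>h. packet_loss n h l) \<in> borel_measurable (hist_space n)"
proof -
  have "(\<lambda>h. (\<lambda>c h. packet_value \<rho> (opt_value \<rho> M ((N - Suc n) div M)) l M (U_stat n h) c) (arm_count n h) h)
      \<in> borel_measurable (hist_space n)"
    by (rule measurable_compose_countable'[OF _ measurable_arm_count])
       (auto intro: measurable_compose[OF measurable_U_stat measurable_packet_opt])
  then show ?thesis by (simp add: packet_loss_def)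
qed

lemma R_rule_iff:
  assumes n: "n < N" "M dvd n" and c: "M \<le> arm_count n h Arm1" "M \<le> arm_count n h Arm2"
  shows "R_rule C \<rho> M N n h l \<longleftrightarrow> packet_loss n h l \<le> packet_loss n h (other_arm l)"
proof -
  define k where "k = (N - Suc n) div M"
  have "M dvd Suc (N - Suc n)" using n dvd by (simp add: Suc_diff_Suc)
  then have "Suc (N - Suc n) div M = Suc k" unfolding k_def by (simp add: div_Suc)
  then have "N - n = Suc k * M" using \<open>M dvd Suc (N - Suc n)\<close> n
    by (metis Suc_diff_Suc dvd_div_mult_self)
  then have N': "N = steps (arm_count n h) + Suc k * M" using n steps_arm_count[of n h] by simp
  have "R_arm C \<rho> M N l' (U_stat n h) (arm_count n h Arm1) (arm_count n h Arm2) = enn2real (packet_loss n h l')" for l'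
    unfolding packet_loss_def k_def[symmetric] using M c
    by (intro R_eq_opt_value(2)[OF M _ _ N' refl]) auto
  then show ?thesis
    unfolding R_rule_def by (simp add: enn2real_le_iff_finite[OF packet_value_finite packet_value_finite] packet_loss_def)
qed

text \<open>The parameter \<open>l\<close> is the arm preferred at ties. Whenever \<open>l\<close>
  is a minimizer, the strategy starts with \<open>l\<close>, as a witness for
  \<open>currently_optimal\<close> must.\<close>

definition rule_strategy :: "arm \<Rightarrow> strategy" where
  "rule_strategy l n h = return_pmf (
     if n = 0 then Arm1
     else if \<not> M dvd n then fst (h (n - 1))
     else if n = M then other_arm (fst (h 0))
     else if packet_loss n h l \<le> packet_loss n h (other_arm l) then l else other_arm l)"

lemma rule_strategy_packet: "rule_strategy l \<in> packet_strategies M"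
proof -
  have "(\<lambda>h. measure_pmf (rule_strategy l n h)) \<in> hist_space n \<rightarrow>\<^sub>M subprob_algebra (count_space UNIV)" for n
  proof -
    have 1: "(\<lambda>h. fst (h (n - 1))) \<in> hist_space n \<rightarrow>\<^sub>M count_space UNIV" if "n \<noteq> 0"
      using that by (intro measurable_hist_arm) simp
    have 2: "(\<lambda>h. other_arm (fst (h 0))) \<in> hist_space n \<rightarrow>\<^sub>M count_space UNIV" if "n \<noteq> 0"
      using that by (intro measurable_compose[OF measurable_hist_arm[of 0 n]]) auto
    have 3: "(\<lambda>h. if packet_loss n h l \<le> packet_loss n h (other_arm l) then l else other_arm l) \<in> hist_space n \<rightarrow>\<^sub>M count_space UNIV"
      by measurable
    have "(\<lambda>h. if n = 0 then Arm1
     else if \<not> M dvd n then fst (h (n - 1))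
     else if n = M then other_arm (fst (h 0))
     else if packet_loss n h l \<le> packet_loss n h (other_arm l) then l else other_arm l) \<in> hist_space n \<rightarrow>\<^sub>M count_space UNIV"
    proof -
      consider "n = 0" | "n \<noteq> 0" "\<not> M dvd n" | "n \<noteq> 0" "\<not> \<not> M dvd n" "n = M"
        | "n \<noteq> 0" "\<not> \<not> M dvd n" "n \<noteq> M" by blast
      then show ?thesis
      proof cases
        case a: 1
        show ?thesis unfolding if_P[OF a] by (rule measurable_const) simp
      next
        case a: 2
        show ?thesis unfolding if_not_P[OF a(1)] if_P[OF a(2)] by (rule 1[OF a(1)])
      next
        case a: 3
        show ?thesis unfolding if_not_P[OF a(1)] if_not_P[OF a(2)] if_P[OF a(3)] by (rule 2[OF a(1)])
      next
        case a: 4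
        show ?thesis unfolding if_not_P[OF a(1)] if_not_P[OF a(2)] if_not_P[OF a(3)] by (rule 3)
      qed
    qed
    from measurable_compose[OF this measurable_measure_pmf[of return_pmf]] show ?thesis
      unfolding rule_strategy_def .
  qed
  moreover have "rule_strategy l n h = return_pmf (fst (h (n - 1)))" if "\<not> M dvd n" for n h
  proof -
    have "n \<noteq> 0" using that by (rule contrapos_nn) simp
    show ?thesis unfolding rule_strategy_def if_not_P[OF \<open>n \<noteq> 0\<close>] if_P[OF that] by (rule refl)
  qed
  ultimately show ?thesis unfolding packet_strategies_def by blast
qed

lemma rule_strategy_limiting: "rule_strategy l \<in> limiting_strategies C \<rho> M N"
  unfolding limiting_strategies_def
proof (intro CollectI conjI ballI allI impI rule_strategy_packet)
  fix h assume "h \<in> packet_histories M M"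
  then show "rule_strategy l M h = return_pmf (other_arm (fst (h 0)))"
    using M by (simp add: rule_strategy_def)
next
  fix n h l'
  assume *: "2 * M \<le> n \<and> n < N \<and> h \<in> packet_histories M n \<and> M \<le> arm_count n h Arm1 \<and> M \<le> arm_count n h Arm2"
    and l': "l' \<in> set_pmf (rule_strategy l n h)"
  then have "M dvd n" "n \<noteq> 0" "n \<noteq> M" using M by (auto simp: packet_histories_iff)
  then have "packet_loss n h l' \<le> packet_loss n h (other_arm l')"
    using l' by (auto simp: rule_strategy_def split: if_splits)
  then show "R_rule C \<rho> M N n h l'" using * \<open>M dvd n\<close> by (simp add: R_rule_iff)
qed

text \<open>The history need not come from the strategy itself. Packet structure together with both
  counts being at least \<open>M\<close> is an invariant, and it forces n >= 2 M, beyond the clause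
  for the second packet.\<close>

lemma rule_strategy_optimal:
  assumes "0 < n" "n \<le> N" "h \<in> space (hist_space n)" "packeted M n h"
    "M \<le> arm_count n h Arm1" "M \<le> arm_count n h Arm2"
  shows "bayes_regret (rule_strategy l) (N - n) n h = ennreal (evidence n h) * hist_value M (N - n) n h"
proof (rule bayes_regret_eq[where N = N and E = "\<lambda>n h. packeted M n h \<and> M \<le> arm_count n h Arm1 \<and> M \<le> arm_count n h Arm2"])
  fix n h l' x
  assume *: "packeted M n h \<and> M \<le> arm_count n h Arm1 \<and> M \<le> arm_count n h Arm2"
    and h: "h \<in> space (hist_space n)" and n: "0 < n" "n < N" and l': "l' \<in> set_pmf (rule_strategy l n h)"
  show "packeted M (Suc n) (h(n := (l', x))) \<and> M \<le> arm_count (Suc n) (h(n := (l', x))) Arm1 \<and>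
    M \<le> arm_count (Suc n) (h(n := (l', x))) Arm2"
    using packet_strategy_packeted[OF rule_strategy_packet h _ n(1) l'] * by (auto simp: arm_count_upd)
  assume "M dvd n"
  have "2 * M \<le> n" using * steps_arm_count[of n h] by linarith
  then have "n \<noteq> M" using M by simp
  then show "packet_value \<rho> (opt_value \<rho> M ((N - Suc n) div M)) l' M (U_stat n h) (arm_count n h) \<le>
     packet_value \<rho> (opt_value \<rho> M ((N - Suc n) div M)) (other_arm l') M (U_stat n h) (arm_count n h)"
    using l' \<open>M dvd n\<close> n unfolding packet_loss_def[symmetric] by (auto simp: rule_strategy_def split: if_splits)
qed (use assms M dvd in \<open>auto intro: rule_strategy_packet\<close>)

text \<open>The invariant records that the second packet switched arms. At time \<open>M\<close> the
  switch is optimal by \<open>packet_value_unobserved\<close>; at later packet boundaries both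
  counts are at least \<open>M\<close>, so the defining rule applies.\<close>

lemma limiting_strategy_optimal:
  assumes \<sigma>: "\<sigma> \<in> limiting_strategies C \<rho> M N" and h: "h \<in> space (hist_space 1)"
  shows "bayes_regret \<sigma> (N - 1) 1 h = ennreal (evidence 1 h) * hist_value M (N - 1) 1 h"
proof (rule bayes_regret_eq[where N = N and E = "\<lambda>n h. packeted M n h \<and> (M < n \<longrightarrow> fst (h M) = other_arm (fst (h 0)))"])
  show \<sigma>': "\<sigma> \<in> packet_strategies M" using \<sigma> by (simp add: limiting_strategies_def)
  fix n h l x
  assume E: "packeted M n h \<and> (M < n \<longrightarrow> fst (h M) = other_arm (fst (h 0)))"
    and h: "h \<in> space (hist_space n)" and n: "0 < n" "n < N" and l: "l \<in> set_pmf (\<sigma> n h)"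
  have second: "l = other_arm (fst (h 0))" if "n = M"
  proof -
    have "h \<in> packet_histories M M" using E h that by (simp add: packet_histories_iff)
    then show ?thesis using \<sigma> l that by (simp add: limiting_strategies_def)
  qed
  show "packeted M (Suc n) (h(n := (l, x))) \<and>
    (M < Suc n \<longrightarrow> fst ((h(n := (l, x))) M) = other_arm (fst ((h(n := (l, x))) 0)))"
    using packet_strategy_packeted[OF \<sigma>' h _ n(1) l] E second n(1) by auto
  assume d: "M dvd n"
  show "packet_value \<rho> (opt_value \<rho> M ((N - Suc n) div M)) l M (U_stat n h) (arm_count n h) \<le>
     packet_value \<rho> (opt_value \<rho> M ((N - Suc n) div M)) (other_arm l) M (U_stat n h) (arm_count n h)"
  proof (cases "n = M")
    case True
    have "\<forall>k<n. fst (h k) = fst (h 0)"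
    proof (intro allI impI)
      fix k assume "k < n"
      then show "fst (h k) = fst (h 0)" using packeted_block[of M n h 0 k] E True by simp
    qed
    note z = U_stat_unobserved[OF this]
    show ?thesis
      unfolding second[OF True] z(2) other_other_arm by (rule packet_value_unobserved[where c = "arm_count n h" and l = "fst (h 0)", OF z(1)])
  next
    case False
    obtain q where q: "n = M * q" using d by auto
    have "q \<noteq> 0" "q \<noteq> 1" using n(1) False unfolding q by auto
    then have "M * 2 \<le> M * q" by (intro mult_le_mono2) simp
    then have n2: "2 * M \<le> n" by (simp add: q)
    \<comment> \<open>The first two packets alone supply \<open>M\<close> applications of each
      arm.\<close>
    have "{0..<M} \<subseteq> {k. k < n \<and> fst (h k) = fst (h 0)}"
    proof
      fix k assume "k \<in> {0..<M}"
      then show "k \<in> {k. k < n \<and> fst (h k) = fst (h 0)}" using packeted_block[of M n h 0 k] E n2 by simp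
    qed
    then have "card {0..<M} \<le> arm_count n h (fst (h 0))" unfolding arm_count_def by (intro card_mono) auto
    moreover have "{M..<2 * M} \<subseteq> {k. k < n \<and> fst (h k) = other_arm (fst (h 0))}"
    proof
      fix k assume "k \<in> {M..<2 * M}"
      then show "k \<in> {k. k < n \<and> fst (h k) = other_arm (fst (h 0))}"
        using packeted_block[of M n h 1 k] E n2 M by simp
    qed
    then have "card {M..<2 * M} \<le> arm_count n h (other_arm (fst (h 0)))" unfolding arm_count_def by (intro card_mono) auto
    ultimately have c: "M \<le> arm_count n h Arm1" "M \<le> arm_count n h Arm2"
      by (cases "fst (h 0)"; simp)+
    have "R_rule C \<rho> M N n h l"
      using \<sigma> n2 n h d E l c unfolding limiting_strategies_def by (auto simp: packet_histories_iff)
    then show ?thesis using R_rule_iff[OF n(2) d c] by (simp add: packet_loss_def)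
  qed
qed (use h M N dvd in \<open>auto simp: packeted_def\<close>)

section \<open>Normalized posterior and current optimality\<close>

text \<open>On the support of \<open>\<rho>\<close> the exponent is bounded in absolute value by
  some \<open>B\<close>, so the mass lies between the evidence times exp (- B) and the evidence
  times exp B.\<close>

lemma likelihood_mass:
  fixes h :: history
  assumes n: "0 < n"
  defines "mass \<equiv> (\<integral>\<^sup>+p. ennreal (likelihood (param p) n h * \<rho> (snd p)) \<partial>(lborel \<Otimes>\<^sub>M lborel))"
  shows "0 < mass" and "mass < \<infinity>"
proof -
  define U D where "U = U_stat n h" and "D = precision (arm_count n h)"
  have D: "0 \<le> D" by (simp add: D_def precision_nonneg)
  let ?I = "\<integral>\<^sup>+v. ennreal (\<rho> v * exp (2 * U * v - 2 * v\<^sup>2 * D)) \<partial>lborel"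
  have mass: "mass = ennreal (evidence n h) * ?I"
    using nn_integral_likelihood_rho[OF n, of "\<lambda>_. 1" h] by (simp add: mass_def U_def D_def)
  have b: "\<bar>2 * U * v - 2 * v\<^sup>2 * D\<bar> \<le> 2 * \<bar>U\<bar> * C + 2 * C\<^sup>2 * D" if "v \<in> {-C..C}" for v
  proof -
    have "\<bar>v\<bar> \<le> C" using that by auto
    then have "\<bar>U\<bar> * \<bar>v\<bar> \<le> \<bar>U\<bar> * C" "v\<^sup>2 * D \<le> C\<^sup>2 * D"
      using D C_pos by (auto intro!: mult_left_mono mult_right_mono simp: abs_le_square_iff[symmetric])
    moreover have "\<bar>2 * U * v - 2 * v\<^sup>2 * D\<bar> \<le> 2 * (\<bar>U\<bar> * \<bar>v\<bar>) + 2 * (v\<^sup>2 * D)"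
      using abs_triangle_ineq4[of "2 * U * v" "2 * v\<^sup>2 * D"] D by (simp add: abs_mult)
    ultimately show ?thesis by simp
  qed
  define B where "B = 2 * \<bar>U\<bar> * C + 2 * C\<^sup>2 * D"
  have "?I \<le> (\<integral>\<^sup>+v. ennreal (exp B) * ennreal (\<rho> v) \<partial>lborel)"
  proof (intro nn_integral_mono)
    fix v
    show "ennreal (\<rho> v * exp (2 * U * v - 2 * v\<^sup>2 * D)) \<le> ennreal (exp B) * ennreal (\<rho> v)"
    proof (cases "v \<in> {-C..C}")
      case True
      then have "\<rho> v * exp (2 * U * v - 2 * v\<^sup>2 * D) \<le> \<rho> v * exp B"
        using b[OF True] unfolding B_def by (intro mult_left_mono) auto
      then show ?thesis by (simp add: ennreal_mult''[symmetric] mult.commute ennreal_leI)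
    qed (simp add: rho_support)
  qed
  also have "\<dots> = ennreal (exp B)" by (simp add: nn_integral_cmult rho_total)
  finally have "?I < \<infinity>" by (simp add: le_less_trans)
  then show "mass < \<infinity>" unfolding mass by (simp add: ennreal_mult_less_top)
  have "(\<integral>\<^sup>+v. ennreal (exp (- B)) * ennreal (\<rho> v) \<partial>lborel) \<le> ?I"
  proof (intro nn_integral_mono)
    fix v
    show "ennreal (exp (- B)) * ennreal (\<rho> v) \<le> ennreal (\<rho> v * exp (2 * U * v - 2 * v\<^sup>2 * D))"
    proof (cases "v \<in> {-C..C}")
      case True
      then have "\<rho> v * exp (- B) \<le> \<rho> v * exp (2 * U * v - 2 * v\<^sup>2 * D)"
        using b[OF True] unfolding B_def by (intro mult_left_mono) auto
      then show ?thesis by (simp add: ennreal_mult''[symmetric] mult.commute ennreal_leI)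
    qed (simp add: rho_support)
  qed
  moreover have "(\<integral>\<^sup>+v. ennreal (exp (- B)) * ennreal (\<rho> v) \<partial>lborel) = ennreal (exp (- B))"
    by (simp add: nn_integral_cmult rho_total)
  ultimately have "ennreal (exp (- B)) \<le> ?I" by simp
  then have "0 < ?I" by (rule less_le_trans[rotated]) simp
  then show "0 < mass" unfolding mass using evidence_pos[OF n, of h] by (simp add: ennreal_zero_less_mult_iff)
qed

lemma bayes_regret_finite:
  assumes n: "0 < n"
  shows "bayes_regret \<sigma> t n h < \<infinity>"
proof -
  have "bayes_regret \<sigma> t n h \<le> (\<integral>\<^sup>+p. ennreal (real t * (2 * C)) * ennreal (likelihood (param p) n h * \<rho> (snd p)) \<partial>(lborel \<Otimes>\<^sub>M lborel))"
    unfolding bayes_regret_def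
  proof (intro nn_integral_mono)
    fix p :: "real \<times> real"
    show "regret \<sigma> (param p) t n h * ennreal (likelihood (param p) n h * \<rho> (snd p)) \<le>
      ennreal (real t * (2 * C)) * ennreal (likelihood (param p) n h * \<rho> (snd p))"
    proof (cases "snd p \<in> {-C..C}")
      case True
      have "regret \<sigma> (param p) t n h \<le> of_nat t * ennreal \<bar>fst (param p) - snd (param p)\<bar>" by (rule regret_le)
      also have "\<dots> \<le> ennreal (real t * (2 * C))"
        using True by (auto simp: ennreal_of_nat_eq_real_of_nat ennreal_mult'[symmetric] intro!: ennreal_leI mult_left_mono)
      finally show ?thesis by (intro mult_right_mono) auto
    qed (simp add: rho_support)
  qed
  also have "\<dots> = ennreal (real t * (2 * C)) * (\<integral>\<^sup>+p. ennreal (likelihood (param p) n h * \<rho> (snd p)) \<partial>(lborel \<Otimes>\<^sub>M lborel))"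
    by (intro nn_integral_cmult) measurable
  also have "\<dots> < \<infinity>" using likelihood_mass(2)[OF n, of h] by (simp add: ennreal_mult_less_top)
  finally show ?thesis .
qed

text \<open>\<open>K\<close> is the reciprocal of the likelihood mass and common to all strategies,
  so comparing posterior losses amounts to comparing \<open>bayes_regret\<close>.\<close>

lemma posterior_loss_eq:
  assumes n: "n \<le> N" and h: "h \<in> space (hist_space n)" and c: "0 < arm_count n h Arm1" "0 < arm_count n h Arm2"
  obtains K where "0 < K" "\<And>\<tau>. measurable_strategy \<tau> \<Longrightarrow> posterior_loss N \<rho> \<tau> n h = K * enn2real (bayes_regret \<tau> (N - n) n h)"
proof -
  let ?P = "lborel \<Otimes>\<^sub>M lborel :: (real \<times> real) measure"
  have n0: "0 < n" using steps_arm_count[of n h] c by linarith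
  obtain K where K: "0 < K" "\<And>m v. likelihood (m + v, m - v) n h * \<rho> v = K * posterior_weight \<rho> n h m v"
    using likelihood_eq_posterior_weight[OF c] by metis
  define mass where "mass = (\<integral>\<^sup>+p. ennreal (likelihood (param p) n h * \<rho> (snd p)) \<partial>?P)"
  have mass: "0 < mass" "mass < \<infinity>" using likelihood_mass[OF n0, of h] by (simp_all add: mass_def)
  have w: "posterior_weight \<rho> n h (fst p) (snd p) = likelihood (param p) n h * \<rho> (snd p) / K" for p
    using K by (simp add: field_simps)
  have "(\<integral>(m, v). posterior_weight \<rho> n h m v \<partial>?P) = (\<integral>p. likelihood (param p) n h * \<rho> (snd p) / K \<partial>?P)"
    by (simp add: split_beta' w)
  also have "\<dots> = (\<integral>p. likelihood (param p) n h * \<rho> (snd p) \<partial>?P) / K" by simp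
  also have "(\<integral>p. likelihood (param p) n h * \<rho> (snd p) \<partial>?P) = enn2real mass"
    unfolding mass_def by (intro integral_eq_nn_integral) auto
  finally have Z: "(\<integral>(m, v). posterior_weight \<rho> n h m v \<partial>?P) = enn2real mass / K" .
  have m0: "0 < enn2real mass" using mass by (simp add: enn2real_positive_iff)
  have d: "posterior_density \<rho> n h (fst p) (snd p) = likelihood (param p) n h * \<rho> (snd p) / enn2real mass" for p
    unfolding posterior_density_def Z w using K by simp
  show ?thesis
  proof (rule that[of "1 / enn2real mass"])
    fix \<tau> assume \<tau>: "measurable_strategy \<tau>"
    note [measurable] = measurable_regret'[OF \<tau>]
    have [measurable]: "(\<lambda>p. regret \<tau> (param p) (N - n) n h) \<in> borel_measurable ?P"
      using h by measurable
    have "posterior_loss N \<rho> \<tau> n h = (\<integral>p. enn2real (regret \<tau> (param p) (N - n) n h) * (likelihood (param p) n h * \<rho> (snd p)) / enn2real mass \<partial>?P)"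
      unfolding posterior_loss_def by (simp add: split_beta' d remaining_loss_eq[OF \<tau> h n])
    also have "\<dots> = (\<integral>p. enn2real (regret \<tau> (param p) (N - n) n h) * (likelihood (param p) n h * \<rho> (snd p)) \<partial>?P) / enn2real mass"
      by simp
    also have "(\<integral>p. enn2real (regret \<tau> (param p) (N - n) n h) * (likelihood (param p) n h * \<rho> (snd p)) \<partial>?P) =
      enn2real (\<integral>\<^sup>+p. ennreal (enn2real (regret \<tau> (param p) (N - n) n h) * (likelihood (param p) n h * \<rho> (snd p))) \<partial>?P)"
      by (intro integral_eq_nn_integral) auto
    also have "(\<integral>\<^sup>+p. ennreal (enn2real (regret \<tau> (param p) (N - n) n h) * (likelihood (param p) n h * \<rho> (snd p))) \<partial>?P) = bayes_regret \<tau> (N - n) n h"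
      unfolding bayes_regret_def using regret_finite
      by (intro nn_integral_cong) (simp add: ennreal_mult)
    finally show "posterior_loss N \<rho> \<tau> n h = 1 / enn2real mass * enn2real (bayes_regret \<tau> (N - n) n h)" by simp
  qed (use m0 in simp)
qed

text \<open>If the rule selects \<open>l\<close>, then \<open>rule_strategy l\<close> starts with
  \<open>l\<close> and attains the lower bound. Conversely, an optimal continuation starting with
  \<open>l\<close> costs at least the evidence times \<open>packet_loss n h l\<close>, while the
  optimum is at most the evidence times the \<open>packet_loss\<close> of the other arm; the
  positive evidence cancels.\<close>

lemma currently_optimal_iff:
  assumes n: "n < N" and h: "h \<in> packet_histories M n"
    and c: "M \<le> arm_count n h Arm1" "M \<le> arm_count n h Arm2"
  shows "currently_optimal M N \<rho> n h l \<longleftrightarrow> R_rule C \<rho> M N n h l"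
proof -
  have hs: "h \<in> space (hist_space n)" and d: "M dvd n" and p: "packeted M n h"
    using h by (simp_all add: packet_histories_iff)
  have n0: "2 * M \<le> n" "0 < n" using c M steps_arm_count[of n h] by linarith+
  define t where "t = N - Suc n"
  have t: "N - n = Suc t" using n by (simp add: t_def)
  have dt: "M dvd Suc t" using d dvd n by (simp flip: t)
  obtain K where K: "0 < K" "\<And>\<tau>. measurable_strategy \<tau> \<Longrightarrow> posterior_loss N \<rho> \<tau> n h = K * enn2real (bayes_regret \<tau> (N - n) n h)"
    using posterior_loss_eq[of n h] n hs c M by (metis less_imp_le_nat less_le_trans less_one linorder_not_less)
  have le: "posterior_loss N \<rho> \<tau> n h \<le> posterior_loss N \<rho> \<tau>' n h \<longleftrightarrow> bayes_regret \<tau> (Suc t) n h \<le> bayes_regret \<tau>' (Suc t) n h"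
    if "\<tau> \<in> packet_strategies M" "\<tau>' \<in> packet_strategies M" for \<tau> \<tau>'
    using that[THEN packet_strategy_measurable] K bayes_regret_finite[OF n0(2)]
    by (simp add: enn2real_le_iff_finite t)
  have rule: "bayes_regret (rule_strategy l') (Suc t) n h = ennreal (evidence n h) * hist_value M (Suc t) n h" for l'
    using rule_strategy_optimal[OF n0(2) _ hs p c] n by (simp add: t)
  have ge: "ennreal (evidence n h) * hist_value M (Suc t) n h \<le> bayes_regret \<tau> (Suc t) n h" if "\<tau> \<in> packet_strategies M" for \<tau>
    using bayes_regret_ge[OF that M n0(2) _ hs, of "Suc t"] dvd_add[OF d dt] by blast
  have R: "R_rule C \<rho> M N n h l \<longleftrightarrow> packet_loss n h l \<le> packet_loss n h (other_arm l)"
    by (rule R_rule_iff[OF n d c])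
  show ?thesis
  proof
    assume "R_rule C \<rho> M N n h l"
    then have "rule_strategy l n h = return_pmf l"
      using R n0 d M by (simp add: rule_strategy_def)
    moreover have "posterior_loss N \<rho> (rule_strategy l) n h \<le> posterior_loss N \<rho> \<tau> n h" if "\<tau> \<in> packet_strategies M" for \<tau>
      unfolding le[OF rule_strategy_packet that] rule by (rule ge[OF that])
    ultimately show "currently_optimal M N \<rho> n h l"
      unfolding currently_optimal_def using rule_strategy_packet by blast
  next
    assume "currently_optimal M N \<rho> n h l"
    then obtain \<tau> where \<tau>: "\<tau> \<in> packet_strategies M" "\<tau> n h = return_pmf l"
      and best: "\<And>\<tau>'. \<tau>' \<in> packet_strategies M \<Longrightarrow> posterior_loss N \<rho> \<tau> n h \<le> posterior_loss N \<rho> \<tau>' n h"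
      unfolding currently_optimal_def by blast
    have "ennreal (evidence n h) * packet_loss n h l \<le> bayes_regret \<tau> (Suc t) n h"
    proof -
      have "ennreal (evidence (Suc n) (h(n := (l, x)))) * hist_value M t (Suc n) (h(n := (l, x)))
          \<le> bayes_regret \<tau> t (Suc n) (h(n := (l, x)))" for l x
        by (intro bayes_regret_ge[OF \<tau>(1) M]) (use dvd_add[OF d dt] hs in \<open>simp_all del: fun_upd_apply\<close>)
      from bayes_regret_step_ge[OF \<tau>(1) n0(2) hs this]
      show ?thesis unfolding \<tau>(2) sum_return_pmf_arm hist_value_Suc_dvd(2)[OF M dt] by (simp add: packet_loss_def t_def)
    qed
    also have "\<dots> \<le> bayes_regret (rule_strategy Arm1) (Suc t) n h"
      using best[OF rule_strategy_packet] le[OF \<tau>(1) rule_strategy_packet] by blast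
    also have "\<dots> \<le> ennreal (evidence n h) * packet_loss n h (other_arm l)"
      unfolding rule hist_value_Suc_dvd(1)[OF M dt] packet_loss_def t_def[symmetric]
      by (intro mult_left_mono opt_value_le) simp
    finally have "packet_loss n h l \<le> packet_loss n h (other_arm l)"
      using evidence_pos[OF n0(2), of h] by (subst (asm) ennreal_mult_le_mult_iff) auto
    then show "R_rule C \<rho> M N n h l" using R by simp
  qed
qed

end

section \<open>Replacing the uniform prior by the flat one\<close>

text \<open>As a function of \<open>m\<close>, the density of a fixed income is again normal. Hence
  the second moment can be integrated over \<open>m\<close> as well as over the income.\<close>

lemma gauss_swap: "gauss 1 (m - w) x = gauss 1 (x + w) m"
  by (simp add: gauss_def normal_density_def power2_eq_square algebra_simps)

lemma nn_integral_gauss_square: "(\<integral>\<^sup>+x. ennreal ((x - \<mu>)\<^sup>2 * gauss 1 \<mu> x) \<partial>lborel) = 1"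
proof -
  have "has_bochner_integral lborel (\<lambda>x. normal_density \<mu> 1 x * (x - \<mu>)\<^sup>2) 1"
    using normal_moment_even[of 1 \<mu> 1] by (simp add: fact_2 numeral_2_eq_2 del: One_nat_def)
  then have "(\<integral>\<^sup>+x. ennreal (normal_density \<mu> 1 x * (x - \<mu>)\<^sup>2) \<partial>lborel) = ennreal 1"
    by (subst nn_integral_eq_integral) (auto simp: has_bochner_integral_iff)
  then show ?thesis by (simp add: gauss_def mult.commute)
qed

lemma ennreal_convex_bounds:
  fixes f :: "arm \<Rightarrow> ennreal"
  shows "(\<And>l. b \<le> f l) \<Longrightarrow> b \<le> (\<Sum>l\<in>UNIV. ennreal (pmf p l) * f l)"
    and "(\<And>l. f l \<le> b) \<Longrightarrow> (\<Sum>l\<in>UNIV. ennreal (pmf p l) * f l) \<le> b"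
proof -
  have e: "(\<Sum>l\<in>UNIV. ennreal (pmf p l) * b) = b"
    by (simp add: sum_distrib_right[symmetric] sum_pmf_arm del: sum_ennreal)
  { assume "\<And>l. b \<le> f l"
    then show "b \<le> (\<Sum>l\<in>UNIV. ennreal (pmf p l) * f l)"
      by (subst e[symmetric]) (intro sum_mono mult_left_mono, auto) }
  { assume "\<And>l. f l \<le> b"
    then show "(\<Sum>l\<in>UNIV. ennreal (pmf p l) * f l) \<le> b"
      by (subst e[symmetric]) (intro sum_mono mult_left_mono, auto) }
qed

abbreviation no_hist :: history where
  "no_hist \<equiv> (\<lambda>_. undefined)"

lemma no_hist_space: "no_hist \<in> space (hist_space 0)"
  by (simp add: hist_space_def space_PiM)

section \<open>Splitting off the first income\<close>

context bandit
begin

definition first_hist :: "arm \<Rightarrow> real \<Rightarrow> history" where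
  "first_hist l x = no_hist(0 := (l, x))"

text \<open>Density of the total regret in the parameter and the first income when the first action
  is \<open>l\<close>. No prior density for \<open>m\<close> is included, so that either
  \<open>m\<close> or \<open>x\<close> can be truncated.\<close>

definition first_weight :: "strategy \<Rightarrow> arm \<Rightarrow> real \<times> real \<Rightarrow> real \<Rightarrow> ennreal" where
  "first_weight \<sigma> l p x = (ennreal (gap (param p) l) + regret \<sigma> (param p) (N - 1) 1 (first_hist l x)) *
     ennreal (gauss 1 (arm_mean (param p) l) x * \<rho> (snd p))"

text \<open>\<open>\<Phi>\<close> will be an indicator of \<open>m\<close>, an indicator of the
  first income, or a quadratic weight that controls their difference.\<close>

definition truncated :: "strategy \<Rightarrow> arm \<Rightarrow> (real \<times> real \<Rightarrow> real \<Rightarrow> ennreal) \<Rightarrow> ennreal" where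
  "truncated \<sigma> l \<Phi> = (\<integral>\<^sup>+p. (\<integral>\<^sup>+x. \<Phi> p x * first_weight \<sigma> l p x \<partial>lborel) \<partial>(lborel \<Otimes>\<^sub>M lborel))"

lemma first_hist_space: "first_hist l x \<in> space (hist_space 1)"
  using space_hist_upd[OF no_hist_space, of l x] by (simp add: first_hist_def)

lemma measurable_first_hist [measurable]: "first_hist l \<in> borel \<rightarrow>\<^sub>M hist_space 1"
proof -
  have "(\<lambda>x. no_hist(0 := (l, x))) \<in> borel \<rightarrow>\<^sub>M hist_space (Suc 0)"
    using no_hist_space by measurable
  then show ?thesis by (simp add: first_hist_def[abs_def])
qed

lemma arm_count_first: "arm_count 1 (first_hist l x) = (\<lambda>_. 0)(l := 1)"
proof -
  have "arm_count 0 no_hist = (\<lambda>_. 0)" by (simp add: arm_count_def[abs_def])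
  then show ?thesis using arm_count_upd[of 0 no_hist l x] by (simp add: first_hist_def)
qed

lemma U_stat_first: "U_stat 1 (first_hist l x) = 0"
  by (rule U_stat_unobserved(2)[of 1 _ l]) (simp add: first_hist_def)

lemma likelihood_first: "likelihood \<theta> 1 (first_hist l x) = gauss 1 (arm_mean \<theta> l) x"
  by (simp add: likelihood_def first_hist_def)

text \<open>The single-income noise cancels the Gaussian integral over \<open>m\<close>: under the
  flat prior the marginal density of the first income is uniform, which is the source of the factor
  2 A.\<close>

lemma evidence_first: "evidence 1 (first_hist l x) = 1"
proof -
  have "total_income 1 (first_hist l x) = x"
    using total_income_upd[of 0 no_hist l x] by (simp add: first_hist_def total_income_def arm_income_def)
  then show ?thesis
    by (simp add: evidence_def noise_factor_def first_hist_def exp_add[symmetric] flip: exp_minus)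
qed

lemma measurable_first_weight:
  assumes \<sigma>: "measurable_strategy \<sigma>"
  shows "case_prod (first_weight \<sigma> l) \<in> borel_measurable ((lborel \<Otimes>\<^sub>M lborel) \<Otimes>\<^sub>M lborel)"
proof -
  note [measurable] = measurable_regret'[OF \<sigma>]
  show ?thesis unfolding first_weight_def split_beta' by measurable
qed

lemma measurable_first_weight' [measurable (raw)]:
  assumes "measurable_strategy \<sigma>" "f \<in> K \<rightarrow>\<^sub>M lborel \<Otimes>\<^sub>M lborel" "g \<in> K \<rightarrow>\<^sub>M lborel"
  shows "(\<lambda>k. first_weight \<sigma> l (f k) (g k)) \<in> borel_measurable K"
  using measurable_compose[OF measurable_Pair[OF assms(2,3)] measurable_first_weight[OF assms(1), of l]] by simp

text \<open>The pointwise bound is asked for on the support of \<open>\<rho>\<close> only, because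
  just there are the arm means within \<open>C\<close> of \<open>m\<close>.\<close>

lemma truncated_add_mono:
  assumes \<sigma>: "measurable_strategy \<sigma>"
    and m [measurable]: "case_prod \<Phi>2 \<in> borel_measurable ((lborel \<Otimes>\<^sub>M lborel) \<Otimes>\<^sub>M lborel)"
      "case_prod \<Phi>3 \<in> borel_measurable ((lborel \<Otimes>\<^sub>M lborel) \<Otimes>\<^sub>M lborel)"
    and le: "\<And>p x. snd p \<in> {-C..C} \<Longrightarrow> \<Phi>1 p x \<le> \<Phi>2 p x + \<Phi>3 p x"
  shows "truncated \<sigma> l \<Phi>1 \<le> truncated \<sigma> l \<Phi>2 + truncated \<sigma> l \<Phi>3"
proof -
  let ?P = "lborel \<Otimes>\<^sub>M lborel :: (real \<times> real) measure"
  note [measurable] = measurable_first_weight'[OF \<sigma>]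
  have m' [measurable]: "\<Phi>2 p \<in> borel_measurable lborel" "\<Phi>3 p \<in> borel_measurable lborel" for p
    using measurable_Pair2[OF m(1), of p] measurable_Pair2[OF m(2), of p] by (auto simp: space_pair_measure)
  have m2 [measurable]: "first_weight \<sigma> l p \<in> borel_measurable lborel" for p
    using measurable_Pair2[OF measurable_first_weight[OF \<sigma>], of p] by (auto simp: space_pair_measure)
  have "truncated \<sigma> l \<Phi>1 \<le> (\<integral>\<^sup>+p. (\<integral>\<^sup>+x. \<Phi>2 p x * first_weight \<sigma> l p x + \<Phi>3 p x * first_weight \<sigma> l p x \<partial>lborel) \<partial>?P)"
    unfolding truncated_def
  proof (intro nn_integral_mono)
    fix p x
    show "\<Phi>1 p x * first_weight \<sigma> l p x \<le> \<Phi>2 p x * first_weight \<sigma> l p x + \<Phi>3 p x * first_weight \<sigma> l p x"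
      using le[of p x] rho_support[of "snd p"] mult_right_mono[of "\<Phi>1 p x" "\<Phi>2 p x + \<Phi>3 p x" "first_weight \<sigma> l p x"]
      by (cases "snd p \<in> {-C..C}") (auto simp: distrib_right first_weight_def)
  qed
  also have "\<dots> = (\<integral>\<^sup>+p. (\<integral>\<^sup>+x. \<Phi>2 p x * first_weight \<sigma> l p x \<partial>lborel) + (\<integral>\<^sup>+x. \<Phi>3 p x * first_weight \<sigma> l p x \<partial>lborel) \<partial>?P)"
    by (intro nn_integral_cong nn_integral_add) measurable
  also have "\<dots> = truncated \<sigma> l \<Phi>2 + truncated \<sigma> l \<Phi>3"
    unfolding truncated_def by (intro nn_integral_add) measurable
  finally show ?thesis .
qed

abbreviation max_loss :: real where
  "max_loss \<equiv> real N * (2 * C)"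

lemma first_weight_le:
  "first_weight \<sigma> l p x \<le> ennreal max_loss * ennreal (gauss 1 (arm_mean (param p) l) x * \<rho> (snd p))"
proof (cases "snd p \<in> {-C..C}")
  case True
  let ?b = "ennreal \<bar>fst (param p) - snd (param p)\<bar>"
  have "ennreal (gap (param p) l) + regret \<sigma> (param p) (N - 1) 1 (first_hist l x) \<le> ?b + of_nat (N - 1) * ?b"
    by (intro add_mono regret_le ennreal_leI gap_le)
  also have "\<dots> = of_nat (Suc (N - 1)) * ?b" by (simp add: distrib_right)
  also have "\<dots> = of_nat N * ?b" using M N by (simp add: Suc_diff_1)
  also have "\<dots> \<le> ennreal max_loss"
    using True by (auto simp: ennreal_of_nat_eq_real_of_nat ennreal_mult'[symmetric] intro!: ennreal_leI mult_left_mono)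
  finally show ?thesis unfolding first_weight_def by (intro mult_right_mono) auto
qed (simp add: first_weight_def rho_support)

text \<open>With \<open>x\<close> restricted, \<open>m\<close> is integrated first by
  \<open>gauss_swap\<close>; with \<open>m\<close> restricted, \<open>x\<close> is. Either inner
  second moment is 1, and an interval of length at most 2 a, divided by \<open>a\<close>, leaves the
  factor 2.\<close>

lemma truncated_square_le:
  assumes \<sigma>: "measurable_strategy \<sigma>" and a: "0 < a"
  shows "0 \<le> A \<Longrightarrow> A \<le> a \<Longrightarrow> truncated \<sigma> l (\<lambda>p x. ennreal (indicator {-A..A} x * (x - arm_mean (param p) l)\<^sup>2 / a)) \<le> ennreal (2 * max_loss)"
    (is "_ \<Longrightarrow> _ \<Longrightarrow> ?L1 \<le> _")
    and "truncated \<sigma> l (\<lambda>p x. ennreal (indicator {-a..a} (fst p) * (x - arm_mean (param p) l)\<^sup>2 / a)) \<le> ennreal (2 * max_loss)"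
    (is "?L2 \<le> _")
proof -
  let ?P = "lborel \<Otimes>\<^sub>M lborel :: (real \<times> real) measure"
  interpret PS: pair_sigma_finite ?P "lborel :: real measure"
    unfolding lborel_prod by (rule lborel_pair.pair_sigma_finite_axioms)
  have B: "0 \<le> max_loss" using C_pos by simp
  have B2: "ennreal max_loss * ennreal 2 = ennreal (2 * max_loss)"
    by (subst ennreal_mult[symmetric]) (use B in \<open>simp_all add: mult.commute\<close>)
  let ?w = "\<lambda>p x. (x - arm_mean (param p) l)\<^sup>2 * gauss 1 (arm_mean (param p) l) x"
  have le: "truncated \<sigma> l (\<lambda>p x. ennreal (f p x * (x - arm_mean (param p) l)\<^sup>2 / a)) \<le>
      ennreal max_loss * (\<integral>\<^sup>+p. (\<integral>\<^sup>+x. ennreal (f p x / a * \<rho> (snd p)) * ennreal (?w p x) \<partial>lborel) \<partial>?P)"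
    if f: "\<And>p x. 0 \<le> f p x" and [measurable]: "case_prod f \<in> borel_measurable (?P \<Otimes>\<^sub>M lborel)" for f
  proof -
    have m' [measurable]: "f p \<in> borel_measurable lborel" for p
      using measurable_Pair2[OF that(2), of p] by (auto simp: space_pair_measure)
    have "truncated \<sigma> l (\<lambda>p x. ennreal (f p x * (x - arm_mean (param p) l)\<^sup>2 / a)) \<le>
      (\<integral>\<^sup>+p. (\<integral>\<^sup>+x. ennreal max_loss * (ennreal (f p x / a * \<rho> (snd p)) * ennreal (?w p x)) \<partial>lborel) \<partial>?P)"
      unfolding truncated_def
    proof (intro nn_integral_mono)
      fix p x
      have "ennreal (f p x * (x - arm_mean (param p) l)\<^sup>2 / a) * first_weight \<sigma> l p x \<le>
        ennreal (f p x * (x - arm_mean (param p) l)\<^sup>2 / a) *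
          (ennreal max_loss * ennreal (gauss 1 (arm_mean (param p) l) x * \<rho> (snd p)))"
        by (intro mult_left_mono first_weight_le) simp
      also have "\<dots> = ennreal max_loss * (ennreal (f p x / a * \<rho> (snd p)) * ennreal (?w p x))"
        using a B f[of p x] by (simp add: ennreal_mult'[symmetric] mult_ac)
      finally show "ennreal (f p x * (x - arm_mean (param p) l)\<^sup>2 / a) * first_weight \<sigma> l p x \<le>
        ennreal max_loss * (ennreal (f p x / a * \<rho> (snd p)) * ennreal (?w p x))" .
    qed
    also have "\<dots> = (\<integral>\<^sup>+p. ennreal max_loss * (\<integral>\<^sup>+x. (ennreal (f p x / a * \<rho> (snd p)) * ennreal (?w p x)) \<partial>lborel) \<partial>?P)"
      by (intro nn_integral_cong nn_integral_cmult) measurable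
    also have "\<dots> = ennreal max_loss * (\<integral>\<^sup>+p. (\<integral>\<^sup>+x. ennreal (f p x / a * \<rho> (snd p)) * ennreal (?w p x) \<partial>lborel) \<partial>?P)"
      by (intro nn_integral_cmult) measurable
    finally show ?thesis .
  qed
  have ind: "(\<integral>\<^sup>+x. ennreal (indicator {-A..A} x / a) \<partial>lborel) = ennreal (2 * A / a)" if "0 \<le> A" for A
  proof -
    have "(\<integral>\<^sup>+x. ennreal (indicator {-A..A} x / a) \<partial>lborel) = (\<integral>\<^sup>+x. ennreal (1 / a) * indicator {-A..A} x \<partial>lborel)"
      by (intro nn_integral_cong) (auto split: split_indicator)
    also have "\<dots> = ennreal (1 / a) * ennreal (2 * A)" using that by (simp add: nn_integral_cmult)
    also have "\<dots> = ennreal (2 * A / a)" using a that by (simp add: ennreal_mult'[symmetric])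
    finally show ?thesis .
  qed
  { assume A: "0 \<le> A" "A \<le> a"
    have "?L1 \<le> ennreal max_loss * (\<integral>\<^sup>+p. (\<integral>\<^sup>+x. ennreal (indicator {-A..A} x / a * \<rho> (snd p)) * ennreal (?w p x) \<partial>lborel) \<partial>?P)"
      by (rule le[of "\<lambda>p x. indicator {-A..A} x"]) auto
    also have "(\<integral>\<^sup>+p. (\<integral>\<^sup>+x. ennreal (indicator {-A..A} x / a * \<rho> (snd p)) * ennreal (?w p x) \<partial>lborel) \<partial>?P) =
      (\<integral>\<^sup>+x. (\<integral>\<^sup>+p. ennreal (indicator {-A..A} x / a * \<rho> (snd p)) * ennreal (?w p x) \<partial>?P) \<partial>lborel)"
      by (rule PS.Fubini'[symmetric]) measurable
    also have "\<dots> = (\<integral>\<^sup>+x. ennreal (indicator {-A..A} x / a) \<partial>lborel)"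
    proof (intro nn_integral_cong)
      fix x
      have "(\<integral>\<^sup>+p. ennreal (indicator {-A..A} x / a * \<rho> (snd p)) * ennreal (?w p x) \<partial>?P) =
        (\<integral>\<^sup>+v. (\<integral>\<^sup>+m. ennreal (indicator {-A..A} x / a * \<rho> v) * ennreal (?w (m, v) x) \<partial>lborel) \<partial>lborel)"
        by (subst lborel_pair.nn_integral_snd[symmetric]) simp_all
      also have "\<dots> = (\<integral>\<^sup>+v. ennreal (indicator {-A..A} x / a * \<rho> v) \<partial>lborel)"
      proof (intro nn_integral_cong)
        fix v
        let ?s = "arm_sign l * v"
        have "?w (m, v) x = (m - (x + ?s))\<^sup>2 * gauss 1 (x + ?s) m" for m
          unfolding fst_conv snd_conv arm_mean_shift gauss_swap by (simp add: power2_eq_square algebra_simps)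
        then show "(\<integral>\<^sup>+m. ennreal (indicator {-A..A} x / a * \<rho> v) * ennreal (?w (m, v) x) \<partial>lborel) = ennreal (indicator {-A..A} x / a * \<rho> v)"
          by (simp only:) (subst nn_integral_cmult, measurable, simp add: nn_integral_gauss_square)
      qed
      also have "\<dots> = ennreal (indicator {-A..A} x / a)"
      proof -
        have k: "0 \<le> indicator {-A..A} x / a" using a by simp
        show ?thesis unfolding ennreal_mult[OF k rho_nonneg] by (simp add: nn_integral_cmult rho_total)
      qed
      finally show "(\<integral>\<^sup>+p. ennreal (indicator {-A..A} x / a * \<rho> (snd p)) * ennreal (?w p x) \<partial>?P) = ennreal (indicator {-A..A} x / a)" .
    qed
    also have "\<dots> = ennreal (2 * A / a)" by (rule ind[OF A(1)])
    also have "ennreal max_loss * ennreal (2 * A / a) \<le> ennreal max_loss * ennreal 2"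
      using A a by (intro mult_left_mono ennreal_leI) (auto simp: divide_le_eq)
    finally show "?L1 \<le> ennreal (2 * max_loss)" unfolding B2 . }
  have "?L2 \<le> ennreal max_loss * (\<integral>\<^sup>+p. (\<integral>\<^sup>+x. ennreal (indicator {-a..a} (fst p) / a * \<rho> (snd p)) * ennreal (?w p x) \<partial>lborel) \<partial>?P)"
    by (rule le[of "\<lambda>p x. indicator {-a..a} (fst p)"]) auto
  also have "(\<integral>\<^sup>+p. (\<integral>\<^sup>+x. ennreal (indicator {-a..a} (fst p) / a * \<rho> (snd p)) * ennreal (?w p x) \<partial>lborel) \<partial>?P) =
     (\<integral>\<^sup>+p. ennreal (indicator {-a..a} (fst p) / a * \<rho> (snd p)) \<partial>?P)"
    by (intro nn_integral_cong, subst nn_integral_cmult, measurable) (simp add: nn_integral_gauss_square)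
  also have "\<dots> = (\<integral>\<^sup>+v. (\<integral>\<^sup>+m. ennreal (\<rho> v) * ennreal (indicator {-a..a} m / a) \<partial>lborel) \<partial>lborel)"
    using a by (subst lborel_pair.nn_integral_snd[symmetric]) (simp_all add: ennreal_mult'[symmetric] mult.commute)
  also have "\<dots> = ennreal 2"
    using ind[of a] a by (simp add: nn_integral_cmult nn_integral_multc rho_total)
  finally show "?L2 \<le> ennreal (2 * max_loss)" unfolding B2 .
qed

section \<open>The flat-prior value of the initial stage\<close>

text \<open>Two packets at the gap without information, followed by optimal play; M / 2 is the
  precision at the counts (M, M), hence the variance that \<open>U_stat\<close> then has.\<close>

definition limit_value :: ennreal where
  "limit_value = of_nat (2 * M) * weighted_gap \<rho> Arm1 0 0 +
     smooth (real M / 2) (\<lambda>u. opt_value \<rho> M ((N - 2 * M) div M) u (\<lambda>_. M)) 0"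

lemma first_packet_value: "packet_value \<rho> (opt_value \<rho> M ((N - 1) div M)) l M 0 (\<lambda>_. 0) = limit_value"
proof -
  define K where "K = (N - 2 * M) div M"
  let ?c = "(\<lambda>_. 0)(l := M)"
  obtain q where q: "N = M * q" using dvd by auto
  have "2 \<le> q" using N M unfolding q by (metis mult.commute mult_le_cancel1 not_one_le_zero zero_less_iff_neq_zero)
  then obtain q' where q': "q = Suc (Suc q')" by (metis add_2_eq_Suc le_Suc_ex)
  have K: "K = q'" unfolding K_def q q' using M by simp
  \<comment> \<open>Subtracting 1 from \<open>N\<close> makes the quotient count the
    \<open>Suc K\<close> packets after the first one.\<close>
  have d: "(N - 1) div M = Suc K"
    using M unfolding K q q' by (intro div_nat_eqI) (simp_all add: algebra_simps)
  have 1: "precision (\<lambda>_. 0) = 0" "precision ?c = 0"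
    by (rule precision_eq_0[of _ Arm1], simp) (rule precision_eq_0[of _ "other_arm l"], simp)
  have 2: "?c(other_arm l := ?c (other_arm l) + M) = (\<lambda>_. M)"
    by (auto simp: fun_eq_iff neq_other_arm_iff)
  have 3: "precision (\<lambda>_. M) = real M / 2" using M by (simp add: precision_def)
  have w: "weighted_gap \<rho> l 0 0 = weighted_gap \<rho> Arm1 0 0" "weighted_gap \<rho> (other_arm l) 0 0 = weighted_gap \<rho> Arm1 0 0"
    by (rule weighted_gap_0)+
  have "opt_value \<rho> M (Suc K) 0 ?c = packet_value \<rho> (opt_value \<rho> M K) (other_arm l) M 0 ?c"
    using packet_value_unobserved[of ?c l M K] by (intro opt_value_eq) (simp del: fun_upd_apply add: fun_upd_other[OF other_arm_neq(1)])
  also have "\<dots> = of_nat M * weighted_gap \<rho> Arm1 0 0 + smooth (real M / 2) (\<lambda>u. opt_value \<rho> M K u (\<lambda>_. M)) 0"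
    unfolding packet_value_def 2 1 3 w by simp
  finally show ?thesis
    unfolding d packet_value_def limit_value_def K_def[symmetric]
    by (simp add: 1 w del: opt_value.simps) (simp add: distrib_right mult_2 add.assoc)
qed

text \<open>The first income leaves \<open>U_stat\<close> at 0, so the first step and the remaining
  \<open>M - 1\<close> steps of its packet add up to a full packet from the empty counts.\<close>

lemma first_step_value:
  "weighted_gap \<rho> l 0 0 + hist_value M (N - 1) 1 (first_hist l x) = limit_value"
proof -
  have p: "precision (\<lambda>_. 0) = 0" "precision ((\<lambda>_. 0)(l := 1)) = 0"
    by (rule precision_eq_0[of _ Arm1], simp) (rule precision_eq_0[of _ "other_arm l"], simp)
  have "1 + (N - 1) mod M = M"
    using hist_value_Suc_dvd(2)[of M "N - 1"] M N dvd by (simp add: Suc_diff_1)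
  then show ?thesis
    using packet_value_split[where F = "opt_value \<rho> M ((N - 1) div M)" and i = 1 and j = "(N - 1) mod M" and l = l
        and U = 0 and c = "\<lambda>_. 0", OF measurable_opt_value]
    unfolding hist_value_def U_stat_first arm_count_first first_packet_value[of l, symmetric]
    by (simp add: p first_hist_def del: One_nat_def)
qed

text \<open>For each fixed first income the flat prior gives a bound that depends neither on
  \<open>x\<close> nor on \<open>l\<close>; truncation in \<open>x\<close> therefore only
  contributes the length of the interval.\<close>

lemma nn_integral_first_weight:
  assumes \<sigma>: "\<sigma> \<in> packet_strategies M"
  shows "limit_value \<le> (\<integral>\<^sup>+p. first_weight \<sigma> l p x \<partial>(lborel \<Otimes>\<^sub>M lborel))"
    and "\<sigma> \<in> limiting_strategies C \<rho> M N \<Longrightarrow> (\<integral>\<^sup>+p. first_weight \<sigma> l p x \<partial>(lborel \<Otimes>\<^sub>M lborel)) = limit_value"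
proof -
  let ?P = "lborel \<Otimes>\<^sub>M lborel :: (real \<times> real) measure"
  note m = packet_strategy_measurable[OF \<sigma>]
  note [measurable] = measurable_regret'[OF m]
  have p: "precision ((\<lambda>_. 0)(l := 1)) = 0" by (rule precision_eq_0[of _ "other_arm l"], simp)
  have [measurable]: "(\<lambda>p. regret \<sigma> (param p) (N - 1) 1 (first_hist l x)) \<in> borel_measurable ?P"
    using first_hist_space by measurable
  have "(\<integral>\<^sup>+p. first_weight \<sigma> l p x \<partial>?P) =
     (\<integral>\<^sup>+p. ennreal (gap (param p) l) * ennreal (likelihood (param p) 1 (first_hist l x) * \<rho> (snd p)) \<partial>?P) +
     bayes_regret \<sigma> (N - 1) 1 (first_hist l x)"
    unfolding first_weight_def bayes_regret_def likelihood_first distrib_right by (intro nn_integral_add) measurable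
  also have "\<dots> = weighted_gap \<rho> l 0 0 + bayes_regret \<sigma> (N - 1) 1 (first_hist l x)"
    unfolding nn_integral_gap_likelihood[OF zero_less_one] evidence_first U_stat_first arm_count_first p by simp
  finally have e: "(\<integral>\<^sup>+p. first_weight \<sigma> l p x \<partial>?P) = weighted_gap \<rho> l 0 0 + bayes_regret \<sigma> (N - 1) 1 (first_hist l x)" .
  have "hist_value M (N - 1) 1 (first_hist l x) \<le> bayes_regret \<sigma> (N - 1) 1 (first_hist l x)"
    using bayes_regret_ge[OF \<sigma> M, of 1 "N - 1" "first_hist l x"] first_hist_space M N dvd
    by (simp add: evidence_first del: One_nat_def)
  then show "limit_value \<le> (\<integral>\<^sup>+p. first_weight \<sigma> l p x \<partial>?P)"
    unfolding e first_step_value[of l x, symmetric] by (intro add_left_mono)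
  assume "\<sigma> \<in> limiting_strategies C \<rho> M N"
  from limiting_strategy_optimal[OF this first_hist_space, of l x]
  show "(\<integral>\<^sup>+p. first_weight \<sigma> l p x \<partial>?P) = limit_value"
    unfolding e first_step_value[of l x, symmetric] by (simp add: evidence_first del: One_nat_def)
qed

lemma truncated_first:
  assumes \<sigma>: "\<sigma> \<in> packet_strategies M" and A: "0 \<le> A"
  shows "ennreal (2 * A) * limit_value \<le> truncated \<sigma> l (\<lambda>p x. indicator {-A..A} x)"
    and "\<sigma> \<in> limiting_strategies C \<rho> M N \<Longrightarrow> truncated \<sigma> l (\<lambda>p x. indicator {-A..A} x) = ennreal (2 * A) * limit_value"
proof -
  let ?P = "lborel \<Otimes>\<^sub>M lborel :: (real \<times> real) measure"
  interpret PS: pair_sigma_finite ?P "lborel :: real measure"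
    unfolding lborel_prod by (rule lborel_pair.pair_sigma_finite_axioms)
  note m = packet_strategy_measurable[OF \<sigma>]
  note [measurable] = measurable_first_weight'[OF m]
  have [measurable]: "(\<lambda>p. first_weight \<sigma> l p x) \<in> borel_measurable ?P" for x by measurable
  have "truncated \<sigma> l (\<lambda>p x. indicator {-A..A} x) = (\<integral>\<^sup>+x. (\<integral>\<^sup>+p. indicator {-A..A} x * first_weight \<sigma> l p x \<partial>?P) \<partial>lborel)"
    unfolding truncated_def by (rule PS.Fubini'[symmetric]) measurable
  also have "\<dots> = (\<integral>\<^sup>+x. indicator {-A..A} x * (\<integral>\<^sup>+p. first_weight \<sigma> l p x \<partial>?P) \<partial>lborel)"
    by (intro nn_integral_cong nn_integral_cmult) measurable
  finally have e: "truncated \<sigma> l (\<lambda>p x. indicator {-A..A} x) = (\<integral>\<^sup>+x. indicator {-A..A} x * (\<integral>\<^sup>+p. first_weight \<sigma> l p x \<partial>?P) \<partial>lborel)" .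
  have c: "(\<integral>\<^sup>+x. indicator {-A..A} x * limit_value \<partial>lborel) = ennreal (2 * A) * limit_value"
    using A by (simp add: nn_integral_multc)
  show "ennreal (2 * A) * limit_value \<le> truncated \<sigma> l (\<lambda>p x. indicator {-A..A} x)"
    unfolding e c[symmetric] by (intro nn_integral_mono mult_left_mono nn_integral_first_weight \<sigma>) simp
  assume "\<sigma> \<in> limiting_strategies C \<rho> M N"
  then show "truncated \<sigma> l (\<lambda>p x. indicator {-A..A} x) = ennreal (2 * A) * limit_value"
    unfolding e c[symmetric] by (simp only: nn_integral_first_weight(2)[OF \<sigma>])
qed

text \<open>The factor 2 a removes the normalization of the uniform prior and leaves the truncation
  of \<open>m\<close>; unfolding one step of \<open>regret\<close> exposes the first income.\<close>

lemma bayes_loss_eq: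
  assumes \<sigma>: "measurable_strategy \<sigma>" and a: "0 < a"
  shows "ennreal (2 * a) * ennreal (bayes_loss N (uniform_prior \<rho> a) \<sigma>) =
      (\<Sum>l\<in>UNIV. ennreal (pmf (\<sigma> 0 no_hist) l) * truncated \<sigma> l (\<lambda>p x. indicator {-a..a} (fst p)))"
    and "0 \<le> bayes_loss N (uniform_prior \<rho> a) \<sigma>"
proof -
  let ?P = "lborel \<Otimes>\<^sub>M lborel :: (real \<times> real) measure"
  let ?\<nu> = "\<lambda>p. uniform_prior \<rho> a (fst p) (snd p)"
  note [measurable] = measurable_regret'[OF \<sigma>] measurable_first_weight'[OF \<sigma>]
  have fw [measurable]: "first_weight \<sigma> l p \<in> borel_measurable lborel" for l p
    using measurable_Pair2[OF measurable_first_weight[OF \<sigma>], of p] by (auto simp: space_pair_measure)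
  have r [measurable]: "(\<lambda>p. regret \<sigma> (param p) N 0 no_hist) \<in> borel_measurable ?P"
    using no_hist_space by measurable
  have [measurable]: "?\<nu> \<in> borel_measurable ?P" unfolding uniform_prior_def by measurable
  have \<nu>: "0 \<le> ?\<nu> p" for p using a by (simp add: uniform_prior_def)
  define I where "I = (\<integral>\<^sup>+p. regret \<sigma> (param p) N 0 no_hist * ennreal (?\<nu> p) \<partial>?P)"
  have "bayes_loss N (uniform_prior \<rho> a) \<sigma> = (\<integral>p. enn2real (regret \<sigma> (param p) N 0 no_hist) * ?\<nu> p \<partial>?P)"
    unfolding bayes_loss_def by (simp add: split_beta' loss_eq[OF \<sigma>])
  also have "\<dots> = enn2real (\<integral>\<^sup>+p. ennreal (enn2real (regret \<sigma> (param p) N 0 no_hist) * ?\<nu> p) \<partial>?P)"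
    using \<nu> by (intro integral_eq_nn_integral) auto
  also have "(\<integral>\<^sup>+p. ennreal (enn2real (regret \<sigma> (param p) N 0 no_hist) * ?\<nu> p) \<partial>?P) = I"
    unfolding I_def using regret_finite \<nu> by (intro nn_integral_cong) (simp add: ennreal_mult)
  finally have bl: "bayes_loss N (uniform_prior \<rho> a) \<sigma> = enn2real I" .
  then show "0 \<le> bayes_loss N (uniform_prior \<rho> a) \<sigma>" by simp
  have total: "(\<integral>\<^sup>+p. ennreal (?\<nu> p) \<partial>?P) = 1"
  proof -
    have "(\<integral>\<^sup>+p. ennreal (?\<nu> p) \<partial>?P) = (\<integral>\<^sup>+v. (\<integral>\<^sup>+m. ennreal (\<rho> v) * (ennreal (1 / (2 * a)) * indicator {-a..a} m) \<partial>lborel) \<partial>lborel)"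
      unfolding uniform_prior_def using a
      by (subst lborel_pair.nn_integral_snd[symmetric])
         (auto simp: ennreal_mult'[symmetric] intro!: nn_integral_cong split: split_indicator)
    also have "\<dots> = 1"
      using a by (simp add: nn_integral_cmult nn_integral_multc rho_total ennreal_mult'[symmetric])
    finally show ?thesis .
  qed
  have "I \<le> (\<integral>\<^sup>+p. ennreal max_loss * ennreal (?\<nu> p) \<partial>?P)"
    unfolding I_def
  proof (intro nn_integral_mono)
    fix p
    show "regret \<sigma> (param p) N 0 no_hist * ennreal (?\<nu> p) \<le> ennreal max_loss * ennreal (?\<nu> p)"
    proof (cases "snd p \<in> {-C..C}")
      case True
      have "regret \<sigma> (param p) N 0 no_hist \<le> of_nat N * ennreal \<bar>fst (param p) - snd (param p)\<bar>" by (rule regret_le)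
      also have "\<dots> \<le> ennreal max_loss"
        using True by (auto simp: ennreal_of_nat_eq_real_of_nat ennreal_mult'[symmetric] intro!: ennreal_leI mult_left_mono)
      finally show ?thesis by (intro mult_right_mono) auto
    qed (simp add: rho_support uniform_prior_def)
  qed
  also have "\<dots> = ennreal max_loss" by (simp add: nn_integral_cmult total)
  finally have "I < \<infinity>" by (simp add: le_less_trans)
  then have I: "ennreal (bayes_loss N (uniform_prior \<rho> a) \<sigma>) = I" unfolding bl by simp
  have N': "N = Suc (N - 1)" using M N by simp
  have "ennreal (2 * a) * I = (\<integral>\<^sup>+p. ennreal (2 * a) * (regret \<sigma> (param p) N 0 no_hist * ennreal (?\<nu> p)) \<partial>?P)"
    unfolding I_def by (intro nn_integral_cmult[symmetric]) measurable
  also have "\<dots> = (\<integral>\<^sup>+p. (\<Sum>l\<in>UNIV. ennreal (pmf (\<sigma> 0 no_hist) l) *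
      (\<integral>\<^sup>+x. indicator {-a..a} (fst p) * first_weight \<sigma> l p x \<partial>lborel)) \<partial>?P)"
  proof (intro nn_integral_cong)
    fix p
    have n: "ennreal (2 * a) * ennreal (?\<nu> p) = indicator {-a..a} (fst p) * ennreal (\<rho> (snd p))"
      using a by (auto simp: uniform_prior_def ennreal_mult'[symmetric] split: split_indicator)
    have "regret \<sigma> (param p) N 0 no_hist * ennreal (\<rho> (snd p)) =
      (\<Sum>l\<in>UNIV. ennreal (pmf (\<sigma> 0 no_hist) l) * (\<integral>\<^sup>+x. first_weight \<sigma> l p x \<partial>lborel))"
    proof (subst N', unfold regret.simps sum_distrib_right, intro sum.cong refl)
      fix l
      let ?g = "\<lambda>x. ennreal (gauss 1 (arm_mean (param p) l) x) * (ennreal (gap (param p) l) + regret \<sigma> (param p) (N - 1) 1 (first_hist l x))"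
      have [measurable]: "(\<lambda>x. regret \<sigma> (param p) (N - 1) 1 (first_hist l x)) \<in> borel_measurable lborel"
        by (rule measurable_regret'[OF \<sigma>])
           (use measurable_first_hist[of l] in \<open>auto simp: space_pair_measure simp del: One_nat_def\<close>)
      have "(\<integral>\<^sup>+x. first_weight \<sigma> l p x \<partial>lborel) = (\<integral>\<^sup>+x. ?g x * ennreal (\<rho> (snd p)) \<partial>lborel)"
        by (intro nn_integral_cong) (simp add: first_weight_def ennreal_mult mult_ac)
      also have "\<dots> = (\<integral>\<^sup>+x. ?g x \<partial>lborel) * ennreal (\<rho> (snd p))"
        by (intro nn_integral_multc) measurable
      finally show "ennreal (pmf (\<sigma> 0 no_hist) l) * (\<integral>\<^sup>+x. ennreal (gauss 1 (arm_mean (param p) l) x) *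
          (ennreal (gap (param p) l) + regret \<sigma> (param p) (N - 1) (Suc 0) (no_hist(0 := (l, x)))) \<partial>lborel) * ennreal (\<rho> (snd p)) =
        ennreal (pmf (\<sigma> 0 no_hist) l) * (\<integral>\<^sup>+x. first_weight \<sigma> l p x \<partial>lborel)"
        by (simp add: first_hist_def mult.assoc)
    qed
    then have "ennreal (2 * a) * (regret \<sigma> (param p) N 0 no_hist * ennreal (?\<nu> p)) =
      indicator {-a..a} (fst p) * (\<Sum>l\<in>UNIV. ennreal (pmf (\<sigma> 0 no_hist) l) * (\<integral>\<^sup>+x. first_weight \<sigma> l p x \<partial>lborel))"
      by (metis (no_types, lifting) n mult.left_commute)
    then show "ennreal (2 * a) * (regret \<sigma> (param p) N 0 no_hist * ennreal (?\<nu> p)) =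
      (\<Sum>l\<in>UNIV. ennreal (pmf (\<sigma> 0 no_hist) l) * (\<integral>\<^sup>+x. indicator {-a..a} (fst p) * first_weight \<sigma> l p x \<partial>lborel))"
      by (simp add: sum_distrib_left nn_integral_cmult mult.left_commute)
  qed
  also have "\<dots> = (\<Sum>l\<in>UNIV. ennreal (pmf (\<sigma> 0 no_hist) l) * truncated \<sigma> l (\<lambda>p x. indicator {-a..a} (fst p)))"
    unfolding truncated_def by (subst nn_integral_sum, measurable) (subst nn_integral_cmult, measurable)
  finally show "ennreal (2 * a) * ennreal (bayes_loss N (uniform_prior \<rho> a) \<sigma>) =
      (\<Sum>l\<in>UNIV. ennreal (pmf (\<sigma> 0 no_hist) l) * truncated \<sigma> l (\<lambda>p x. indicator {-a..a} (fst p)))"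
    unfolding I .
qed

text \<open>Each of the 2 M initial applications costs twice the integral of
  \<open>v * \<rho> v\<close> over [0, C], which explains the factor 4 M in
  \<open>limit_risk\<close>.\<close>

lemma limit_value_eq: "limit_value = ennreal (limit_risk C \<rho> M N)" "0 \<le> limit_risk C \<rho> M N"
proof -
  define K where "K = (N - 2 * M) div M"
  let ?c = "\<lambda>_ :: arm. M" and ?F = "\<lambda>u. R_min C \<rho> M N u M M"
  have "M dvd N - 2 * M" using dvd by (simp add: dvd_diff_nat)
  then have NK: "N = steps ?c + K * M" unfolding K_def using N by simp
  have R: "R_min C \<rho> M N u M M = enn2real (opt_value \<rho> M K u ?c)" for u
    using R_eq_opt_value(1)[OF M _ _ NK] M by simp
  have [measurable]: "?F \<in> borel_measurable borel" unfolding R by measurable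
  have e: "ennreal (?F u) = opt_value \<rho> M K u ?c" for u
    using opt_value_finite[of M K u ?c] unfolding R by simp
  have s: "0 < real M / 2" using M by simp
  \<comment> \<open>With one count reset to 0, a packet raises the precision from 0 to M / 2; the
    smoothing is then a summand of a packet value already known to be finite.\<close>
  have z: "precision ((?c(Arm2 := 0))(Arm2 := (?c(Arm2 := 0)) Arm2 + M)) - precision (?c(Arm2 := 0)) = real M / 2"
    "(?c(Arm2 := 0))(Arm2 := (?c(Arm2 := 0)) Arm2 + M) = ?c"
    using M by (auto simp: precision_def)
  have "smooth (real M / 2) (\<lambda>u. opt_value \<rho> M K u ?c) 0 \<le> packet_value \<rho> (opt_value \<rho> M K) Arm2 M 0 (?c(Arm2 := 0))"
    unfolding packet_value_def unfolding z(1) unfolding z(2) by simp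
  then have fin: "smooth (real M / 2) (\<lambda>u. ennreal (?F u)) 0 < \<infinity>"
    unfolding e using packet_value_finite by (rule le_less_trans)
  \<comment> \<open>Reflection gives the integral the form \<open>U - x\<close> at
    \<open>U = 0\<close> expected by \<open>smooth_gauss\<close>.\<close>
  have refl: "(\<integral>U. ?F U * gauss (real M / 2) 0 U \<partial>lborel) = (\<integral>x. ?F (0 - x) * gauss (real M / 2) 0 x \<partial>lborel)"
    using lborel_integral_real_affine[of "-1" "\<lambda>U. ?F U * gauss (real M / 2) 0 U" 0]
    by (simp add: gauss_def normal_density_def)
  note S = smooth_gauss[OF _ _ s fin, folded refl]
  have F: "0 \<le> ?F u" for u unfolding R by simp
  have g0: "precision (\<lambda>_. 0) = 0" by (simp add: precision_def)
  have g: "g_fun C \<rho> Arm1 0 0 0 = 2 * (LINT v:{0..C}|lborel. v * \<rho> v)"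
    unfolding g_fun_def set_lebesgue_integral_def
    by (subst Bochner_Integration.integral_mult_right_zero[symmetric]) (simp add: mult_ac)
  have w: "weighted_gap \<rho> Arm1 0 0 = ennreal (2 * (LINT v:{0..C}|lborel. v * \<rho> v))"
    using g_fun_eq[of Arm1 0 "\<lambda>_. 0"] unfolding g g0 by simp
  have w0: "0 \<le> 2 * (LINT v:{0..C}|lborel. v * \<rho> v)" using g_fun_nonneg[of Arm1 0 0 0] unfolding g .
  show "0 \<le> limit_risk C \<rho> M N"
    unfolding limit_risk_def using S(2) F w0 by (intro add_nonneg_nonneg mult_nonneg_nonneg) auto
  have "limit_value = ennreal (real (2 * M)) * ennreal (2 * (LINT v:{0..C}|lborel. v * \<rho> v)) +
      ennreal (\<integral>U. ?F U * gauss (real M / 2) 0 U \<partial>lborel)"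
    unfolding limit_value_def K_def[symmetric] w S(1)[OF _ F] e[symmetric]
    by (simp add: S(1) F ennreal_of_nat_eq_real_of_nat)
  also have "\<dots> = ennreal (limit_risk C \<rho> M N)"
    unfolding limit_risk_def using S(2) F w0
    by (subst ennreal_mult[symmetric]) (auto simp: ennreal_plus[symmetric] simp del: ennreal_plus intro!: arg_cong[where f=ennreal])
  finally show "limit_value = ennreal (limit_risk C \<rho> M N)" .
qed

section \<open>Chebyshev comparison and passage to the limit\<close>

lemma square_div_ge_1:
  assumes "0 < a" "sqrt a \<le> \<bar>y\<bar>"
  shows "1 \<le> y\<^sup>2 / (a :: real)"
proof -
  have "(sqrt a)\<^sup>2 \<le> \<bar>y\<bar>\<^sup>2" using assms by (intro power_mono) auto
  then show ?thesis using assms by (simp add: divide_simps)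
qed

lemma arm_mean_close: "snd p \<in> {-C..C} \<Longrightarrow> \<bar>arm_mean (param p) l - fst p\<bar> \<le> C"
  by (cases l) auto

lemma sum_pmf_add: "(\<Sum>l\<in>UNIV. ennreal (pmf q l) * (f l + b)) = (\<Sum>l\<in>UNIV. ennreal (pmf q (l :: arm)) * f l) + b"
  by (simp add: distrib_left sum.distrib sum_distrib_right[symmetric] sum_pmf_arm del: sum_ennreal)

text \<open>Shrinking by \<open>C\<close> accounts for the distance of an arm mean from
  \<open>m\<close>, shrinking by sqrt a for the Chebyshev deviation. Everything is scaled by 2
  inside the proof, so the error \<open>2 * max_loss\<close> ends as
  \<open>max_loss\<close>.\<close>

lemma bayes_loss_lower:
  assumes \<sigma>: "\<sigma> \<in> packet_strategies M" and a: "0 < a" and A: "0 \<le> a - C - sqrt a"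
  shows "(a - C - sqrt a) * limit_risk C \<rho> M N \<le> a * bayes_loss N (uniform_prior \<rho> a) \<sigma> + max_loss"
proof -
  define A where "A = a - C - sqrt a"
  have A: "0 \<le> A" "A \<le> a" using assms C_pos real_sqrt_ge_zero[of a] unfolding A_def by linarith+
  note m = packet_strategy_measurable[OF \<sigma>]
  let ?f = "\<lambda>l. truncated \<sigma> l (\<lambda>p x. indicator {-a..a} (fst p))"
  have "ennreal (2 * A) * limit_value \<le> ?f l + ennreal (2 * max_loss)" for l
  proof -
    have "ennreal (2 * A) * limit_value \<le> truncated \<sigma> l (\<lambda>p x. indicator {-A..A} x)"
      by (rule truncated_first(1)[OF \<sigma> A(1)])
    also have "\<dots> \<le> ?f l + truncated \<sigma> l (\<lambda>p x. ennreal (indicator {-A..A} x * (x - arm_mean (param p) l)\<^sup>2 / a))"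
    proof (rule truncated_add_mono[OF m])
      fix p :: "real \<times> real" and x :: real
      assume p: "snd p \<in> {-C..C}"
      show "indicator {-A..A} x \<le> indicator {-a..a} (fst p) + ennreal (indicator {-A..A} x * (x - arm_mean (param p) l)\<^sup>2 / a)"
      proof (cases "x \<in> {-A..A} \<and> fst p \<notin> {-a..a}")
        case True
        \<comment> \<open>Here |x| <= a - C - sqrt a and |m| > a, while the arm mean is within
          \<open>C\<close> of \<open>m\<close>.\<close>
        then have "sqrt a \<le> \<bar>x - arm_mean (param p) l\<bar>"
          using arm_mean_close[OF p, of l] unfolding A_def by (auto simp: abs_le_iff)
        then show ?thesis using square_div_ge_1[OF a] True by (simp add: ennreal_leI flip: ennreal_1)
      qed (auto split: split_indicator)
    qed measurable
    also have "\<dots> \<le> ?f l + ennreal (2 * max_loss)"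
      by (intro add_left_mono truncated_square_le(1)[OF m a A])
    finally show ?thesis .
  qed
  then have "ennreal (2 * A) * limit_value \<le> (\<Sum>l\<in>UNIV. ennreal (pmf (\<sigma> 0 no_hist) l) * (?f l + ennreal (2 * max_loss)))"
    by (rule ennreal_convex_bounds(1))
  also have "\<dots> = ennreal (2 * a) * ennreal (bayes_loss N (uniform_prior \<rho> a) \<sigma>) + ennreal (2 * max_loss)"
    unfolding sum_pmf_add bayes_loss_eq(1)[OF m a] ..
  finally have "ennreal (2 * A * limit_risk C \<rho> M N) \<le> ennreal (2 * a * bayes_loss N (uniform_prior \<rho> a) \<sigma> + 2 * max_loss)"
    using a A C_pos bayes_loss_eq(2)[OF m a] limit_value_eq(2) unfolding limit_value_eq(1)
    by (simp add: ennreal_mult ennreal_plus)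
  then have "2 * A * limit_risk C \<rho> M N \<le> 2 * a * bayes_loss N (uniform_prior \<rho> a) \<sigma> + 2 * max_loss"
    using a C_pos bayes_loss_eq(2)[OF m a] by (subst (asm) ennreal_le_iff) auto
  then have "2 * (A * limit_risk C \<rho> M N) \<le> 2 * (a * bayes_loss N (uniform_prior \<rho> a) \<sigma>) + 2 * max_loss"
    by (simp only: mult.assoc)
  then show ?thesis unfolding A_def[symmetric] by linarith
qed

text \<open>Mirror image with an enlarged interval. It needs the exact value in
  \<open>truncated_first\<close>, which holds for limiting strategies only.\<close>

lemma bayes_loss_upper:
  assumes \<sigma>: "\<sigma> \<in> limiting_strategies C \<rho> M N" and a: "0 < a"
  shows "a * bayes_loss N (uniform_prior \<rho> a) \<sigma> \<le> (a + C + sqrt a) * limit_risk C \<rho> M N + max_loss"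
proof -
  define A where "A = a + C + sqrt a"
  have A: "0 \<le> A" using assms C_pos by (simp add: A_def)
  have \<sigma>': "\<sigma> \<in> packet_strategies M" using \<sigma> by (simp add: limiting_strategies_def)
  note m = packet_strategy_measurable[OF \<sigma>']
  let ?f = "\<lambda>l. truncated \<sigma> l (\<lambda>p x. indicator {-a..a} (fst p))"
  have "?f l \<le> ennreal (2 * A) * limit_value + ennreal (2 * max_loss)" for l
  proof -
    have "?f l \<le> truncated \<sigma> l (\<lambda>p x. indicator {-A..A} x) +
        truncated \<sigma> l (\<lambda>p x. ennreal (indicator {-a..a} (fst p) * (x - arm_mean (param p) l)\<^sup>2 / a))"
    proof (rule truncated_add_mono[OF m])
      fix p :: "real \<times> real" and x :: real
      assume p: "snd p \<in> {-C..C}"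
      show "indicator {-a..a} (fst p) \<le> indicator {-A..A} x + ennreal (indicator {-a..a} (fst p) * (x - arm_mean (param p) l)\<^sup>2 / a)"
      proof (cases "x \<notin> {-A..A} \<and> fst p \<in> {-a..a}")
        case True
        \<comment> \<open>Here |m| <= a and |x| > a + C + sqrt a, so again the mean and the income
          are at least sqrt a apart.\<close>
        then have "sqrt a \<le> \<bar>x - arm_mean (param p) l\<bar>"
          using arm_mean_close[OF p, of l] unfolding A_def by (auto simp: abs_le_iff)
        then show ?thesis using square_div_ge_1[OF a] True by (simp add: ennreal_leI flip: ennreal_1)
      qed (auto split: split_indicator)
    qed measurable
    also have "\<dots> \<le> ennreal (2 * A) * limit_value + ennreal (2 * max_loss)"
      unfolding truncated_first(2)[OF \<sigma>' A \<sigma>] by (intro add_left_mono truncated_square_le(2)[OF m a])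
    finally show ?thesis .
  qed
  then have "(\<Sum>l\<in>UNIV. ennreal (pmf (\<sigma> 0 no_hist) l) * ?f l) \<le> ennreal (2 * A) * limit_value + ennreal (2 * max_loss)"
    by (rule ennreal_convex_bounds(2))
  then have "ennreal (2 * a * bayes_loss N (uniform_prior \<rho> a) \<sigma>) \<le> ennreal (2 * A * limit_risk C \<rho> M N + 2 * max_loss)"
    using a A C_pos bayes_loss_eq(2)[OF m a] limit_value_eq(2) unfolding bayes_loss_eq(1)[OF m a, symmetric] limit_value_eq(1)
    by (simp add: ennreal_mult ennreal_plus)
  then have "2 * a * bayes_loss N (uniform_prior \<rho> a) \<sigma> \<le> 2 * A * limit_risk C \<rho> M N + 2 * max_loss"
    using A C_pos limit_value_eq(2) by (subst (asm) ennreal_le_iff) auto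
  then have "2 * (a * bayes_loss N (uniform_prior \<rho> a) \<sigma>) \<le> 2 * (A * limit_risk C \<rho> M N) + 2 * max_loss"
    by (simp only: mult.assoc)
  then show ?thesis unfolding A_def[symmetric] by linarith
qed

text \<open>The estimate of \<open>bayes_loss_lower\<close> divided by \<open>a\<close>, arranged so
  that the limit can be taken term by term.\<close>

definition lower_bound :: "real \<Rightarrow> real" where
  "lower_bound a = limit_risk C \<rho> M N - (C * limit_risk C \<rho> M N + max_loss) * inverse a
     - limit_risk C \<rho> M N * inverse (sqrt a)"

definition upper_bound :: "real \<Rightarrow> real" where
  "upper_bound a = limit_risk C \<rho> M N + (C * limit_risk C \<rho> M N + max_loss) * inverse a
     + limit_risk C \<rho> M N * inverse (sqrt a)"

lemma inverse_sqrt: "0 < a \<Longrightarrow> inverse (sqrt a) = sqrt a * inverse (a :: real)"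
  by (metis divide_inverse inverse_eq_divide less_imp_le real_div_sqrt real_sqrt_divide real_sqrt_one sqrt_divide_self_eq)

lemma tendsto_bounds:
  "(lower_bound \<longlongrightarrow> limit_risk C \<rho> M N) at_top" "(upper_bound \<longlongrightarrow> limit_risk C \<rho> M N) at_top"
proof -
  have 1: "((\<lambda>a::real. inverse a) \<longlongrightarrow> 0) at_top" "((\<lambda>a. inverse (sqrt a)) \<longlongrightarrow> 0) at_top"
    by (intro tendsto_inverse_0_at_top filterlim_ident sqrt_at_top)+
  have "(lower_bound \<longlongrightarrow> limit_risk C \<rho> M N - (C * limit_risk C \<rho> M N + max_loss) * 0 - limit_risk C \<rho> M N * 0) at_top"
    unfolding lower_bound_def[abs_def] by (intro tendsto_intros 1)
  then show "(lower_bound \<longlongrightarrow> limit_risk C \<rho> M N) at_top" by simp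
  have "(upper_bound \<longlongrightarrow> limit_risk C \<rho> M N + (C * limit_risk C \<rho> M N + max_loss) * 0 + limit_risk C \<rho> M N * 0) at_top"
    unfolding upper_bound_def[abs_def] by (intro tendsto_intros 1)
  then show "(upper_bound \<longlongrightarrow> limit_risk C \<rho> M N) at_top" by simp
qed

text \<open>The threshold for \<open>a\<close> is the same for all strategies, so the bound survives
  the infimum in \<open>bayes_risk\<close>.\<close>

lemma eventually_lower:
  "eventually (\<lambda>a. \<forall>\<sigma>\<in>packet_strategies M. lower_bound a \<le> bayes_loss N (uniform_prior \<rho> a) \<sigma>) at_top"
proof (rule eventually_mono[OF eventually_ge_at_top[of "4 + 2 * C"]], intro ballI)
  fix a \<sigma> assume a: "4 + 2 * C \<le> a" and \<sigma>: "\<sigma> \<in> packet_strategies M"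
  have a0: "0 < a" using a C_pos by simp
  \<comment> \<open>From a >= 4 follows sqrt a >= 2, hence sqrt a <= a / 2; the other half of the
    threshold gives C <= a / 2.\<close>
  have "sqrt a * 2 \<le> sqrt a * sqrt a"
    using a C_pos by (intro mult_left_mono real_le_rsqrt) auto
  then have A: "0 \<le> a - C - sqrt a" using a a0 by simp
  have "lower_bound a = ((a - C - sqrt a) * limit_risk C \<rho> M N - max_loss) * inverse a"
    unfolding lower_bound_def inverse_sqrt[OF a0] using a0 by (simp add: algebra_simps)
  also have "\<dots> \<le> (a * bayes_loss N (uniform_prior \<rho> a) \<sigma>) * inverse a"
    using bayes_loss_lower[OF \<sigma> a0 A] a0 by (intro mult_right_mono) auto
  also have "\<dots> = bayes_loss N (uniform_prior \<rho> a) \<sigma>" using a0 by (simp add: field_simps)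
  finally show "lower_bound a \<le> bayes_loss N (uniform_prior \<rho> a) \<sigma>" .
qed

lemma eventually_upper:
  assumes \<sigma>: "\<sigma> \<in> limiting_strategies C \<rho> M N"
  shows "eventually (\<lambda>a. bayes_loss N (uniform_prior \<rho> a) \<sigma> \<le> upper_bound a) at_top"
proof (rule eventually_mono[OF eventually_gt_at_top[of 0]])
  fix a :: real assume a0: "0 < a"
  have "bayes_loss N (uniform_prior \<rho> a) \<sigma> = (a * bayes_loss N (uniform_prior \<rho> a) \<sigma>) * inverse a" using a0 by simp
  also have "\<dots> \<le> ((a + C + sqrt a) * limit_risk C \<rho> M N + max_loss) * inverse a"
    using bayes_loss_upper[OF \<sigma> a0] a0 by (intro mult_right_mono) auto
  also have "\<dots> = upper_bound a"
    unfolding upper_bound_def inverse_sqrt[OF a0] using a0 by (simp add: algebra_simps)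
  finally show "bayes_loss N (uniform_prior \<rho> a) \<sigma> \<le> upper_bound a" .
qed

text \<open>Below, the uniform bound over all packet strategies; above, one explicit limiting
  strategy. The infimum is well behaved because Bayesian losses are nonnegative.\<close>

lemma tendsto_bayes_risk: "((\<lambda>a. bayes_risk M N (uniform_prior \<rho> a)) \<longlongrightarrow> limit_risk C \<rho> M N) at_top"
proof (rule tendsto_sandwich[OF _ _ tendsto_bounds])
  show "eventually (\<lambda>a. lower_bound a \<le> bayes_risk M N (uniform_prior \<rho> a)) at_top"
    using eventually_lower
  proof eventually_elim
    case (elim a)
    then show ?case unfolding bayes_risk_def using rule_strategy_packet by (intro cINF_greatest) auto
  qed
  show "eventually (\<lambda>a. bayes_risk M N (uniform_prior \<rho> a) \<le> upper_bound a) at_top"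
    using eventually_upper[OF rule_strategy_limiting[of Arm1]] eventually_gt_at_top[of 0]
  proof eventually_elim
    case (elim a)
    have "bayes_risk M N (uniform_prior \<rho> a) \<le> bayes_loss N (uniform_prior \<rho> a) (rule_strategy Arm1)"
      unfolding bayes_risk_def using bayes_loss_eq(2)[OF packet_strategy_measurable elim(2)]
      by (intro cINF_lower rule_strategy_packet bdd_belowI[of _ 0]) auto
    with elim show ?case by simp
  qed
qed

lemma limiting_strategy_bayesian:
  assumes \<sigma>: "\<sigma> \<in> limiting_strategies C \<rho> M N"
  shows "bayesian_in_limit M N \<rho> \<sigma>"
proof -
  have "((\<lambda>a. bayes_loss N (uniform_prior \<rho> a) \<sigma>) \<longlongrightarrow> limit_risk C \<rho> M N) at_top"
  proof (rule tendsto_sandwich[OF _ eventually_upper[OF \<sigma>] tendsto_bounds])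
    show "eventually (\<lambda>a. lower_bound a \<le> bayes_loss N (uniform_prior \<rho> a) \<sigma>) at_top"
      using eventually_lower by eventually_elim (use \<sigma> in \<open>auto simp: limiting_strategies_def\<close>)
  qed
  from tendsto_diff[OF this tendsto_bayes_risk] show ?thesis
    by (simp add: bayesian_in_limit_def)
qed

end

text \<open>The nonemptiness clause keeps the claim about all limiting strategies from being
  vacuous.\<close>

theorem theorem1:
  fixes C :: real and M N :: nat and \<rho> :: "real \<Rightarrow> real"
  assumes "0 < C"
    and "1 \<le> M" and "2 * M \<le> N" and "M dvd N"
    and "\<rho> \<in> borel_measurable borel"
    and "\<And>v. 0 \<le> \<rho> v"
    and "\<And>v. v \<notin> {-C..C} \<Longrightarrow> \<rho> v = 0"
    and "(\<integral>\<^sup>+v. ennreal (\<rho> v) \<partial>lborel) = 1"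
    and "\<And>v. \<rho> (- v) = \<rho> v"
  shows "limiting_strategies C \<rho> M N \<noteq> {}
    \<and> (\<forall>\<sigma> \<in> limiting_strategies C \<rho> M N. bayesian_in_limit M N \<rho> \<sigma>)
    \<and> (\<forall>n h l. n < N \<and> h \<in> packet_histories M n
          \<and> M \<le> arm_count n h Arm1 \<and> M \<le> arm_count n h Arm2 \<longrightarrow>
          (currently_optimal M N \<rho> n h l \<longleftrightarrow> R_rule C \<rho> M N n h l))
    \<and> ((\<lambda>a. bayes_risk M N (uniform_prior \<rho> a)) \<longlongrightarrow> limit_risk C \<rho> M N) at_top"
proof -
  interpret bandit C \<rho> M N
    using assms by unfold_locales
  show ?thesis
    using rule_strategy_limiting limiting_strategy_bayesian currently_optimal_iff tendsto_bayes_risk by blast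
qed

end
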